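(* Let $X$ be a complex Banach space. Then $X$ has the approximation property if and only if $\mathcal G_0(B_X)$ has the approximation property.
   Context: A Banach space $E$ has the approximation property (AP) if the identity of $E$ can be approximated, uniformly on compact sets, by finite-rank bounded operators on $E$. $B_X$ is the open unit ball of $X$. $\mathcal HL_0(B_X)$ is the Banach space of holomorphic Lipschitz functions $f:B_X\to\mathbb C$ with $f(0)=0$, normed by the Lipschitz constant $L(f)$. With $\tau_0$ the compact-open topology (uniform convergence on compact subsets of $B_X$), $\mathcal G_0(B_X)=\{\varphi\in\mathcal HL_0(B_X)^*: \varphi \text{ restricted to } \{f:L(f)\le1\}\text{ is }\tau_0\text{-continuous}\}$, with the norm of $\mathcal HL_0(B_X)^*$. *)

theory Defs
  imports "HOL-Analysis.Analysis"
begin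

section \<open>Complex normed spaces\<close>

class complex_normed_vector = real_normed_vector +
  fixes scaleC :: "complex \<Rightarrow> 'a \<Rightarrow> 'a" (infixr "*\<^sub>C" 75)
  assumes scaleC_add_right: "c *\<^sub>C (x + y) = c *\<^sub>C x + c *\<^sub>C y"
    and scaleC_add_left: "(c + d) *\<^sub>C x = c *\<^sub>C x + d *\<^sub>C x"
    and scaleC_scaleC: "c *\<^sub>C (d *\<^sub>C x) = (c * d) *\<^sub>C x"
    and scaleR_scaleC: "r *\<^sub>R x = complex_of_real r *\<^sub>C x"
    and norm_scaleC: "norm (c *\<^sub>C x) = cmod c * norm x"

class complex_banach = complex_normed_vector + complete_space

subclass (in complex_banach) banach ..

lemma scaleC_one: "1 *\<^sub>C x = (x :: 'a::complex_normed_vector)"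
  by (metis of_real_1 scaleR_one scaleR_scaleC)

global_interpretation complex_vector: vector_space "scaleC :: complex \<Rightarrow> 'a \<Rightarrow> 'a::complex_normed_vector"
  defines cspan = complex_vector.span
  by unfold_locales (simp_all add: scaleC_add_right scaleC_add_left scaleC_scaleC scaleC_one)

instantiation complex :: complex_banach
begin

definition scaleC_complex :: "complex \<Rightarrow> complex \<Rightarrow> complex"
  where [simp]: "scaleC_complex c x = c * x"

instance
  by standard (simp_all add: algebra_simps norm_mult scaleR_conv_of_real)

end

lemma bounded_linear_scaleC: "bounded_linear (\<lambda>x::'a::complex_normed_vector. c *\<^sub>C x)"
proof (rule bounded_linear_intro[where K = "cmod c"])
  show "c *\<^sub>C (x + y) = c *\<^sub>C x + c *\<^sub>C y" for x y :: 'a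
    by (rule scaleC_add_right)
  show "c *\<^sub>C (r *\<^sub>R x) = r *\<^sub>R (c *\<^sub>C x)" for r and x :: 'a
    by (simp add: scaleR_scaleC scaleC_scaleC mult.commute)
  show "norm (c *\<^sub>C x) \<le> norm x * cmod c" for x :: 'a
    by (simp add: norm_scaleC mult.commute)
qed

definition bounded_clinear :: "('a::complex_normed_vector \<Rightarrow> 'b::complex_normed_vector) \<Rightarrow> bool"
  where "bounded_clinear T \<longleftrightarrow> bounded_linear T \<and> (\<forall>c x. T (c *\<^sub>C x) = c *\<^sub>C T x)"

definition finite_rank :: "('a::complex_normed_vector \<Rightarrow> 'b::complex_normed_vector) \<Rightarrow> bool"
  where "finite_rank T \<longleftrightarrow> (\<exists>B. finite B \<and> range T \<subseteq> cspan B)"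

definition approximation_property :: "'a::complex_banach itself \<Rightarrow> bool"
  where "approximation_property _ \<longleftrightarrow>
    (\<forall>K::'a set. compact K \<longrightarrow>
      (\<forall>e>0. \<exists>T. bounded_clinear T \<and> finite_rank T \<and> (\<forall>x\<in>K. norm (T x - x) < e)))"


section \<open>Holomorphic Lipschitz functions on the unit ball\<close>

text \<open>Holomorphy on an open set of a complex normed space: the function has a bounded
  complex-linear Frechet derivative at each point.\<close>

definition frechet_holomorphic_on ::
    "('a::complex_normed_vector \<Rightarrow> 'b::complex_normed_vector) \<Rightarrow> 'a set \<Rightarrow> bool"
  where "frechet_holomorphic_on f U \<longleftrightarrow>
    (\<forall>x\<in>U. \<exists>D. bounded_clinear D \<and> (f has_derivative D) (at x))"

text \<open>The least Lipschitz constant. Written as an infimum, it is 0 also on a one-point set,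
  where there are no difference quotients.\<close>

definition lipschitz_constant :: "'a::metric_space set \<Rightarrow> ('a \<Rightarrow> 'b::metric_space) \<Rightarrow> real"
  where "lipschitz_constant U f = Inf {C. C-lipschitz_on U f}"

lemma lipschitz_constant_le:
  assumes "C-lipschitz_on U f"
  shows "lipschitz_constant U f \<le> C"
  unfolding lipschitz_constant_def
  by (rule cInf_lower) (use assms in \<open>auto intro!: bdd_belowI[where m = 0] lipschitz_on_nonneg\<close>)

lemma lipschitz_on_lipschitz_constant:
  assumes "C-lipschitz_on U f"
  shows "(lipschitz_constant U f)-lipschitz_on U f"
proof (rule lipschitz_onI)
  show "0 \<le> lipschitz_constant U f"
    unfolding lipschitz_constant_def
    by (rule cInf_greatest) (use assms in \<open>auto intro: lipschitz_on_nonneg\<close>)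
  fix x y assume xy: "x \<in> U" "y \<in> U"
  show "dist (f x) (f y) \<le> lipschitz_constant U f * dist x y"
  proof (cases "x = y")
    case False
    have "dist (f x) (f y) / dist x y \<le> lipschitz_constant U f"
      unfolding lipschitz_constant_def
      by (rule cInf_greatest)
        (use assms False xy in \<open>auto simp: divide_le_eq dest: lipschitz_onD\<close>)
    then show ?thesis using False by (simp add: divide_le_eq)
  qed simp
qed

text \<open>Functions on the open unit ball are represented by total functions that vanish
  outside of the ball.\<close>

definition hl0_functions :: "('a::complex_normed_vector \<Rightarrow> complex) set"
  where "hl0_functions = {f. frechet_holomorphic_on f (ball 0 1) \<and>
    (\<exists>C. C-lipschitz_on (ball 0 1) f) \<and> f 0 = 0 \<and> (\<forall>x. x \<notin> ball 0 1 \<longrightarrow> f x = 0)}"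

lemma hl0_functions_zero: "(\<lambda>x. 0) \<in> hl0_functions"
proof -
  have "bounded_clinear (\<lambda>x::'a. 0::complex)"
    by (simp add: bounded_clinear_def)
  then have "frechet_holomorphic_on (\<lambda>x::'a. 0::complex) (ball 0 1)"
    unfolding frechet_holomorphic_on_def by (metis has_derivative_const)
  then show ?thesis
    unfolding hl0_functions_def using lipschitz_on_constant by auto
qed

lemma hl0_functions_add:
  assumes "f \<in> hl0_functions" "g \<in> hl0_functions"
  shows "(\<lambda>x. f x + g x) \<in> hl0_functions"
proof -
  have "frechet_holomorphic_on (\<lambda>x. f x + g x) (ball 0 1)"
    unfolding frechet_holomorphic_on_def
  proof
    fix x :: 'a assume "x \<in> ball 0 1"
    then obtain D E where "bounded_clinear D" "(f has_derivative D) (at x)"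
        "bounded_clinear E" "(g has_derivative E) (at x)"
      using assms unfolding hl0_functions_def frechet_holomorphic_on_def by blast
    then have "bounded_clinear (\<lambda>x. D x + E x)"
        "((\<lambda>x. f x + g x) has_derivative (\<lambda>x. D x + E x)) (at x)"
      by (auto simp: bounded_clinear_def bounded_linear_add algebra_simps intro: has_derivative_add)
    then show "\<exists>D. bounded_clinear D \<and> ((\<lambda>x. f x + g x) has_derivative D) (at x)" by blast
  qed
  moreover have "\<exists>C. C-lipschitz_on (ball 0 1) (\<lambda>x. f x + g x)"
    using assms lipschitz_on_add unfolding hl0_functions_def by blast
  ultimately show ?thesis using assms by (simp add: hl0_functions_def)
qed

lemma lipschitz_on_mult_left:
  fixes f :: "'a::metric_space \<Rightarrow> complex"
  assumes "C-lipschitz_on U f"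
  shows "(cmod c * C)-lipschitz_on U (\<lambda>x. c * f x)"
proof (rule lipschitz_onI)
  show "dist (c * f x) (c * f y) \<le> cmod c * C * dist x y" if "x \<in> U" "y \<in> U" for x y
    using lipschitz_onD[OF assms that]
    by (simp add: dist_norm norm_mult mult.assoc mult_left_mono flip: right_diff_distrib)
  show "0 \<le> cmod c * C"
    using lipschitz_on_nonneg[OF assms] by simp
qed

lemma hl0_functions_mult:
  assumes "f \<in> hl0_functions"
  shows "(\<lambda>x. c * f x) \<in> hl0_functions"
proof -
  have "frechet_holomorphic_on (\<lambda>x. c * f x) (ball 0 1)"
    unfolding frechet_holomorphic_on_def
  proof
    fix x :: 'a assume "x \<in> ball 0 1"
    then obtain D where "bounded_clinear D" "(f has_derivative D) (at x)"
      using assms unfolding hl0_functions_def frechet_holomorphic_on_def by blast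
    then have "bounded_clinear (\<lambda>x. c * D x)"
        "((\<lambda>x. c * f x) has_derivative (\<lambda>x. c * D x)) (at x)"
      by (auto simp: bounded_clinear_def bounded_linear_const_mult intro: has_derivative_mult_right)
    then show "\<exists>D. bounded_clinear D \<and> ((\<lambda>x. c * f x) has_derivative D) (at x)" by blast
  qed
  moreover have "\<exists>C. C-lipschitz_on (ball 0 1) (\<lambda>x. c * f x)"
    using assms lipschitz_on_mult_left unfolding hl0_functions_def by blast
  ultimately show ?thesis using assms by (simp add: hl0_functions_def)
qed

typedef (overloaded) ('a::complex_normed_vector) hl0 = "hl0_functions :: ('a \<Rightarrow> complex) set"
  morphisms hl0_apply Abs_hl0
  using hl0_functions_zero by blast

setup_lifting type_definition_hl0

instantiation hl0 :: (complex_normed_vector) complex_normed_vector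
begin

lift_definition norm_hl0 :: "'a hl0 \<Rightarrow> real" is "lipschitz_constant (ball 0 1)" .

lift_definition zero_hl0 :: "'a hl0" is "\<lambda>x. 0"
  by (rule hl0_functions_zero)

lift_definition plus_hl0 :: "'a hl0 \<Rightarrow> 'a hl0 \<Rightarrow> 'a hl0" is "\<lambda>f g x. f x + g x"
  by (rule hl0_functions_add)

lift_definition scaleC_hl0 :: "complex \<Rightarrow> 'a hl0 \<Rightarrow> 'a hl0" is "\<lambda>c f x. c * f x"
  by (rule hl0_functions_mult)

lift_definition uminus_hl0 :: "'a hl0 \<Rightarrow> 'a hl0" is "\<lambda>f x. - f x"
  using hl0_functions_mult[where c = "-1"] by simp

lift_definition minus_hl0 :: "'a hl0 \<Rightarrow> 'a hl0 \<Rightarrow> 'a hl0" is "\<lambda>f g x. f x - g x"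
  using hl0_functions_add hl0_functions_mult[where c = "-1"] by fastforce

definition scaleR_hl0 :: "real \<Rightarrow> 'a hl0 \<Rightarrow> 'a hl0"
  where "scaleR_hl0 r f = complex_of_real r *\<^sub>C f"

definition dist_hl0 :: "'a hl0 \<Rightarrow> 'a hl0 \<Rightarrow> real"
  where "dist_hl0 f g = norm (f - g)"

definition sgn_hl0 :: "'a hl0 \<Rightarrow> 'a hl0"
  where "sgn_hl0 f = inverse (norm f) *\<^sub>R f"

definition uniformity_hl0 :: "('a hl0 \<times> 'a hl0) filter"
  where "uniformity_hl0 = (INF e\<in>{0 <..}. principal {(f, g). dist f g < e})"

definition open_hl0 :: "'a hl0 set \<Rightarrow> bool"
  where "open_hl0 S = (\<forall>f\<in>S. \<forall>\<^sub>F (f', g) in uniformity. f' = f \<longrightarrow> g \<in> S)"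

instance
proof
  fix f g h :: "'a hl0" and a b :: real and c d :: complex
  show "f + g + h = f + (g + h)" by transfer (simp add: add.assoc)
  show "f + g = g + f" by transfer (simp add: add.commute)
  show "0 + f = f" by transfer simp
  show "- f + f = 0" by transfer simp
  show "f - g = f + - g" by transfer simp
  show "a *\<^sub>R (f + g) = a *\<^sub>R f + a *\<^sub>R g"
    unfolding scaleR_hl0_def by transfer (simp add: algebra_simps)
  show "(a + b) *\<^sub>R f = a *\<^sub>R f + b *\<^sub>R f"
    unfolding scaleR_hl0_def by transfer (simp add: algebra_simps)
  show "a *\<^sub>R b *\<^sub>R f = (a * b) *\<^sub>R f"
    unfolding scaleR_hl0_def by transfer (simp add: algebra_simps)
  show "1 *\<^sub>R f = f"
    unfolding scaleR_hl0_def by transfer simp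
  show "c *\<^sub>C (f + g) = c *\<^sub>C f + c *\<^sub>C g" by transfer (simp add: algebra_simps)
  show "(c + d) *\<^sub>C f = c *\<^sub>C f + d *\<^sub>C f" by transfer (simp add: algebra_simps)
  show "c *\<^sub>C d *\<^sub>C f = (c * d) *\<^sub>C f" by transfer (simp add: algebra_simps)
  show "a *\<^sub>R f = complex_of_real a *\<^sub>C f" by (rule scaleR_hl0_def)
  show "dist f g = norm (f - g)" by (rule dist_hl0_def)
  show "sgn f = inverse (norm f) *\<^sub>R f" by (rule sgn_hl0_def)
  show "uniformity = (INF e\<in>{0<..}. principal {(x, y::'a hl0). dist x y < e})"
    by (rule uniformity_hl0_def)
  show "open U = (\<forall>x\<in>U. \<forall>\<^sub>F (x', y) in uniformity. x' = x \<longrightarrow> y \<in> U)" for U :: "'a hl0 set"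
    by (rule open_hl0_def)
  have lip: "(norm f)-lipschitz_on (ball 0 1) (hl0_apply f)" for f :: "'a hl0"
    by transfer (auto simp: hl0_functions_def intro: lipschitz_on_lipschitz_constant)
  show "norm f = 0 \<longleftrightarrow> f = 0"
  proof
    assume 0: "norm f = 0"
    have "hl0_apply f x = 0" for x
    proof (cases "x \<in> ball 0 1")
      case True
      then have "dist (hl0_apply f x) (hl0_apply f 0) \<le> 0"
        using lipschitz_onD[OF lip[of f], of x 0] 0 by simp
      moreover have "hl0_apply f 0 = 0" by transfer (simp add: hl0_functions_def)
      ultimately show ?thesis by simp
    next
      case False
      then show ?thesis by transfer (simp add: hl0_functions_def)
    qed
    then show "f = 0" by transfer auto
  next
    assume "f = 0"
    have "norm (0 :: 'a hl0) \<le> 0"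
      by transfer (rule lipschitz_constant_le, rule lipschitz_on_constant)
    then show "norm f = 0"
      using lipschitz_on_nonneg[OF lip[of f]] \<open>f = 0\<close> by simp
  qed
  show "norm (f + g) \<le> norm f + norm g"
    using lip[of f] lip[of g] by transfer (intro lipschitz_constant_le lipschitz_on_add)
  have scale_le: "norm (c *\<^sub>C f) \<le> cmod c * norm f" for c and f :: "'a hl0"
    using lip[of f] by transfer (intro lipschitz_constant_le lipschitz_on_mult_left)
  show norm_scale: "norm (c *\<^sub>C f) = cmod c * norm f" for c and f :: "'a hl0"
  proof (cases "c = 0")
    case True
    then show ?thesis
      using scale_le[of c f] lipschitz_on_nonneg[OF lip[of "c *\<^sub>C f"]] by simp
  next
    case False
    then have "f = inverse c *\<^sub>C c *\<^sub>C f" by transfer (simp flip: mult.assoc)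
    then have "norm f \<le> cmod (inverse c) * norm (c *\<^sub>C f)"
      by (metis scale_le)
    then have "cmod c * norm f \<le> norm (c *\<^sub>C f)"
      using False by (simp add: norm_inverse norm_divide field_simps)
    with scale_le[of c f] show ?thesis by simp
  qed
  show "norm (a *\<^sub>R f) = \<bar>a\<bar> * norm f"
    by (simp add: scaleR_hl0_def norm_scale)
qed

end


section \<open>The predual\<close>

text \<open>The compact-open topology on the holomorphic Lipschitz functions, that is, the
  topology of uniform convergence on the compact subsets of the open unit ball.\<close>

definition tau0 :: "'a::complex_normed_vector hl0 topology"
  where "tau0 = topology_generated_by
    {{g. \<forall>x\<in>K. cmod (hl0_apply g x - hl0_apply f x) < e} | f K e.
      compact K \<and> K \<subseteq> ball 0 1 \<and> 0 < e}"

lemma topspace_tau0: "topspace tau0 = UNIV"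
proof -
  have "UNIV \<in> {{g. \<forall>x\<in>K. cmod (hl0_apply g x - hl0_apply f x) < e} | f K e.
      compact K \<and> K \<subseteq> ball (0::'a) 1 \<and> 0 < e}"
    by (rule CollectI, rule exI, rule exI[of _ "{}"], rule exI[of _ 1]) auto
  then show ?thesis
    unfolding tau0_def topology_generated_by_topspace by blast
qed

text \<open>Real-linear functionals that are also complex-homogeneous form the complex dual; the
  operator norm does not depend on the choice of the scalar field.\<close>

definition g0_functionals :: "('a::complex_normed_vector hl0 \<Rightarrow>\<^sub>L complex) set"
  where "g0_functionals = {\<phi>. bounded_clinear (blinfun_apply \<phi>) \<and>
    continuous_map (subtopology tau0 {f. norm f \<le> 1}) euclidean (blinfun_apply \<phi>)}"

lemma g0_functionals_zero: "0 \<in> g0_functionals"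
  by (simp add: g0_functionals_def bounded_clinear_def blinfun.bounded_linear_right
      zero_blinfun.rep_eq)

lemma g0_functionals_add:
  "\<phi> \<in> g0_functionals \<Longrightarrow> \<psi> \<in> g0_functionals \<Longrightarrow> \<phi> + \<psi> \<in> g0_functionals"
  by (simp add: g0_functionals_def bounded_clinear_def blinfun.bounded_linear_right
      blinfun.add_left algebra_simps bounded_linear_add plus_blinfun.rep_eq continuous_map_add)

instantiation blinfun :: (real_normed_vector, complex_normed_vector) complex_normed_vector
begin

lift_definition scaleC_blinfun :: "complex \<Rightarrow> 'a \<Rightarrow>\<^sub>L 'b \<Rightarrow> 'a \<Rightarrow>\<^sub>L 'b" is "\<lambda>c T x. c *\<^sub>C T x"
  by (rule bounded_linear_compose[OF bounded_linear_scaleC])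

instance
proof
  fix S T :: "'a \<Rightarrow>\<^sub>L 'b" and c d :: complex and r :: real
  show "c *\<^sub>C (S + T) = c *\<^sub>C S + c *\<^sub>C T" by transfer (simp add: scaleC_add_right)
  show "(c + d) *\<^sub>C T = c *\<^sub>C T + d *\<^sub>C T" by transfer (simp add: scaleC_add_left)
  show "c *\<^sub>C d *\<^sub>C T = (c * d) *\<^sub>C T" by transfer (simp add: scaleC_scaleC)
  show "r *\<^sub>R T = complex_of_real r *\<^sub>C T" by transfer (simp add: scaleR_scaleC)
  have le: "norm (c *\<^sub>C T) \<le> cmod c * norm T" for c and T :: "'a \<Rightarrow>\<^sub>L 'b"
    by (rule norm_blinfun_bound)
      (simp_all add: scaleC_blinfun.rep_eq norm_scaleC mult.assoc mult_left_mono norm_blinfun)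
  show "norm (c *\<^sub>C T) = cmod c * norm T"
  proof (cases "c = 0")
    case True
    then show ?thesis using le[of c T] by simp
  next
    case False
    then have "T = inverse c *\<^sub>C c *\<^sub>C T" by transfer (simp add: scaleC_scaleC scaleC_one)
    then have "norm T \<le> cmod (inverse c) * norm (c *\<^sub>C T)" by (metis le)
    then have "cmod c * norm T \<le> norm (c *\<^sub>C T)"
      using False by (simp add: norm_inverse norm_divide field_simps)
    with le[of c T] show ?thesis by simp
  qed
qed

end

lemma g0_functionals_scaleC:
  assumes "\<phi> \<in> g0_functionals"
  shows "c *\<^sub>C \<phi> \<in> g0_functionals"
proof -
  have "continuous_map (subtopology tau0 {f. norm f \<le> 1}) euclidean ((*) c \<circ> blinfun_apply \<phi>)"
    using assms by (intro continuous_map_compose[where X' = euclidean])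
      (auto simp: g0_functionals_def intro: continuous_intros)
  then have "continuous_map (subtopology tau0 {f. norm f \<le> 1}) euclidean (blinfun_apply (c *\<^sub>C \<phi>))"
    by (simp add: scaleC_blinfun.rep_eq o_def)
  then show ?thesis
    using assms by (simp add: g0_functionals_def bounded_clinear_def blinfun.bounded_linear_right
        scaleC_blinfun.rep_eq)
qed

lemma closed_g0_functionals: "closed g0_functionals"
  unfolding closed_sequential_limits
proof (intro allI impI, elim conjE)
  fix \<phi> :: "nat \<Rightarrow> 'a hl0 \<Rightarrow>\<^sub>L complex" and \<psi>
  assume mem: "\<forall>n. \<phi> n \<in> g0_functionals" and lim: "\<phi> \<longlonglongrightarrow> \<psi>"
  have "\<psi> (c *\<^sub>C f) = c *\<^sub>C \<psi> f" for c f
  proof (rule LIMSEQ_unique)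
    have "(\<lambda>n. \<phi> n f) \<longlonglongrightarrow> \<psi> f" "(\<lambda>n. \<phi> n (c *\<^sub>C f)) \<longlonglongrightarrow> \<psi> (c *\<^sub>C f)"
      by (intro blinfun.tendsto[OF lim tendsto_const])+
    moreover have "\<phi> n (c *\<^sub>C f) = c *\<^sub>C \<phi> n f" for n
      using mem by (simp add: g0_functionals_def bounded_clinear_def)
    ultimately show "(\<lambda>n. \<phi> n (c *\<^sub>C f)) \<longlonglongrightarrow> \<psi> (c *\<^sub>C f)"
        "(\<lambda>n. \<phi> n (c *\<^sub>C f)) \<longlonglongrightarrow> c *\<^sub>C \<psi> f"
      by (auto intro: tendsto_mult_left)
  qed
  moreover have "continuous_map (subtopology tau0 {f. norm f \<le> 1}) Met_TC.mtopology (blinfun_apply \<psi>)"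
  proof (rule Met_TC.continuous_map_uniform_limit[where F = sequentially])
    show "\<forall>\<^sub>F n in sequentially. continuous_map (subtopology tau0 {f. norm f \<le> 1}) Met_TC.mtopology
        (blinfun_apply (\<phi> n))"
      using mem by (simp add: g0_functionals_def mtopology_is_euclidean)
    fix e :: real assume "0 < e"
    with lim have "\<forall>\<^sub>F n in sequentially. dist (\<phi> n) \<psi> < e" by (rule tendstoD)
    then show "\<forall>\<^sub>F n in sequentially. \<forall>f\<in>topspace (subtopology tau0 {f. norm f \<le> 1}).
        \<psi> f \<in> UNIV \<and> dist (\<phi> n f) (\<psi> f) < e"
    proof eventually_elim
      case (elim n)
      have "dist (\<phi> n f) (\<psi> f) < e" if "norm f \<le> 1" for f
      proof -
        have "dist (\<phi> n f) (\<psi> f) \<le> norm (\<phi> n - \<psi>) * norm f"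
          by (metis blinfun.diff_left dist_norm norm_blinfun)
        also have "\<dots> \<le> norm (\<phi> n - \<psi>)"
          using that by (simp add: mult_left_le)
        finally show ?thesis using elim by (simp add: dist_norm)
      qed
      then show ?case by simp
    qed
  qed simp
  ultimately show "\<psi> \<in> g0_functionals"
    by (simp add: g0_functionals_def bounded_clinear_def blinfun.bounded_linear_right
        mtopology_is_euclidean)
qed

typedef (overloaded) ('a::complex_normed_vector) g0 =
    "g0_functionals :: ('a hl0 \<Rightarrow>\<^sub>L complex) set"
  morphisms g0_functional Abs_g0
  using g0_functionals_zero by blast

setup_lifting type_definition_g0

instantiation g0 :: (complex_normed_vector) complex_normed_vector
begin

lift_definition norm_g0 :: "'a g0 \<Rightarrow> real" is norm .

lift_definition zero_g0 :: "'a g0" is 0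
  by (rule g0_functionals_zero)

lift_definition plus_g0 :: "'a g0 \<Rightarrow> 'a g0 \<Rightarrow> 'a g0" is "(+)"
  by (rule g0_functionals_add)

lift_definition scaleC_g0 :: "complex \<Rightarrow> 'a g0 \<Rightarrow> 'a g0" is scaleC
  by (rule g0_functionals_scaleC)

lift_definition scaleR_g0 :: "real \<Rightarrow> 'a g0 \<Rightarrow> 'a g0" is scaleR
  by (simp add: scaleR_scaleC g0_functionals_scaleC)

lift_definition uminus_g0 :: "'a g0 \<Rightarrow> 'a g0" is uminus
  by (metis g0_functionals_scaleC of_real_1 of_real_minus scaleR_minus1_left scaleR_scaleC)

lift_definition minus_g0 :: "'a g0 \<Rightarrow> 'a g0 \<Rightarrow> 'a g0" is "(-)"
  by (metis diff_conv_add_uminus g0_functionals_add g0_functionals_scaleC of_real_1 of_real_minus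
      scaleR_minus1_left scaleR_scaleC)

definition dist_g0 :: "'a g0 \<Rightarrow> 'a g0 \<Rightarrow> real"
  where "dist_g0 \<phi> \<psi> = norm (\<phi> - \<psi>)"

definition sgn_g0 :: "'a g0 \<Rightarrow> 'a g0"
  where "sgn_g0 \<phi> = inverse (norm \<phi>) *\<^sub>R \<phi>"

definition uniformity_g0 :: "('a g0 \<times> 'a g0) filter"
  where "uniformity_g0 = (INF e\<in>{0 <..}. principal {(\<phi>, \<psi>). dist \<phi> \<psi> < e})"

definition open_g0 :: "'a g0 set \<Rightarrow> bool"
  where "open_g0 S = (\<forall>\<phi>\<in>S. \<forall>\<^sub>F (\<phi>', \<psi>) in uniformity. \<phi>' = \<phi> \<longrightarrow> \<psi> \<in> S)"

instance
proof
  fix \<phi> \<psi> \<theta> :: "'a g0" and a b :: real and c d :: complex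
  show "\<phi> + \<psi> + \<theta> = \<phi> + (\<psi> + \<theta>)" by transfer (simp add: add.assoc)
  show "\<phi> + \<psi> = \<psi> + \<phi>" by transfer (simp add: add.commute)
  show "0 + \<phi> = \<phi>" by transfer simp
  show "- \<phi> + \<phi> = 0" by transfer simp
  show "\<phi> - \<psi> = \<phi> + - \<psi>" by transfer simp
  show "a *\<^sub>R (\<phi> + \<psi>) = a *\<^sub>R \<phi> + a *\<^sub>R \<psi>" by transfer (rule scaleR_add_right)
  show "(a + b) *\<^sub>R \<phi> = a *\<^sub>R \<phi> + b *\<^sub>R \<phi>" by transfer (rule scaleR_add_left)
  show "a *\<^sub>R b *\<^sub>R \<phi> = (a * b) *\<^sub>R \<phi>" by transfer simp
  show "1 *\<^sub>R \<phi> = \<phi>" by transfer simp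
  show "c *\<^sub>C (\<phi> + \<psi>) = c *\<^sub>C \<phi> + c *\<^sub>C \<psi>" by transfer (rule scaleC_add_right)
  show "(c + d) *\<^sub>C \<phi> = c *\<^sub>C \<phi> + d *\<^sub>C \<phi>" by transfer (rule scaleC_add_left)
  show "c *\<^sub>C d *\<^sub>C \<phi> = (c * d) *\<^sub>C \<phi>" by transfer (rule scaleC_scaleC)
  show "a *\<^sub>R \<phi> = complex_of_real a *\<^sub>C \<phi>" by transfer (rule scaleR_scaleC)
  show "norm (c *\<^sub>C \<phi>) = cmod c * norm \<phi>" by transfer (rule norm_scaleC)
  show "dist \<phi> \<psi> = norm (\<phi> - \<psi>)" by (rule dist_g0_def)
  show "sgn \<phi> = inverse (norm \<phi>) *\<^sub>R \<phi>" by (rule sgn_g0_def)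
  show "uniformity = (INF e\<in>{0<..}. principal {(x, y::'a g0). dist x y < e})"
    by (rule uniformity_g0_def)
  show "open U = (\<forall>x\<in>U. \<forall>\<^sub>F (x', y) in uniformity. x' = x \<longrightarrow> y \<in> U)" for U :: "'a g0 set"
    by (rule open_g0_def)
  show "norm \<phi> = 0 \<longleftrightarrow> \<phi> = 0" by transfer simp
  show "norm (\<phi> + \<psi>) \<le> norm \<phi> + norm \<psi>" by transfer (rule norm_triangle_ineq)
  show "norm (a *\<^sub>R \<phi>) = \<bar>a\<bar> * norm \<phi>" by transfer simp
qed

end

instance g0 :: (complex_normed_vector) complex_banach
proof
  fix \<phi> :: "nat \<Rightarrow> 'a g0"
  have dist_eq: "dist (g0_functional \<alpha>) (g0_functional \<beta>) = dist \<alpha> \<beta>" for \<alpha> \<beta> :: "'a g0"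
    by (simp add: dist_norm dist_g0_def norm_g0.rep_eq minus_g0.rep_eq)
  assume "Cauchy \<phi>"
  then have "Cauchy (\<lambda>n. g0_functional (\<phi> n))"
    unfolding Cauchy_def dist_eq .
  then obtain \<psi> where lim: "(\<lambda>n. g0_functional (\<phi> n)) \<longlonglongrightarrow> \<psi>"
    by (auto simp: Cauchy_convergent_iff convergent_def)
  have "\<psi> \<in> g0_functionals"
    by (rule closed_sequentially[OF closed_g0_functionals _ lim]) (rule g0_functional)
  then have "g0_functional (Abs_g0 \<psi>) = \<psi>"
    by (rule Abs_g0_inverse)
  then have "dist (\<phi> n) (Abs_g0 \<psi>) = dist (g0_functional (\<phi> n)) \<psi>" for n
    by (metis dist_eq)
  then have "\<phi> \<longlonglongrightarrow> Abs_g0 \<psi>"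
    using lim by (simp add: lim_sequentially)
  then show "convergent \<phi>"
    unfolding convergent_def by blast
qed

end

theory Submission
  imports Defs "HOL-Complex_Analysis.Complex_Analysis" "HOL-Real_Asymp.Real_Asymp"
begin

text \<open>
  Write \<open>B\<close> for the open unit ball of the Banach space \<open>X\<close>, \<open>G\<close> for the predual of the holomorphic
  Lipschitz functions on \<open>B\<close> that vanish at 0, and \<open>\<delta> x\<close> for the evaluation at \<open>x\<close>, an element of \<open>G\<close>.

  Two facts make \<open>G\<close> manageable. The evaluations span a dense subspace (\<open>g0_induct\<close>): continuity of
  a functional for the compact-open topology says that, up to a small multiple of the norm, it is
  controlled by finitely many point values, and the Hahn--Banach theorem turns this into an
  approximation by a combination of evaluations. And \<open>\<delta>\<close> is holomorphic as a map from \<open>B\<close> to \<open>G\<close>,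
  because Cauchy's estimate bounds the second-order Taylor remainder uniformly over all functions of
  norm at most 1. Together they give the universal property (\<open>linearization\<close>): holomorphic Lipschitz
  maps on \<open>B\<close> that vanish at 0 are the bounded linear maps on \<open>G\<close>.

  If \<open>G\<close> has the approximation property then so has \<open>X\<close>, since \<open>X\<close> is a complemented subspace of
  \<open>G\<close> (\<open>g0_retraction\<close>): the linearization \<open>P\<close> of the inclusion of \<open>B\<close> in \<open>X\<close> is a left inverse of the
  derivative of \<open>\<delta>\<close> at 0.

  Conversely, let \<open>X\<close> have the approximation property. The dilation \<open>f \<mapsto> f (r \<cdot> )\<close> induces an operator
  on \<open>G\<close> that tends to the identity as \<open>r \<rightarrow> 1\<close>, uniformly on compact sets, and that is the norm
  convergent series of the \<open>r\<^sup>k \<pi>\<^sub>k\<close>, where \<open>\<pi>\<^sub>k\<close> (\<open>hproj k\<close>) is the projection dual to taking the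
  \<open>k\<close>-homogeneous Taylor polynomial. So it is enough to approximate each \<open>\<pi>\<^sub>k\<close> on a compact set. For a
  finite-rank operator \<open>T\<close> on \<open>X\<close> there is an operator \<open>U\<close> on \<open>G\<close> dual to \<open>f \<mapsto> p \<circ> T\<close>, where \<open>p\<close> is the
  \<open>k\<close>-homogeneous Taylor polynomial of \<open>f\<close>; it has finite rank because homogeneous polynomials on a
  finite-dimensional space are determined by their values on a finite grid
  (\<open>finite_rank_hproj_g0_map\<close>).

  The difficulty is that \<open>T\<close> is close to the identity only on a compact set and may have a large norm,
  so that the operators \<open>U\<close> are not uniformly bounded and their closeness to \<open>\<pi>\<^sub>k\<close> on the vectors \<open>\<delta> x\<close>
  does not pass to limits. Grothendieck's description of compact sets resolves this
  (\<open>compact_absorbed_by_hull\<close>). The unit ball of the range of \<open>\<pi>\<^sub>k\<close> is absorbed by the closed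
  absolutely convex hull of the vectors \<open>\<pi>\<^sub>k (\<delta> x)\<close> (\<open>homogeneous_ball_subset_hull\<close>), so a compact
  subset of the range is controlled by finite sets of such vectors, on the \<open>j\<close>-th of which
  \<open>\<pi>\<^sub>k - U\<close> may be as large as a small constant times \<open>2\<^sup>j\<^sup>k\<close>. By homogeneity that is exactly what
  one gets if \<open>T\<close> is close to the identity at the points \<open>2\<^sup>-\<^sup>j x\<close>, and these points form, with 0, a
  compact subset of \<open>X\<close>.
\<close>

section \<open>The Hahn--Banach theorem\<close>

text \<open>A form of the Hahn--Banach theorem in which the sublinear functional is replaced by a convex cone,
  to be thought of as its epigraph. This suits functionals given as infima, and Zorn's lemma applies
  directly: unions of chains of cones are cones. A maximal cone that does not reach below the origin
  is the epigraph of a linear functional, for if \<open>\<phi> y\<close> is the infimum of its fibre over \<open>y\<close> then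
  adding the ray through \<open>(-y, -\<phi> y)\<close> keeps it above the origin, so the ray was there already.\<close>

lemma linear_functional_below_cone:
  fixes W :: "('a::real_vector \<times> real) set"
  assumes add: "\<And>x s y t. (x, s) \<in> W \<Longrightarrow> (y, t) \<in> W \<Longrightarrow> (x + y, s + t) \<in> W"
    and scale: "\<And>r x t. r \<ge> 0 \<Longrightarrow> (x, t) \<in> W \<Longrightarrow> (r *\<^sub>R x, r * t) \<in> W"
    and total: "\<And>x. \<exists>t. (x, t) \<in> W"
    and pos: "\<And>t. (0, t) \<in> W \<Longrightarrow> 0 \<le> t"
  shows "\<exists>\<phi>. linear \<phi> \<and> (\<forall>x t. (x, t) \<in> W \<longrightarrow> \<phi> x \<le> t)"
proof -
  define good where "good V \<longleftrightarrow>
    (\<forall>x s y t. (x, s) \<in> V \<longrightarrow> (y, t) \<in> V \<longrightarrow> (x + y, s + t) \<in> V) \<and>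
    (\<forall>r x t. r \<ge> 0 \<longrightarrow> (x, t) \<in> V \<longrightarrow> (r *\<^sub>R x, r * t) \<in> V) \<and>
    (\<forall>t. (0, t) \<in> V \<longrightarrow> 0 \<le> t)" for V :: "('a \<times> real) set"
  have goodD: "good V \<Longrightarrow> (x, s) \<in> V \<Longrightarrow> (y, t) \<in> V \<Longrightarrow> (x + y, s + t) \<in> V"
    "good V \<Longrightarrow> r \<ge> 0 \<Longrightarrow> (x, t) \<in> V \<Longrightarrow> (r *\<^sub>R x, r * t) \<in> V"
    "good V \<Longrightarrow> (0, t) \<in> V \<Longrightarrow> 0 \<le> t" for V x s y t r
    unfolding good_def by simp_all
  have "\<exists>V\<in>{V. good V \<and> W \<subseteq> V}. \<forall>U\<in>{V. good V \<and> W \<subseteq> V}. V \<subseteq> U \<longrightarrow> U = V"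
  proof (rule subset_Zorn_nonempty)
    show "{V. good V \<and> W \<subseteq> V} \<noteq> {}"
    proof -
      have "good W" unfolding good_def using add scale pos by simp
      then show ?thesis by blast
    qed
    fix \<C> assume ne: "\<C> \<noteq> {}" and ch: "subset.chain {V. good V \<and> W \<subseteq> V} \<C>"
    have mem: "good V" "W \<subseteq> V" if "V \<in> \<C>" for V
      using ch that unfolding subset_chain_def by auto
    have comp: "U \<subseteq> V \<or> V \<subseteq> U" if "U \<in> \<C>" "V \<in> \<C>" for U V
      using ch that unfolding subset_chain_def by auto
    have "good (\<Union>\<C>)"
      unfolding good_def
    proof (intro conjI allI impI)
      fix x s y t assume "(x, s) \<in> \<Union>\<C>" "(y, t) \<in> \<Union>\<C>"
      then obtain U V where UV: "U \<in> \<C>" "(x, s) \<in> U" "V \<in> \<C>" "(y, t) \<in> V" by blast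
      then obtain Z where "Z \<in> \<C>" "(x, s) \<in> Z" "(y, t) \<in> Z" using comp by blast
      then show "(x + y, s + t) \<in> \<Union>\<C>" using goodD(1)[OF mem(1)] by blast
    next
      fix r :: real and x t assume "0 \<le> r" "(x, t) \<in> \<Union>\<C>"
      then obtain Z where "Z \<in> \<C>" "(x, t) \<in> Z" by blast
      then show "(r *\<^sub>R x, r * t) \<in> \<Union>\<C>"
        using goodD(2)[OF mem(1) \<open>0 \<le> r\<close>] by blast
    next
      fix t assume "(0, t) \<in> \<Union>\<C>"
      then obtain Z where "Z \<in> \<C>" "(0, t) \<in> Z" by blast
      then show "0 \<le> t" using goodD(3)[OF mem(1)] by blast
    qed
    moreover obtain Z where Z: "Z \<in> \<C>" using ne by blast
    then have "W \<subseteq> Z" by (rule mem(2))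
    then have "W \<subseteq> \<Union>\<C>" using Z by blast
    ultimately show "\<Union>\<C> \<in> {V. good V \<and> W \<subseteq> V}" by simp
  qed
  then obtain V where V: "good V" "W \<subseteq> V"
    and maxW: "\<And>U. good U \<Longrightarrow> W \<subseteq> U \<Longrightarrow> V \<subseteq> U \<Longrightarrow> U = V"
    unfolding mem_Collect_eq Bex_def Ball_def by metis
  have max: "U = V" if "good U" "V \<subseteq> U" for U
    using maxW[OF that(1) _ that(2)] V(2) that(2) by (metis order_trans)
  note Vadd = goodD(1)[OF V(1)] and Vscale = goodD(2)[OF V(1)] and Vpos = goodD(3)[OF V(1)]
  have Vtotal: "\<exists>t. (x, t) \<in> V" for x using total V(2) by blast
  have V0: "(0, 0) \<in> V" using Vtotal[of 0] Vscale[of 0] by auto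
  define \<phi> where "\<phi> x = Inf {t. (x, t) \<in> V}" for x
  have bdd: "bdd_below {t. (x, t) \<in> V}" for x
  proof -
    obtain s where s: "(- x, s) \<in> V" using Vtotal by blast
    have "- s \<le> t" if "(x, t) \<in> V" for t
      using Vpos[of "t + s"] Vadd[OF that s] by simp
    then show ?thesis by (intro bdd_belowI[of _ "- s"]) simp
  qed
  have le: "\<phi> x \<le> t" if "(x, t) \<in> V" for x t
    unfolding \<phi>_def using that bdd by (auto intro: cInf_lower)
  have neg: "(- y, - \<phi> y) \<in> V" for y
  proof -
    define U where "U = {(x - s *\<^sub>R y, t - s * \<phi> y) | x t s. (x, t) \<in> V \<and> 0 \<le> s}"
    have UI: "(x - s *\<^sub>R y, t - s * \<phi> y) \<in> U" if "(x, t) \<in> V" "0 \<le> s" for x t s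
      using that unfolding U_def by blast
    have UE: "\<exists>x' t' s. (x', t') \<in> V \<and> 0 \<le> s \<and> x = x' - s *\<^sub>R y \<and> t = t' - s * \<phi> y"
      if "(x, t) \<in> U" for x t
      using that unfolding U_def by blast
    have "good U"
      unfolding good_def
    proof (intro conjI allI impI)
      fix x s z t assume "(x, s) \<in> U" "(z, t) \<in> U"
      then obtain x' s' a z' t' b where *: "(x', s') \<in> V" "0 \<le> a" "x = x' - a *\<^sub>R y" "s = s' - a * \<phi> y"
        "(z', t') \<in> V" "0 \<le> b" "z = z' - b *\<^sub>R y" "t = t' - b * \<phi> y"
        using UE by metis
      have "x + z = x' + z' - (a + b) *\<^sub>R y" "s + t = s' + t' - (a + b) * \<phi> y"
        unfolding *(3,4,7,8) by (simp_all add: algebra_simps)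
      moreover have "a + b \<ge> 0" using *(2,6) by simp
      ultimately show "(x + z, s + t) \<in> U"
        using UI[OF Vadd[OF *(1,5)], of "a + b"] by simp
    next
      fix r :: real and x t assume "0 \<le> r" "(x, t) \<in> U"
      then obtain x' t' a where *: "(x', t') \<in> V" "0 \<le> a" "x = x' - a *\<^sub>R y" "t = t' - a * \<phi> y"
        using UE by metis
      show "(r *\<^sub>R x, r * t) \<in> U"
        using UI[OF Vscale[OF \<open>0 \<le> r\<close> *(1)], of "r * a"] * \<open>0 \<le> r\<close>
        by (simp add: scaleR_right_diff_distrib right_diff_distrib mult.assoc)
    next
      fix t assume "(0, t) \<in> U"
      then obtain x' t' a where *: "(x', t') \<in> V" "0 \<le> a" "0 = x' - a *\<^sub>R y" "t = t' - a * \<phi> y"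
        using UE by metis
      show "0 \<le> t"
      proof (cases "a = 0")
        case True
        then show ?thesis using * Vpos by simp
      next
        case False
        then have "(y, t' / a) \<in> V"
          using Vscale[of "inverse a", OF _ *(1)] * by (simp add: divide_inverse mult.commute)
        from le[OF this] show ?thesis using * False by (simp add: field_simps)
      qed
    qed
    moreover have "V \<subseteq> U" using UI[where s = 0] by auto
    ultimately have "U = V" by (rule max)
    then show ?thesis using UI[OF V0, of 1] by simp
  qed
  have minus: "\<phi> (- y) = - \<phi> y" for y
  proof (rule antisym)
    show "\<phi> (- y) \<le> - \<phi> y" by (rule le[OF neg])
    have "- \<phi> y \<le> t" if t: "(- y, t) \<in> V" for t
    proof -
      have "- t \<le> s" if "(y, s) \<in> V" for s
        using Vpos[of "s + t"] Vadd[OF that t] by simp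
      then have "- t \<le> \<phi> y"
        unfolding \<phi>_def[of y] using Vtotal[of y] by (intro cInf_greatest) auto
      then show ?thesis by simp
    qed
    then show "- \<phi> y \<le> \<phi> (- y)"
      unfolding \<phi>_def[of "- y"] using Vtotal[of "- y"] by (intro cInf_greatest) auto
  qed
  have mem: "(y, \<phi> y) \<in> V" for y
    using neg[of "- y"] minus[of y] by simp
  have eq: "\<phi> x = t" if "(x, t) \<in> V" "(- x, - t) \<in> V" for x t
    using le[OF that(1)] le[OF that(2)] minus[of x] by simp
  have "linear \<phi>"
  proof (rule linearI)
    show "\<phi> (x + y) = \<phi> x + \<phi> y" for x y
      using eq[OF Vadd[OF mem[of x] mem[of y]]] Vadd[OF neg[of x] neg[of y]] by simp
    show "\<phi> (r *\<^sub>R x) = r *\<^sub>R \<phi> x" for r x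
    proof (cases "r \<ge> 0")
      case True
      then show ?thesis using eq[OF Vscale[OF True mem]] Vscale[OF True neg, of x] by simp
    next
      case False
      then have r: "- r \<ge> 0" by simp
      show ?thesis
        using eq[OF Vscale[OF r neg]] Vscale[OF r mem, of x] by simp
    qed
  qed
  moreover have "\<phi> x \<le> t" if "(x, t) \<in> W" for x t using le V(2) that by blast
  ultimately show ?thesis by blast
qed

text \<open>The complex-linear functional with a given real part.\<close>

definition complexify :: "('a::complex_normed_vector \<Rightarrow> real) \<Rightarrow> 'a \<Rightarrow> complex"
  where "complexify \<phi> x = Complex (\<phi> x) (- \<phi> (\<i> *\<^sub>C x))"

lemma linear_scaleC:
  "linear (\<lambda>x::'a::complex_normed_vector. c *\<^sub>C x)"
  using bounded_linear_scaleC bounded_linear.linear by blast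

lemma complexify_linear:
  assumes "linear \<phi>"
  shows complexify_add: "complexify \<phi> (x + y) = complexify \<phi> x + complexify \<phi> y"
    and complexify_scaleC: "complexify \<phi> (c *\<^sub>C x) = c * complexify \<phi> x"
proof -
  interpret linear \<phi> by fact
  show "complexify \<phi> (x + y) = complexify \<phi> x + complexify \<phi> y"
    by (simp add: complexify_def scaleC_add_right add complex_eq_iff)
  have dec: "d *\<^sub>C z = Re d *\<^sub>R z + Im d *\<^sub>R (\<i> *\<^sub>C z)" for d and z :: 'a
  proof -
    have "d *\<^sub>C z = (complex_of_real (Re d) + complex_of_real (Im d) * \<i>) *\<^sub>C z"
      using complex_eq[of d] by (simp add: mult.commute)
    then show ?thesis
      by (simp add: scaleC_add_left scaleR_scaleC scaleC_scaleC mult.commute)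
  qed
  have "\<phi> (c *\<^sub>C x) = Re c * \<phi> x + Im c * \<phi> (\<i> *\<^sub>C x)"
    by (subst dec) (simp add: add scale)
  moreover have "\<phi> (\<i> *\<^sub>C c *\<^sub>C x) = Re c * \<phi> (\<i> *\<^sub>C x) - Im c * \<phi> x"
  proof -
    have "\<phi> (\<i> *\<^sub>C c *\<^sub>C x) = Re (\<i> * c) * \<phi> x + Im (\<i> * c) * \<phi> (\<i> *\<^sub>C x)"
      unfolding scaleC_scaleC by (subst dec) (simp add: add diff scale)
    then show ?thesis by simp
  qed
  ultimately show "complexify \<phi> (c *\<^sub>C x) = c * complexify \<phi> x"
    by (simp add: complexify_def complex_eq_iff)
qed

lemma norm_le_of_Re_le:
  fixes F :: "'a::complex_normed_vector \<Rightarrow> complex"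
  assumes "\<And>c. F (c *\<^sub>C x) = c * F x" "\<And>c. cmod c = 1 \<Longrightarrow> Re (F (c *\<^sub>C x)) \<le> B"
  shows "cmod (F x) \<le> B"
proof (cases "F x = 0")
  case True
  then show ?thesis using assms(2)[of 1] by (simp add: scaleC_one)
next
  case False
  define c where "c = cnj (F x) / cmod (F x)"
  have "c * F x = (F x * cnj (F x)) / cmod (F x)" by (simp add: c_def)
  also have "\<dots> = complex_of_real (cmod (F x) * cmod (F x)) / complex_of_real (cmod (F x))"
    by (simp only: complex_norm_square[symmetric] power2_eq_square)
  also have "\<dots> = cmod (F x)" using False by simp
  finally have "c * F x = cmod (F x)" .
  moreover have "cmod c = 1" using False by (simp add: c_def norm_divide)
  ultimately show ?thesis using assms(1)[of c] assms(2)[of c] by simp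
qed

lemma bounded_clinear_intro:
  fixes T :: "'a::complex_normed_vector \<Rightarrow> 'b::complex_normed_vector"
  assumes "\<And>x y. T (x + y) = T x + T y" "\<And>c x. T (c *\<^sub>C x) = c *\<^sub>C T x"
    "\<And>x. norm (T x) \<le> K * norm x"
  shows "bounded_clinear T"
  unfolding bounded_clinear_def
  by (intro conjI allI bounded_linear_intro[where K = K])
    (use assms in \<open>simp_all add: scaleR_scaleC mult.commute\<close>)

lemma bounded_clinearD:
  assumes "bounded_clinear T"
  shows bounded_clinear_add: "T (x + y) = T x + T y"
    and bounded_clinear_diff: "T (x - y) = T x - T y"
    and bounded_clinear_scaleC: "T (c *\<^sub>C x) = c *\<^sub>C T x"
    and bounded_clinear_zero: "T 0 = 0"
    and bounded_clinear_bounded_linear: "bounded_linear T"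
  using assms unfolding bounded_clinear_def
  by (auto simp: linear_add linear_diff linear_0 bounded_linear.linear)

lemma bounded_clinear_compose:
  "bounded_clinear S \<Longrightarrow> bounded_clinear T \<Longrightarrow> bounded_clinear (\<lambda>x. S (T x))"
  unfolding bounded_clinear_def using bounded_linear_compose by fastforce

text \<open>
  The Hahn--Banach separation theorem for an absolutely convex set. The functional comes from the
  gauge of the convex hull of the set and a small ball, which makes it bounded.\<close>

lemma absconvex_separation:
  fixes A :: "'a::complex_normed_vector set"
  assumes A: "convex A" "0 \<in> A" and bal: "\<And>c x. cmod c = 1 \<Longrightarrow> x \<in> A \<Longrightarrow> c *\<^sub>C x \<in> A"
    and x0: "x0 \<notin> closure A"
  shows "\<exists>F :: 'a \<Rightarrow> complex. bounded_clinear F \<and> (\<forall>x\<in>A. cmod (F x) \<le> 1) \<and> 1 \<le> cmod (F x0)"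
proof -
  obtain e where e: "0 < e" "\<And>a. a \<in> A \<Longrightarrow> e \<le> norm (x0 - a)"
    using x0 unfolding closure_approachable by (metis dist_commute dist_norm not_le)
  \<comment> \<open>the epigraph of the gauge of the convex hull of A and the e-ball, enlarged by the ray through
      \<open>(-x0, -1)\<close>, which forces the functional to be at least 1 at \<open>x0\<close>\<close>
  define W where "W = {(x, t). \<exists>s\<ge>0. \<exists>r\<ge>0. \<exists>a\<in>A. s + norm (x + r *\<^sub>R x0 - s *\<^sub>R a) / e \<le> t + r}"
  have WI: "(x, t) \<in> W" if "s \<ge> 0" "r \<ge> 0" "a \<in> A" "s + norm (x + r *\<^sub>R x0 - s *\<^sub>R a) / e \<le> t + r"
    for x t s r a using that unfolding W_def by blast
  have WE: "\<exists>s r a. s \<ge> 0 \<and> r \<ge> 0 \<and> a \<in> A \<and> s + norm (x + r *\<^sub>R x0 - s *\<^sub>R a) / e \<le> t + r"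
    if "(x, t) \<in> W" for x t using that unfolding W_def by blast
  have "\<exists>\<phi>. linear \<phi> \<and> (\<forall>x t. (x, t) \<in> W \<longrightarrow> \<phi> x \<le> t)"
  proof (rule linear_functional_below_cone[of W])
    fix x t y u assume "(x, t) \<in> W" "(y, u) \<in> W"
    then obtain s r a s' r' a' where *: "s \<ge> 0" "r \<ge> 0" "a \<in> A" "s' \<ge> 0" "r' \<ge> 0" "a' \<in> A"
      "s + norm (x + r *\<^sub>R x0 - s *\<^sub>R a) / e \<le> t + r"
      "s' + norm (y + r' *\<^sub>R x0 - s' *\<^sub>R a') / e \<le> u + r'"
      using WE by metis
    obtain b where b: "b \<in> A" "s *\<^sub>R a + s' *\<^sub>R a' = (s + s') *\<^sub>R b"
    proof (cases "s + s' = 0")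
      case True
      then have "s = 0" "s' = 0" using * by auto
      then show ?thesis using that * by simp
    next
      case False
      have "(s / (s + s')) *\<^sub>R a + (s' / (s + s')) *\<^sub>R a' \<in> A"
        using A(1) * False by (intro convexD) (auto simp: add_divide_distrib[symmetric])
      then show ?thesis using that[of "(s / (s + s')) *\<^sub>R a + (s' / (s + s')) *\<^sub>R a'"] False
        by (simp add: scaleR_add_right)
    qed
    have "norm (x + y + (r + r') *\<^sub>R x0 - (s + s') *\<^sub>R b)
      \<le> norm (x + r *\<^sub>R x0 - s *\<^sub>R a) + norm (y + r' *\<^sub>R x0 - s' *\<^sub>R a')"
    proof -
      have "x + y + (r + r') *\<^sub>R x0 - (s + s') *\<^sub>R b
        = (x + r *\<^sub>R x0 - s *\<^sub>R a) + (y + r' *\<^sub>R x0 - s' *\<^sub>R a')"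
        unfolding b(2)[symmetric] by (simp add: algebra_simps)
      then show ?thesis by (simp only: norm_triangle_ineq)
    qed
    then have "norm (x + y + (r + r') *\<^sub>R x0 - (s + s') *\<^sub>R b) / e
      \<le> norm (x + r *\<^sub>R x0 - s *\<^sub>R a) / e + norm (y + r' *\<^sub>R x0 - s' *\<^sub>R a') / e"
      using e(1) by (simp add: divide_right_mono flip: add_divide_distrib)
    then show "(x + y, t + u) \<in> W"
      using * b(1) by (intro WI[of "s + s'" "r + r'" b]) auto
  next
    fix q :: real and x t assume "0 \<le> q" "(x, t) \<in> W"
    then obtain s r a where *: "s \<ge> 0" "r \<ge> 0" "a \<in> A"
      "s + norm (x + r *\<^sub>R x0 - s *\<^sub>R a) / e \<le> t + r" using WE by metis
    have "norm (q *\<^sub>R x + (q * r) *\<^sub>R x0 - (q * s) *\<^sub>R a) = norm (q *\<^sub>R (x + r *\<^sub>R x0 - s *\<^sub>R a))"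
      by (simp add: algebra_simps)
    also have "\<dots> = q * norm (x + r *\<^sub>R x0 - s *\<^sub>R a)" using \<open>0 \<le> q\<close> by simp
    finally have "q * s + norm (q *\<^sub>R x + (q * r) *\<^sub>R x0 - (q * s) *\<^sub>R a) / e
        = q * (s + norm (x + r *\<^sub>R x0 - s *\<^sub>R a) / e)"
      by (simp add: algebra_simps)
    also have "\<dots> \<le> q * (t + r)" using * \<open>0 \<le> q\<close> by (intro mult_left_mono)
    finally show "(q *\<^sub>R x, q * t) \<in> W"
      using * \<open>0 \<le> q\<close> by (intro WI[of "q * s" "q * r" a]) (auto simp: algebra_simps)
  next
    show "\<exists>t. (x, t) \<in> W" for x
      using WI[of 0 0 0 x "norm x / e"] A(2) by auto
  next
    fix t assume "(0, t) \<in> W"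
    then obtain s r a where *: "s \<ge> 0" "r \<ge> 0" "a \<in> A"
      "s + norm (r *\<^sub>R x0 - s *\<^sub>R a) / e \<le> t + r" using WE[of 0 t] by auto
    have "r \<le> s + norm (r *\<^sub>R x0 - s *\<^sub>R a) / e"
    proof (cases "r \<le> s")
      case True
      then show ?thesis using e(1) by (simp add: add_increasing2)
    next
      case False
      then have r: "r > 0" "s / r \<le> 1" using * by auto
      \<comment> \<open>\<open>(s / r) *\<^sub>R a\<close> lies in A because A is star-shaped about 0\<close>
      have "(s / r) *\<^sub>R a + (1 - s / r) *\<^sub>R 0 \<in> A"
        using A * r by (intro convexD) auto
      then have "e \<le> norm (x0 - (s / r) *\<^sub>R a)" using e(2) by simp
      then have "r * e \<le> norm (r *\<^sub>R (x0 - (s / r) *\<^sub>R a))" using r by simp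
      also have "r *\<^sub>R (x0 - (s / r) *\<^sub>R a) = r *\<^sub>R x0 - s *\<^sub>R a"
        using r by (simp add: algebra_simps)
      finally have "r \<le> norm (r *\<^sub>R x0 - s *\<^sub>R a) / e" using e(1) by (simp add: field_simps)
      then show ?thesis using * by simp
    qed
    then show "0 \<le> t" using * by simp
  qed
  then obtain \<phi> where \<phi>: "linear \<phi>" "\<And>x t. (x, t) \<in> W \<Longrightarrow> \<phi> x \<le> t"
    by blast
  define F where "F = complexify \<phi>"
  have F: "F (x + y) = F x + F y" "F (c *\<^sub>C x) = c * F x" for x y c
    using complexify_linear[OF \<phi>(1)] unfolding F_def by auto
  have Re: "Re (F x) = \<phi> x" for x by (simp add: F_def complexify_def)
  have "bounded_clinear F"
  proof (rule bounded_clinear_intro)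
    show "norm (F x) \<le> (1 / e) * norm x" for x
    proof (rule norm_le_of_Re_le[of F x])
      fix c :: complex assume "cmod c = 1"
      then show "Re (F (c *\<^sub>C x)) \<le> 1 / e * norm x"
        unfolding Re by (intro \<phi>(2) WI[of 0 0 0]) (auto simp: A norm_scaleC)
    qed (rule F)
  qed (use F in auto)
  moreover have "cmod (F x) \<le> 1" if "x \<in> A" for x
  proof (rule norm_le_of_Re_le[of F x])
    fix c :: complex assume "cmod c = 1"
    then show "Re (F (c *\<^sub>C x)) \<le> 1"
      unfolding Re by (intro \<phi>(2) WI[of 1 0 "c *\<^sub>C x"]) (auto simp: bal that)
  qed (rule F)
  moreover have "1 \<le> cmod (F x0)"
  proof -
    have "\<phi> (- x0) \<le> -1" by (intro \<phi>(2) WI[of 0 1 0]) (auto simp: A)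
    then show ?thesis
      using complex_Re_le_cmod[of "F x0"] Re[of x0] linear_neg[OF \<phi>(1), of x0] by simp
  qed
  ultimately show ?thesis by blast
qed

lemma norming_functional:
  fixes x0 :: "'a::complex_normed_vector"
  assumes "1 < norm x0"
  shows "\<exists>F :: 'a \<Rightarrow> complex. bounded_clinear F \<and> (\<forall>x. cmod (F x) \<le> norm x) \<and> 1 \<le> cmod (F x0)"
proof -
  have "\<exists>F :: 'a \<Rightarrow> complex. bounded_clinear F \<and> (\<forall>x\<in>cball 0 1. cmod (F x) \<le> 1) \<and> 1 \<le> cmod (F x0)"
    using assms by (intro absconvex_separation) (auto simp: norm_scaleC)
  then obtain F :: "'a \<Rightarrow> complex" where F: "bounded_clinear F"
      "\<And>x. x \<in> cball 0 1 \<Longrightarrow> cmod (F x) \<le> 1" "1 \<le> cmod (F x0)"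
    by blast
  have "cmod (F x) \<le> norm x" for x
  proof (cases "x = 0")
    case False
    have "cmod (F (complex_of_real (inverse (norm x)) *\<^sub>C x)) \<le> 1"
      using False by (intro F(2)) (simp add: norm_scaleC norm_inverse)
    then show ?thesis
      using False by (simp add: bounded_clinearD[OF F(1)] norm_mult norm_inverse norm_divide field_simps)
  qed (simp add: bounded_clinearD[OF F(1)])
  then show ?thesis using F by blast
qed

text \<open>
  By induction on the number of functionals: subtracting a multiple of one of them from \<open>l\<close> reduces
  to the common kernel of the others.\<close>

lemma functional_in_span_of_kernel:
  fixes L :: "'i \<Rightarrow> 'a::complex_normed_vector \<Rightarrow> complex"
  assumes "finite I"
    and "\<And>i x y. i \<in> I \<Longrightarrow> L i (x + y) = L i x + L i y" "\<And>i c x. i \<in> I \<Longrightarrow> L i (c *\<^sub>C x) = c * L i x"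
    and "\<And>x y. l (x + y) = l x + l y" "\<And>c x. l (c *\<^sub>C x) = c * l x"
    and "\<And>x. (\<forall>i\<in>I. L i x = 0) \<Longrightarrow> l x = 0"
  shows "\<exists>c. \<forall>x. l x = (\<Sum>i\<in>I. c i * L i x)"
  using assms
proof (induction I arbitrary: l rule: finite_induct)
  case empty
  then show ?case by simp
next
  case (insert j I)
  show ?case
  proof (cases "\<exists>x. (\<forall>i\<in>I. L i x = 0) \<and> L j x \<noteq> 0")
    case True
    then obtain y where y: "\<forall>i\<in>I. L i y = 0" "L j y \<noteq> 0" by blast
    define z where "z = inverse (L j y) *\<^sub>C y"
    have z: "\<forall>i\<in>I. L i z = 0" "L j z = 1"
      using y insert.prems(2) by (auto simp: z_def)
    define l' where "l' x = l x - l z * L j x" for x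
    have "\<exists>c. \<forall>x. l' x = (\<Sum>i\<in>I. c i * L i x)"
    proof (rule insert.IH)
      fix x assume x: "\<forall>i\<in>I. L i x = 0"
      have "l (x + (- L j x) *\<^sub>C z) = 0"
      proof (rule insert.prems(5), intro ballI)
        fix i assume i: "i \<in> insert j I"
        show "L i (x + (- L j x) *\<^sub>C z) = 0"
        proof -
          have "L i (x + (- L j x) *\<^sub>C z) = L i x + (- L j x) * L i z"
            by (simp only: insert.prems(1,2)[OF i])
          then show ?thesis using i x z by auto
        qed
      qed
      then show "l' x = 0" unfolding insert.prems(3,4) by (simp add: l'_def mult.commute)
    qed (use insert.prems in \<open>auto simp: l'_def algebra_simps\<close>)
    then obtain c where c: "\<And>x. l' x = (\<Sum>i\<in>I. c i * L i x)" by blast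
    have "l x = (\<Sum>i\<in>insert j I. (c(j := l z)) i * L i x)" for x
    proof -
      have "(\<Sum>i\<in>I. (c(j := l z)) i * L i x) = (\<Sum>i\<in>I. c i * L i x)"
        using insert.hyps by (intro sum.cong) auto
      then show ?thesis using c[of x] insert.hyps by (simp add: l'_def algebra_simps)
    qed
    then show ?thesis by blast
  next
    case False
    have "\<exists>c. \<forall>x. l x = (\<Sum>i\<in>I. c i * L i x)"
      by (rule insert.IH) (use insert.prems False in auto)
    then obtain c where c: "\<And>x. l x = (\<Sum>i\<in>I. c i * L i x)" by blast
    have "l x = (\<Sum>i\<in>insert j I. (c(j := 0)) i * L i x)" for x
    proof -
      have "(\<Sum>i\<in>I. (c(j := 0)) i * L i x) = (\<Sum>i\<in>I. c i * L i x)"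
        using insert.hyps by (intro sum.cong) auto
      then show ?thesis using c[of x] insert.hyps by simp
    qed
    then show ?thesis by blast
  qed
qed

section \<open>Holomorphic Lipschitz functions and their predual\<close>

lemma hl0_apply_zero [simp]: "hl0_apply f 0 = 0"
  by transfer (simp add: hl0_functions_def)

lemma hl0_apply_outside: "1 \<le> norm x \<Longrightarrow> hl0_apply f x = 0"
  by transfer (simp add: hl0_functions_def)

lemma hl0_holomorphic: "frechet_holomorphic_on (hl0_apply f) (ball 0 1)"
  by transfer (simp add: hl0_functions_def)

lemma hl0_lipschitz:
  assumes "norm x < 1" "norm y < 1"
  shows "cmod (hl0_apply f x - hl0_apply f y) \<le> norm f * norm (x - y)"
proof -
  have "(norm f)-lipschitz_on (ball 0 1) (hl0_apply f)"
    by transfer (auto simp: hl0_functions_def intro: lipschitz_on_lipschitz_constant)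
  from lipschitz_onD[OF this, of x y] show ?thesis using assms by (simp add: dist_norm)
qed

lemma hl0_bound: "cmod (hl0_apply f x) \<le> norm f * norm x"
  using hl0_lipschitz[of x 0 f] by (cases "norm x < 1") (simp_all add: hl0_apply_outside)

lemma norm_hl0_le:
  assumes "\<And>x y. norm x < 1 \<Longrightarrow> norm y < 1 \<Longrightarrow> cmod (hl0_apply f x - hl0_apply f y) \<le> C * norm (x - y)"
    and "0 \<le> C"
  shows "norm f \<le> C"
proof -
  have "C-lipschitz_on (ball 0 1) (hl0_apply f)"
    using assms by (intro lipschitz_onI) (auto simp: dist_norm)
  then show ?thesis by transfer (rule lipschitz_constant_le)
qed

lemma continuous_on_hl0: "continuous_on (ball 0 1) (hl0_apply f)"
proof -
  have "(norm f)-lipschitz_on (ball 0 1) (hl0_apply f)"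
    by transfer (auto simp: hl0_functions_def intro: lipschitz_on_lipschitz_constant)
  then show ?thesis by (rule lipschitz_on_continuous_on)
qed

text \<open>Holomorphic Lipschitz functions are represented by functions that vanish outside of the ball.\<close>

definition restrict_hl0 :: "('a::complex_normed_vector \<Rightarrow> complex) \<Rightarrow> 'a hl0"
  where "restrict_hl0 u = Abs_hl0 (\<lambda>x. if norm x < 1 then u x else 0)"

lemma restrict_hl0_apply:
  assumes hol: "frechet_holomorphic_on u (ball 0 1)"
    and lip: "\<And>x y. norm x < 1 \<Longrightarrow> norm y < 1 \<Longrightarrow> cmod (u x - u y) \<le> C * norm (x - y)"
    and C: "0 \<le> C" and u0: "u 0 = 0"
  shows "hl0_apply (restrict_hl0 u) = (\<lambda>x. if norm x < 1 then u x else 0)"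
    and "norm (restrict_hl0 u) \<le> C"
proof -
  let ?v = "\<lambda>x. if norm x < 1 then u x else 0"
  have "frechet_holomorphic_on ?v (ball 0 1)"
    unfolding frechet_holomorphic_on_def
  proof
    fix x :: 'a assume x: "x \<in> ball 0 1"
    then obtain D where D: "bounded_clinear D" "(u has_derivative D) (at x)"
      using hol unfolding frechet_holomorphic_on_def by blast
    have "(?v has_derivative D) (at x)"
      by (rule has_derivative_transform_within_open[OF D(2) open_ball x]) simp
    with D show "\<exists>D. bounded_clinear D \<and> (?v has_derivative D) (at x)" by blast
  qed
  moreover have "C-lipschitz_on (ball 0 1) ?v"
    using lip C by (intro lipschitz_onI) (auto simp: dist_norm)
  ultimately have "?v \<in> hl0_functions"
    using u0 unfolding hl0_functions_def by auto
  then show *: "hl0_apply (restrict_hl0 u) = ?v"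
    unfolding restrict_hl0_def by (rule Abs_hl0_inverse)
  show "norm (restrict_hl0 u) \<le> C"
    by (rule norm_hl0_le) (use lip C in \<open>auto simp: *\<close>)
qed

definition g0_apply :: "'a::complex_normed_vector g0 \<Rightarrow> 'a hl0 \<Rightarrow> complex"
  where "g0_apply \<phi> = blinfun_apply (g0_functional \<phi>)"

lemma g0_apply_linear:
  shows g0_apply_add: "g0_apply (\<phi> + \<psi>) f = g0_apply \<phi> f + g0_apply \<psi> f"
    and g0_apply_diff: "g0_apply (\<phi> - \<psi>) f = g0_apply \<phi> f - g0_apply \<psi> f"
    and g0_apply_scaleC: "g0_apply (c *\<^sub>C \<phi>) f = c * g0_apply \<phi> f"
    and g0_apply_scaleR: "g0_apply (r *\<^sub>R \<phi>) f = r *\<^sub>R g0_apply \<phi> f"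
    and g0_apply_zero: "g0_apply 0 f = 0"
  by (simp_all add: g0_apply_def plus_g0.rep_eq minus_g0.rep_eq scaleC_g0.rep_eq scaleR_g0.rep_eq
      zero_g0.rep_eq blinfun.add_left blinfun.diff_left scaleC_blinfun.rep_eq blinfun.scaleR_left)

lemma g0_apply_sum: "g0_apply (sum h I) f = (\<Sum>i\<in>I. g0_apply (h i) f)"
  by (induction I rule: infinite_finite_induct) (auto simp: g0_apply_linear)

lemma bounded_clinear_g0_apply: "bounded_clinear (g0_apply \<phi>)"
  using g0_functional[of \<phi>] unfolding g0_functionals_def g0_apply_def by simp

lemma g0_apply_bound: "cmod (g0_apply \<phi> f) \<le> norm \<phi> * norm f"
  unfolding g0_apply_def norm_g0.rep_eq by (rule norm_blinfun)

lemma bounded_clinear_g0_apply_left: "bounded_clinear (\<lambda>\<phi>. g0_apply \<phi> f)"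
  by (rule bounded_clinear_intro[where K = "norm f"])
    (auto simp: g0_apply_linear g0_apply_bound mult.commute)

lemma norm_g0_le: "(\<And>f. cmod (g0_apply \<phi> f) \<le> C * norm f) \<Longrightarrow> 0 \<le> C \<Longrightarrow> norm \<phi> \<le> C"
  unfolding g0_apply_def norm_g0.rep_eq by (rule norm_blinfun_bound)

lemma g0_eqI: "(\<And>f. g0_apply \<phi> f = g0_apply \<psi> f) \<Longrightarrow> \<phi> = \<psi>"
  unfolding g0_apply_def by (metis blinfun_eqI g0_functional_inject)

definition delta :: "'a::complex_normed_vector \<Rightarrow> 'a g0"
  where "delta x = Abs_g0 (Blinfun (\<lambda>f. hl0_apply f x))"

lemma continuous_map_evaluation:
  assumes "norm x < 1"
  shows "continuous_map tau0 euclidean (\<lambda>f. hl0_apply f x)"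
  unfolding continuous_map_def
proof (intro conjI allI impI)
  fix U :: "complex set" assume U: "openin euclidean U"
  show "openin tau0 {f \<in> topspace tau0. hl0_apply f x \<in> U}"
  proof (subst openin_subopen, intro ballI)
    fix f assume "f \<in> {f \<in> topspace tau0. hl0_apply f x \<in> U}"
    then obtain e where e: "0 < e" "ball (hl0_apply f x) e \<subseteq> U"
      using U unfolding open_openin[symmetric] by (auto simp: open_contains_ball)
    define N where "N = {g. \<forall>y\<in>{x}. cmod (hl0_apply g y - hl0_apply f y) < e}"
    have "openin tau0 N"
      unfolding tau0_def N_def
      by (rule topology_generated_by_Basis) (use assms e in \<open>fastforce intro!: exI[of _ "{x}"]\<close>)
    moreover have "f \<in> N" using e by (simp add: N_def)
    moreover have "N \<subseteq> {f \<in> topspace tau0. hl0_apply f x \<in> U}"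
      using e(2) by (auto simp: N_def topspace_tau0 dist_norm norm_minus_commute subset_iff)
    ultimately show "\<exists>T. openin tau0 T \<and> f \<in> T \<and> T \<subseteq> {f \<in> topspace tau0. hl0_apply f x \<in> U}"
      by blast
  qed
qed simp

lemma g0_apply_delta: "g0_apply (delta x) f = hl0_apply f x"
proof -
  have bl: "bounded_clinear (\<lambda>f. hl0_apply f x)"
    by (rule bounded_clinear_intro[where K = "norm x"])
      (use hl0_bound in \<open>auto simp: plus_hl0.rep_eq scaleC_hl0.rep_eq mult.commute\<close>)
  have ap: "blinfun_apply (Blinfun (\<lambda>f. hl0_apply f x)) = (\<lambda>f. hl0_apply f x)"
    using bl by (simp add: bounded_linear_Blinfun_apply bounded_clinear_def)
  have "continuous_map (subtopology tau0 {f. norm f \<le> 1}) euclidean (\<lambda>f. hl0_apply f x)"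
  proof (cases "norm x < 1")
    case True
    then show ?thesis by (intro continuous_map_from_subtopology continuous_map_evaluation)
  next
    case False
    then show ?thesis by (simp add: hl0_apply_outside)
  qed
  then have "Blinfun (\<lambda>f. hl0_apply f x) \<in> g0_functionals"
    using bl unfolding g0_functionals_def by (simp add: ap)
  then show ?thesis
    unfolding delta_def g0_apply_def by (simp add: Abs_g0_inverse ap)
qed

lemma delta_zero [simp]: "delta 0 = 0"
  by (rule g0_eqI) (simp add: g0_apply_delta g0_apply_zero)

lemma delta_outside: "1 \<le> norm x \<Longrightarrow> delta x = 0"
  by (rule g0_eqI) (simp add: g0_apply_delta g0_apply_zero hl0_apply_outside)

lemma norm_delta: "norm (delta x) \<le> norm x"
  by (rule norm_g0_le) (use hl0_bound in \<open>auto simp: g0_apply_delta mult.commute\<close>)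

lemma norm_delta_diff: "norm x < 1 \<Longrightarrow> norm y < 1 \<Longrightarrow> norm (delta x - delta y) \<le> norm (x - y)"
  by (rule norm_g0_le) (use hl0_lipschitz in \<open>auto simp: g0_apply_delta g0_apply_diff mult.commute\<close>)

section \<open>Density of the point evaluations\<close>

text \<open>On the unit ball of the holomorphic Lipschitz functions, which is equicontinuous, the compact-open
  topology is the topology of pointwise convergence: values on a compact set are controlled by the
  values on a finite net.\<close>

lemma tau0_neighbourhood_zero:
  fixes U :: "'a::complex_normed_vector hl0 set"
  assumes "openin tau0 U" "0 \<in> U"
  shows "\<exists>X \<eta>. finite X \<and> 0 < \<eta> \<and> (\<forall>g. norm g \<le> 1 \<longrightarrow> (\<forall>x\<in>X. cmod (hl0_apply g x) < \<eta>) \<longrightarrow> g \<in> U)"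
proof -
  let ?S = "{{g :: 'a hl0. \<forall>x\<in>K. cmod (hl0_apply g x - hl0_apply f x) < e} | f K e.
      compact K \<and> K \<subseteq> ball 0 1 \<and> 0 < e}"
  have "generate_topology_on ?S U"
    using assms(1) unfolding tau0_def openin_topology_generated_by_iff .
  then show ?thesis using assms(2)
  proof induction
    case Empty
    then show ?case by simp
  next
    case (Int a b)
    obtain X \<eta> where X: "finite X" "0 < \<eta>"
      "\<forall>g. norm g \<le> 1 \<longrightarrow> (\<forall>x\<in>X. cmod (hl0_apply g x) < \<eta>) \<longrightarrow> g \<in> a"
      using Int.IH(1) Int.prems by auto
    obtain Y \<theta> where Y: "finite Y" "0 < \<theta>"
      "\<forall>g. norm g \<le> 1 \<longrightarrow> (\<forall>x\<in>Y. cmod (hl0_apply g x) < \<theta>) \<longrightarrow> g \<in> b"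
      using Int.IH(2) Int.prems by auto
    note * = X(1,2) Y(1,2) X(3)[rule_format] Y(3)[rule_format]
    have "g \<in> a \<inter> b" if "norm g \<le> 1" "\<forall>x\<in>X \<union> Y. cmod (hl0_apply g x) < min \<eta> \<theta>" for g
    proof
      show "g \<in> a" using that by (intro *(5)) auto
      show "g \<in> b" using that by (intro *(6)) auto
    qed
    then show ?case using * by (intro exI[of _ "X \<union> Y"] exI[of _ "min \<eta> \<theta>"]) auto
  next
    case (UN \<U>)
    then obtain V where "V \<in> \<U>" "0 \<in> V" by blast
    then obtain X \<eta> where "finite X" "0 < \<eta>"
      "\<And>g. norm g \<le> 1 \<Longrightarrow> \<forall>x\<in>X. cmod (hl0_apply g x) < \<eta> \<Longrightarrow> g \<in> V"
      using UN.IH by blast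
    then show ?case using \<open>V \<in> \<U>\<close> by (intro exI[of _ X] exI[of _ \<eta>]) auto
  next
    case (Basis s)
    then obtain f K e where s: "s = {g. \<forall>x\<in>K. cmod (hl0_apply g x - hl0_apply f x) < e}"
      and K: "compact K" "K \<subseteq> ball 0 1" and e: "0 < e" by blast
    have f: "cmod (hl0_apply f x) < e" if "x \<in> K" for x
      using Basis.prems that unfolding s by (auto simp: zero_hl0.rep_eq)
    have "\<exists>m<e. \<forall>x\<in>K. cmod (hl0_apply f x) \<le> m"
    proof (cases "K = {}")
      case True
      then show ?thesis using e by (intro exI[of _ 0]) auto
    next
      case False
      have "continuous_on K (\<lambda>x. cmod (hl0_apply f x))"
        using continuous_on_hl0 K(2) continuous_on_subset by (intro continuous_on_norm) blast
      from continuous_attains_sup[OF K(1) False this] show ?thesis using f by blast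
    qed
    then obtain m where m: "m < e" "\<And>x. x \<in> K \<Longrightarrow> cmod (hl0_apply f x) \<le> m" by blast
    define \<eta> where "\<eta> = (e - m) / 2"
    have \<eta>: "0 < \<eta>" using m by (simp add: \<eta>_def)
    obtain X where X: "X \<subseteq> K" "finite X" "K \<subseteq> (\<Union>x\<in>X. ball x \<eta>)"
      using compactE_image[OF K(1), of K "\<lambda>x. ball x \<eta>"] \<eta> by (metis UN_I centre_in_ball open_ball subsetI)
    have "g \<in> s" if g: "norm g \<le> 1" "\<forall>x\<in>X. cmod (hl0_apply g x) < \<eta>" for g
      unfolding s
    proof safe
      fix y assume y: "y \<in> K"
      then obtain x where x: "x \<in> X" "dist x y < \<eta>" using X(3) by auto
      have "cmod (hl0_apply g y - hl0_apply g x) \<le> norm g * norm (y - x)"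
        using x y X(1) K(2) by (intro hl0_lipschitz) auto
      also have "\<dots> \<le> 1 * norm (y - x)" using g by (intro mult_right_mono) auto
      also have "\<dots> < \<eta>" using x by (simp add: dist_norm norm_minus_commute)
      finally have "cmod (hl0_apply g y - hl0_apply g x) < \<eta>" .
      moreover have "cmod (hl0_apply g x) < \<eta>" using g x by blast
      moreover have "cmod (hl0_apply f y) \<le> m" using m y by blast
      moreover have "cmod (hl0_apply g y - hl0_apply f y)
        \<le> cmod (hl0_apply g y - hl0_apply g x) + cmod (hl0_apply g x) + cmod (hl0_apply f y)"
        by norm
      ultimately show "cmod (hl0_apply g y - hl0_apply f y) < e" by (simp add: \<eta>_def field_simps)
    qed
    then show ?case using X(2) \<eta> by blast
  qed
qed

text \<open>Continuity at 0 gives \<open>cmod (\<phi> f) \<le> e * norm f + C * m f\<close>, where \<open>m f\<close> is the sum of finitely many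
  \<open>cmod (f x)\<close>. By the Hahn--Banach theorem \<open>\<phi>\<close> splits into a part of norm at most \<open>e\<close> and a part
  dominated by \<open>C * m\<close>. The latter vanishes where the finitely many evaluations do, so it is a linear
  combination of them.\<close>

lemma g0_approx_delta:
  fixes \<phi> :: "'a::complex_normed_vector g0"
  assumes e: "0 < e"
  shows "\<exists>X c. finite X \<and> norm (\<phi> - (\<Sum>x\<in>X. c x *\<^sub>C delta x)) \<le> e"
proof -
  have "continuous_map (subtopology tau0 {f. norm f \<le> 1}) euclidean (g0_apply \<phi>)"
    using g0_functional[of \<phi>] unfolding g0_functionals_def g0_apply_def by simp
  then have "openin (subtopology tau0 {f. norm f \<le> 1})
      {f \<in> topspace (subtopology tau0 {f. norm f \<le> 1}). g0_apply \<phi> f \<in> ball 0 e}"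
    by (rule openin_continuous_map_preimage) simp
  then obtain U where U: "openin tau0 U" "{f. norm f \<le> 1 \<and> g0_apply \<phi> f \<in> ball 0 e} = U \<inter> {f. norm f \<le> 1}"
    by (auto simp: openin_subtopology topspace_tau0)
  have "(0::'a hl0) \<in> U"
  proof -
    have "(0::'a hl0) \<in> {f. norm f \<le> 1 \<and> g0_apply \<phi> f \<in> ball 0 e}"
      using e bounded_clinear_zero[OF bounded_clinear_g0_apply, of \<phi>] by simp
    then show ?thesis unfolding U(2) by blast
  qed
  from tau0_neighbourhood_zero[OF U(1) this] obtain X \<eta> where X: "finite X" "0 < \<eta>"
    "\<And>g. norm g \<le> 1 \<Longrightarrow> \<forall>x\<in>X. cmod (hl0_apply g x) < \<eta> \<Longrightarrow> g \<in> U" by blast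
  have small: "cmod (g0_apply \<phi> g) < e" if "norm g \<le> 1" "\<forall>x\<in>X. cmod (hl0_apply g x) < \<eta>" for g
  proof -
    have "g \<in> U \<inter> {f. norm f \<le> 1}" using X(3)[OF that] that by simp
    then show ?thesis by (simp only: U(2)[symmetric]) simp
  qed
  define m where "m f = (\<Sum>x\<in>X. cmod (hl0_apply f x))" for f
  define C where "C = norm \<phi> / \<eta>"
  have C: "0 \<le> C" using X(2) by (simp add: C_def)
  have m_nonneg: "0 \<le> m f" for f by (simp add: m_def sum_nonneg)
  have m_ge: "cmod (hl0_apply f x) \<le> m f" if "x \<in> X" for f x
    unfolding m_def using X(1) that by (intro member_le_sum) auto
  have m_add: "m (f + g) \<le> m f + m g" for f g
    unfolding m_def sum.distrib[symmetric]
    by (intro sum_mono) (simp add: plus_hl0.rep_eq norm_triangle_ineq)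
  have m_scale: "m (c *\<^sub>C f) = cmod c * m f" for c f
    by (simp add: m_def scaleC_hl0.rep_eq norm_mult sum_distrib_left)
  have m_scaleR: "m (r *\<^sub>R f) = r * m f" if "0 \<le> r" for r f
    using that by (simp add: scaleR_scaleC m_scale)
  have dominated: "cmod (g0_apply \<phi> f) \<le> e * norm f + C * m f" for f
  proof (cases "norm f = 0")
    case True
    then have "f = 0" by simp
    then show ?thesis using C m_nonneg[of f] bounded_clinear_zero[OF bounded_clinear_g0_apply, of \<phi>] by simp
  next
    case False
    then have f: "0 < norm f" by simp
    define g where "g = complex_of_real (inverse (norm f)) *\<^sub>C f"
    have g: "norm g \<le> 1" using f by (simp add: g_def norm_scaleC norm_inverse)
    show ?thesis
    proof (cases "\<forall>x\<in>X. cmod (hl0_apply g x) < \<eta>")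
      case True
      then have "cmod (g0_apply \<phi> g) < e" using small g by blast
      then have "cmod (g0_apply \<phi> f) < e * norm f"
        using f by (simp add: g_def bounded_clinearD[OF bounded_clinear_g0_apply] norm_mult norm_divide norm_inverse field_simps)
      then show ?thesis using C m_nonneg[of f] by (smt (verit) mult_nonneg_nonneg)
    next
      case False
      then obtain x where x: "x \<in> X" "\<eta> \<le> cmod (hl0_apply g x)" by force
      then have "\<eta> * norm f \<le> cmod (hl0_apply f x)"
        using f by (simp add: g_def scaleC_hl0.rep_eq norm_mult norm_divide norm_inverse field_simps)
      also have "\<dots> \<le> m f" by (rule m_ge[OF x(1)])
      finally have "norm f \<le> m f / \<eta>" using X(2) by (simp add: field_simps)
      then have "norm \<phi> * norm f \<le> norm \<phi> * (m f / \<eta>)" by (intro mult_left_mono) auto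
      then have "norm \<phi> * norm f \<le> C * m f" by (simp add: C_def)
      then show ?thesis using g0_apply_bound[of \<phi> f] e f by (smt (verit) mult_nonneg_nonneg)
    qed
  qed
  note \<phi>_lin = bounded_clinearD[OF bounded_clinear_g0_apply[of \<phi>]]
  \<comment> \<open>a linear \<open>\<psi>\<close> below W satisfies \<open>\<psi> f \<le> C * m f\<close> (take \<open>h = 0\<close>) and
      \<open>Re (\<phi> h) - \<psi> h \<le> e * norm h\<close> (take \<open>f = - h\<close>)\<close>
  define W where "W = {(f, t). \<exists>h. C * m (f + h) + e * norm h - Re (g0_apply \<phi> h) \<le> t}"
  have WI: "(f, t) \<in> W" if "C * m (f + h) + e * norm h - Re (g0_apply \<phi> h) \<le> t" for f t h
    using that unfolding W_def by blast
  have "\<exists>\<psi>. linear \<psi> \<and> (\<forall>f t. (f, t) \<in> W \<longrightarrow> \<psi> f \<le> t)"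
  proof (rule linear_functional_below_cone)
    fix f s g t assume "(f, s) \<in> W" "(g, t) \<in> W"
    then obtain h k where *: "C * m (f + h) + e * norm h - Re (g0_apply \<phi> h) \<le> s"
      "C * m (g + k) + e * norm k - Re (g0_apply \<phi> k) \<le> t" unfolding W_def by blast
    have "C * m (f + g + (h + k)) \<le> C * (m (f + h) + m (g + k))"
      using m_add[of "f + h" "g + k"] C by (intro mult_left_mono) (simp_all add: algebra_simps)
    moreover have "e * norm (h + k) \<le> e * (norm h + norm k)"
      using e norm_triangle_ineq by (intro mult_left_mono) auto
    ultimately show "(f + g, s + t) \<in> W"
      using * by (intro WI[of _ "h + k"]) (simp add: \<phi>_lin distrib_left)
  next
    fix r :: real and f t assume r: "0 \<le> r" and "(f, t) \<in> W"
    then obtain h where "C * m (f + h) + e * norm h - Re (g0_apply \<phi> h) \<le> t" unfolding W_def by blast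
    then have "r * (C * m (f + h) + e * norm h - Re (g0_apply \<phi> h)) \<le> r * t"
      using r by (intro mult_left_mono)
    moreover have "m (r *\<^sub>R f + r *\<^sub>R h) = r * m (f + h)"
      using m_scaleR[OF r, of "f + h"] by (simp add: scaleR_add_right)
    moreover have "Re (g0_apply \<phi> (r *\<^sub>R h)) = r * Re (g0_apply \<phi> h)"
      by (simp add: scaleR_scaleC \<phi>_lin)
    ultimately show "(r *\<^sub>R f, r * t) \<in> W"
      using r by (intro WI[of _ "r *\<^sub>R h"]) (simp add: algebra_simps)
  next
    show "\<exists>t. (f, t) \<in> W" for f using WI[of f 0] by blast
  next
    fix t assume "(0, t) \<in> W"
    then obtain h where h: "C * m h + e * norm h - Re (g0_apply \<phi> h) \<le> t" unfolding W_def by auto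
    then show "0 \<le> t" using dominated[of h] complex_Re_le_cmod[of "g0_apply \<phi> h"] by linarith
  qed
  then obtain \<psi> where \<psi>: "linear \<psi>" "\<And>f t. (f, t) \<in> W \<Longrightarrow> \<psi> f \<le> t" by blast
  define \<Psi> where "\<Psi> = complexify \<psi>"
  have \<Psi>: "\<Psi> (f + g) = \<Psi> f + \<Psi> g" "\<Psi> (c *\<^sub>C f) = c * \<Psi> f" for f g c
    using complexify_linear[OF \<psi>(1)] unfolding \<Psi>_def by auto
  have Re: "Re (\<Psi> f) = \<psi> f" for f by (simp add: \<Psi>_def complexify_def)
  have \<Psi>_m: "cmod (\<Psi> f) \<le> C * m f" for f
  proof (rule norm_le_of_Re_le[of \<Psi> f])
    fix c :: complex assume "cmod c = 1"
    then show "Re (\<Psi> (c *\<^sub>C f)) \<le> C * m f"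
      unfolding Re by (intro \<psi>(2) WI[of _ 0]) (simp add: m_scale \<phi>_lin)
  qed (rule \<Psi>)
  have close: "cmod (g0_apply \<phi> f - \<Psi> f) \<le> e * norm f" for f
  proof (rule norm_le_of_Re_le[of "\<lambda>f. g0_apply \<phi> f - \<Psi> f" f])
    fix c :: complex assume c: "cmod c = 1"
    have "\<psi> (- (c *\<^sub>C f)) \<le> e * norm f - Re (g0_apply \<phi> (c *\<^sub>C f))"
      using c m_scale[of 0 0] by (intro \<psi>(2) WI[of _ "c *\<^sub>C f"]) (simp add: norm_scaleC)
    then show "Re (g0_apply \<phi> (c *\<^sub>C f) - \<Psi> (c *\<^sub>C f)) \<le> e * norm f"
      by (simp add: Re linear_neg[OF \<psi>(1)])
  qed (simp add: \<phi>_lin \<Psi> right_diff_distrib)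
  have "\<exists>c. \<forall>f. \<Psi> f = (\<Sum>x\<in>X. c x * hl0_apply f x)"
  proof (rule functional_in_span_of_kernel)
    fix f assume "\<forall>x\<in>X. hl0_apply f x = 0"
    then have "m f = 0" by (simp add: m_def)
    then show "\<Psi> f = 0" using \<Psi>_m[of f] by simp
  qed (auto simp: X(1) \<Psi> plus_hl0.rep_eq scaleC_hl0.rep_eq)
  then obtain c where c: "\<And>f. \<Psi> f = (\<Sum>x\<in>X. c x * hl0_apply f x)" by blast
  have "norm (\<phi> - (\<Sum>x\<in>X. c x *\<^sub>C delta x)) \<le> e"
    using close e by (intro norm_g0_le)
      (auto simp: g0_apply_linear g0_apply_sum g0_apply_delta c)
  then show ?thesis using X(1) by blast
qed

text \<open>Density of the evaluations as an induction rule. Most properties of operators on the predual are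
  checked on the evaluations in this way.\<close>

lemma g0_induct [case_names delta add scaleC closed]:
  assumes delta: "\<And>x. norm x < 1 \<Longrightarrow> P (delta x)"
    and add: "\<And>\<phi> \<psi>. P \<phi> \<Longrightarrow> P \<psi> \<Longrightarrow> P (\<phi> + \<psi>)"
    and scaleC: "\<And>c \<phi>. P \<phi> \<Longrightarrow> P (c *\<^sub>C \<phi>)"
    and closed: "closed {\<phi>. P \<phi>}"
  shows "P \<phi>"
proof -
  have P0: "P 0" using delta[of 0] by simp
  have P_delta: "P (delta x)" for x
    using delta P0 by (cases "norm x < 1") (auto simp: delta_outside)
  have P_sum: "P (\<Sum>x\<in>X. c x *\<^sub>C delta x)" for X c
    by (induction X rule: infinite_finite_induct) (auto intro: P0 P_delta add scaleC)
  have "\<phi> \<in> closure {\<phi>. P \<phi>}"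
    unfolding closure_approachable
  proof (intro allI impI)
    fix e :: real assume "0 < e"
    then obtain X c where "norm (\<phi> - (\<Sum>x\<in>X. c x *\<^sub>C delta x)) \<le> e / 2"
      using g0_approx_delta[of "e / 2" \<phi>] by auto
    then show "\<exists>y\<in>{\<phi>. P \<phi>}. dist y \<phi> < e"
      using P_sum[of c X] \<open>0 < e\<close> by (intro bexI[of _ "\<Sum>x\<in>X. c x *\<^sub>C delta x"])
        (auto simp: dist_norm norm_minus_commute)
  qed
  then show ?thesis using closed by simp
qed

lemma bounded_clinear_eq_on_delta:
  fixes S T :: "'a::complex_normed_vector g0 \<Rightarrow> 'b::complex_normed_vector"
  assumes "bounded_clinear S" "bounded_clinear T" "\<And>x. norm x < 1 \<Longrightarrow> S (delta x) = T (delta x)"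
  shows "S \<phi> = T \<phi>"
proof (induction \<phi> rule: g0_induct)
  case closed
  show ?case
    using assms(1,2)[THEN bounded_clinear_bounded_linear]
    by (intro closed_Collect_eq linear_continuous_on)
qed (use assms in \<open>auto simp: bounded_clinearD\<close>)

section \<open>Holomorphy of the point evaluations\<close>

text \<open>Cauchy's inequality on discs of radius \<open>r\<close> bounds the second derivative on the unit disc.\<close>

lemma taylor_remainder_order_2:
  fixes g :: "complex \<Rightarrow> complex"
  assumes hol: "g holomorphic_on ball 0 (3 * r)" and r: "1 \<le> r"
    and bound: "\<And>z. cmod z \<le> 2 * r \<Longrightarrow> cmod (g z) \<le> M"
  shows "cmod (g 1 - g 0 - deriv g 0) \<le> 2 * M / r\<^sup>2"
proof -
  have near: "cmod w \<le> 2 * r" if "cmod z \<le> 1" "dist z w \<le> r" for z w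
    using that r norm_triangle_ineq[of z "w - z"] by (simp add: dist_norm norm_minus_commute)
  have sub: "cball z r \<subseteq> ball 0 (3 * r)" if "cmod z \<le> 1" for z
    using near[OF that] r by force
  have second: "cmod ((deriv ^^ 2) g z) \<le> 2 * M / r\<^sup>2" if z: "cmod z \<le> 1" for z
  proof -
    have "cmod ((deriv ^^ 2) g z) \<le> fact 2 * M / r ^ 2"
    proof (rule Cauchy_inequality)
      show "g holomorphic_on ball z r"
        by (rule holomorphic_on_subset[OF hol]) (use sub[OF z] ball_subset_cball in blast)
      show "continuous_on (cball z r) g"
        by (rule continuous_on_subset[OF holomorphic_on_imp_continuous_on[OF hol] sub[OF z]])
      show "cmod (g w) \<le> M" if "cmod (z - w) = r" for w
        using bound near[OF z, of w] that by (simp add: dist_norm)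
    qed (use r in auto)
    then show ?thesis by (simp add: fact_2)
  qed
  have "cmod ((deriv ^^ 0) g 1 - (\<Sum>i\<le>1. (deriv ^^ i) g 0 * (1 - 0) ^ i / fact i))
      \<le> 2 * M / r\<^sup>2 * cmod (1 - 0) ^ Suc 1 / fact 1"
  proof (rule complex_Taylor[of "cball 0 1"])
    fix i :: nat and x :: complex assume "x \<in> cball 0 1" "i \<le> 1"
    then have x: "x \<in> ball 0 (3 * r)" using r by auto
    have "(deriv ^^ i) g holomorphic_on ball 0 (3 * r)"
      by (rule holomorphic_higher_deriv[OF hol open_ball])
    from holomorphic_derivI[OF this open_ball x]
    show "((deriv ^^ i) g has_field_derivative (deriv ^^ Suc i) g x) (at x within cball 0 1)"
      by simp
  qed (use second in \<open>auto simp: numeral_2_eq_2\<close>)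
  then show ?thesis by (simp add: diff_diff_eq)
qed

lemma derivative_along_line:
  assumes D: "bounded_clinear D" and f: "(f has_derivative D) (at (x + z *\<^sub>C h))"
  shows "((\<lambda>z. f (x + z *\<^sub>C h)) has_derivative (\<lambda>z. z *\<^sub>C D h)) (at z)"
proof -
  have "bounded_linear (\<lambda>z::complex. z *\<^sub>C h)"
    by (rule bounded_linear_intro[where K = "norm h"])
      (simp_all add: scaleC_add_left norm_scaleC scaleR_scaleC scaleC_scaleC scaleR_conv_of_real)
  then have "((\<lambda>z. z *\<^sub>C h) has_derivative (\<lambda>z. z *\<^sub>C h)) (at z)"
    by (rule bounded_linear_imp_has_derivative)
  then have "((\<lambda>z. x + z *\<^sub>C h) has_derivative (\<lambda>z. z *\<^sub>C h)) (at z)"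
    using has_derivative_add[OF has_derivative_const] by fastforce
  from has_derivative_compose[OF this f] show ?thesis
    by (simp add: bounded_clinearD[OF D])
qed

lemma field_derivative_along_line:
  fixes f :: "'a::complex_normed_vector \<Rightarrow> complex"
  assumes "bounded_clinear D" "(f has_derivative D) (at (x + z *\<^sub>C h))"
  shows "((\<lambda>z. f (x + z *\<^sub>C h)) has_field_derivative D h) (at z)"
  using derivative_along_line[OF assms] by (simp add: has_field_derivative_def mult_commute_abs)

lemma frechet_holomorphic_along_line:
  fixes f :: "'a::complex_normed_vector \<Rightarrow> complex"
  assumes "frechet_holomorphic_on f (ball 0 1)"
  shows "(\<lambda>z. f (x + z *\<^sub>C h)) holomorphic_on {z. norm (x + z *\<^sub>C h) < 1}"
  unfolding holomorphic_on_def field_differentiable_def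
proof
  fix z assume "z \<in> {z. norm (x + z *\<^sub>C h) < 1}"
  then have "x + z *\<^sub>C h \<in> ball 0 1" by simp
  then obtain D where "bounded_clinear D" "(f has_derivative D) (at (x + z *\<^sub>C h))"
    using assms unfolding frechet_holomorphic_on_def by blast
  from field_derivative_along_line[OF this]
  show "\<exists>d. ((\<lambda>z. f (x + z *\<^sub>C h)) has_field_derivative d) (at z within {z. norm (x + z *\<^sub>C h) < 1})"
    by (meson has_field_derivative_at_within)
qed

text \<open>The remainder is quadratic in \<open>h\<close>, with a constant that depends on \<open>f\<close> only through its norm. On the
  line through \<open>x\<close> in direction \<open>h\<close> the function is holomorphic in a disc of radius \<open>\<rho> / norm h\<close>, and
  it varies by at most a multiple of \<open>\<rho> * norm f\<close> there.\<close>

lemma hl0_taylor_remainder: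
  fixes f :: "'a::complex_normed_vector hl0"
  assumes D: "bounded_clinear D" "(hl0_apply f has_derivative D) (at x)"
    and \<rho>: "norm x + \<rho> \<le> 1" "4 * norm h \<le> \<rho>" "0 < \<rho>"
  shows "cmod (hl0_apply f (x + h) - hl0_apply f x - D h) \<le> 16 / \<rho> * (norm h)\<^sup>2 * norm f"
proof (cases "h = 0")
  case True
  then show ?thesis using D(1) by (simp add: bounded_clinearD)
next
  case False
  then have h: "0 < norm h" by simp
  define r where "r = \<rho> / (4 * norm h)"
  have r: "1 \<le> r" "r * norm h = \<rho> / 4" using h \<rho> by (auto simp: r_def field_simps)
  define g where "g z = hl0_apply f (x + z *\<^sub>C h) - hl0_apply f x" for z
  have inside: "norm (x + z *\<^sub>C h) < 1" if "cmod z < 4 * r" for z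
  proof -
    have "norm (x + z *\<^sub>C h) \<le> norm x + cmod z * norm h"
      by (metis norm_scaleC norm_triangle_ineq)
    also have "\<dots> < norm x + (4 * r) * norm h"
      using that h by (intro add_strict_left_mono mult_strict_right_mono) auto
    also have "\<dots> \<le> 1" using r(2) \<rho> by simp
    finally show ?thesis .
  qed
  have "g holomorphic_on {z. norm (x + z *\<^sub>C h) < 1}"
    unfolding g_def by (intro holomorphic_intros frechet_holomorphic_along_line hl0_holomorphic)
  then have hol: "g holomorphic_on ball 0 (3 * r)"
    by (rule holomorphic_on_subset) (use inside r in force)
  have bound: "cmod (g z) \<le> norm f * (2 * r * norm h)" if "cmod z \<le> 2 * r" for z
  proof -
    have "cmod (g z) \<le> norm f * norm ((x + z *\<^sub>C h) - x)"
      unfolding g_def using that r \<rho> by (intro hl0_lipschitz inside) auto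
    also have "\<dots> \<le> norm f * (2 * r * norm h)"
      using that h by (intro mult_left_mono) (auto simp: norm_scaleC)
    finally show ?thesis .
  qed
  have "(g has_field_derivative D h) (at 0)"
    unfolding g_def using field_derivative_along_line[of D "hl0_apply f" x 0 h] D
    by (auto intro!: derivative_eq_intros simp: complex_vector.scale_zero_left)
  then have "deriv g 0 = D h" by (rule DERIV_imp_deriv)
  then have "cmod (hl0_apply f (x + h) - hl0_apply f x - D h) = cmod (g 1 - g 0 - deriv g 0)"
    by (simp add: g_def scaleC_one complex_vector.scale_zero_left)
  also have "\<dots> \<le> 2 * (norm f * (2 * r * norm h)) / r\<^sup>2"
    by (rule taylor_remainder_order_2[OF hol r(1) bound])
  also have "\<dots> = 4 * norm f * norm h / r"
    using r(1) by (simp add: power2_eq_square)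
  also have "\<dots> = 16 / \<rho> * (norm h)\<^sup>2 * norm f"
    using h \<rho>(3) by (simp add: r_def power2_eq_square)
  finally show ?thesis .
qed

text \<open>The quadratic bound on the Taylor remainders is uniform over the functions of norm at most 1, so
  it is a bound in the norm of the predual.\<close>

lemma frechet_holomorphic_delta: "frechet_holomorphic_on (delta :: 'a::complex_normed_vector \<Rightarrow> 'a g0) (ball 0 1)"
  unfolding frechet_holomorphic_on_def
proof
  fix x :: 'a assume "x \<in> ball 0 1"
  define \<rho> where "\<rho> = 1 - norm x"
  have \<rho>: "0 < \<rho>" "norm x + \<rho> \<le> 1" using \<open>x \<in> ball 0 1\<close> by (auto simp: \<rho>_def)
  have "\<exists>D. bounded_clinear D \<and> (hl0_apply f has_derivative D) (at x)" for f :: "'a hl0"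
    using hl0_holomorphic[of f] \<open>x \<in> ball 0 1\<close> unfolding frechet_holomorphic_on_def by blast
  then obtain d where d: "\<And>f. bounded_clinear (d f)" "\<And>f. (hl0_apply f has_derivative d f) (at x)"
    by metis
  \<comment> \<open>the derivative of \<open>f\<close> in a fixed direction, as a functional of \<open>f\<close>, lies in the predual because it is
      a norm limit of difference quotients of \<open>delta\<close>\<close>
  have quot: "\<exists>\<phi>. (\<forall>f. g0_apply \<phi> f = d f h) \<and> norm \<phi> \<le> norm h" for h :: 'a
  proof -
    obtain N where N: "real N > 4 * norm h / \<rho>" using reals_Archimedean2 by blast
    have N0: "real N > 0"
      using N \<rho>(1) by (smt (verit) divide_nonneg_pos norm_ge_zero)
    define s where "s n = real n + real N" for n
    have s: "s n > 0" "4 * norm h \<le> \<rho> * s n" for n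
    proof -
      show "s n > 0" using N0 by (simp add: s_def)
      have "4 * norm h < \<rho> * real N" using N \<rho>(1) by (simp add: field_simps)
      also have "\<dots> \<le> \<rho> * s n" using \<rho>(1) by (simp add: s_def)
      finally show "4 * norm h \<le> \<rho> * s n" by simp
    qed
    define q where "q n = s n *\<^sub>R (delta (x + (1 / s n) *\<^sub>R h) - delta x)" for n
    define c where "c = 16 / \<rho> * (norm h)\<^sup>2"
    have c: "0 \<le> c" using \<rho> by (simp add: c_def)
    have est: "cmod (g0_apply (q n) f - d f h) \<le> c / s n * norm f" for n f
    proof -
      have "d f ((1 / s n) *\<^sub>R h) = (1 / s n) *\<^sub>R d f h"
        by (simp add: scaleR_scaleC bounded_clinearD[OF d(1)])
      then have "g0_apply (q n) f - d f h
          = s n *\<^sub>R (hl0_apply f (x + (1 / s n) *\<^sub>R h) - hl0_apply f x - d f ((1 / s n) *\<^sub>R h))"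
        using s(1)[of n] by (simp add: q_def g0_apply_linear g0_apply_delta scaleR_diff_right)
      then have "cmod (g0_apply (q n) f - d f h)
          = s n * cmod (hl0_apply f (x + (1 / s n) *\<^sub>R h) - hl0_apply f x - d f ((1 / s n) *\<^sub>R h))"
        using s(1)[of n] by simp
      also have "\<dots> \<le> s n * (16 / \<rho> * (norm ((1 / s n) *\<^sub>R h))\<^sup>2 * norm f)"
        using s[of n] \<rho> by (intro mult_left_mono hl0_taylor_remainder d) (auto simp: field_simps)
      also have "\<dots> = c / s n * norm f"
        using s(1)[of n] by (simp add: c_def power2_eq_square)
      finally show ?thesis .
    qed
    have lim0: "(\<lambda>n. c / s n) \<longlonglongrightarrow> 0"
      unfolding s_def by real_asymp
    have qlim: "(\<lambda>n. g0_apply (q n) f) \<longlonglongrightarrow> d f h" for f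
    proof (rule LIM_zero_cancel, rule Lim_null_comparison)
      show "\<forall>\<^sub>F n in sequentially. cmod (g0_apply (q n) f - d f h) \<le> c / s n * norm f"
        using est by simp
      show "(\<lambda>n. c / s n * norm f) \<longlonglongrightarrow> 0"
        by (rule tendsto_mult_left_zero[OF lim0])
    qed
    have "Cauchy q"
    proof (rule CauchyI)
      fix e :: real assume "0 < e"
      then obtain M where M: "\<And>n. n \<ge> M \<Longrightarrow> c / s n < e / 2"
        using order_tendstoD(2)[OF lim0, of "e / 2"] by (auto simp: eventually_sequentially)
      have "norm (q m - q n) < e" if "m \<ge> M" "n \<ge> M" for m n
      proof -
        have "norm (q m - q n) \<le> c / s m + c / s n"
        proof (rule norm_g0_le)
          show "cmod (g0_apply (q m - q n) f) \<le> (c / s m + c / s n) * norm f" for f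
          proof -
            have "cmod (g0_apply (q m - q n) f)
                = cmod ((g0_apply (q m) f - d f h) - (g0_apply (q n) f - d f h))"
              by (simp add: g0_apply_diff)
            also have "\<dots> \<le> cmod (g0_apply (q m) f - d f h) + cmod (g0_apply (q n) f - d f h)"
              by (rule norm_triangle_ineq4)
            also have "\<dots> \<le> c / s m * norm f + c / s n * norm f"
              using est by (intro add_mono)
            finally show ?thesis by (simp add: distrib_right)
          qed
          show "0 \<le> c / s m + c / s n"
            using c s(1) by (intro add_nonneg_nonneg divide_nonneg_pos) auto
        qed
        then show ?thesis using M[OF that(1)] M[OF that(2)] by linarith
      qed
      then show "\<exists>M. \<forall>m\<ge>M. \<forall>n\<ge>M. norm (q m - q n) < e" by blast
    qed
    then obtain \<phi> where \<phi>: "q \<longlonglongrightarrow> \<phi>" by (auto simp: Cauchy_convergent_iff convergent_def)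
    have "g0_apply \<phi> f = d f h" for f
      using bounded_linear.tendsto[OF bounded_clinear_bounded_linear[OF bounded_clinear_g0_apply_left] \<phi>, of f]
        qlim[of f] LIMSEQ_unique by blast
    moreover have "norm (q n) \<le> norm h" for n
    proof -
      have "norm ((1 / s n) *\<^sub>R h) \<le> \<rho> / 4" using s[of n] by (simp add: field_simps)
      then have "norm (x + (1 / s n) *\<^sub>R h) < 1" "norm x < 1"
        using norm_triangle_ineq[of x "(1 / s n) *\<^sub>R h"] \<rho> by linarith+
      then have "norm (delta (x + (1 / s n) *\<^sub>R h) - delta x) \<le> norm (x + (1 / s n) *\<^sub>R h - x)"
        by (rule norm_delta_diff)
      then have "s n * norm (delta (x + (1 / s n) *\<^sub>R h) - delta x) \<le> norm h"
        using s(1)[of n] by (simp add: field_simps)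
      then show ?thesis using s(1)[of n] by (simp add: q_def del: scaleR_diff_right)
    qed
    then have "norm \<phi> \<le> norm h"
      using tendsto_norm[OF \<phi>] by (meson LIMSEQ_le_const2)
    ultimately show ?thesis by blast
  qed
  then obtain D where D: "\<And>h f. g0_apply (D h) f = d f h" "\<And>h. norm (D h) \<le> norm h"
    by metis
  have bl: "bounded_clinear D"
    by (rule bounded_clinear_intro[where K = 1])
      (auto intro!: g0_eqI simp: D g0_apply_linear bounded_clinearD[OF d(1)])
  have rem: "norm (delta (x + h) - delta x - D h) \<le> 16 / \<rho> * (norm h)\<^sup>2" if "4 * norm h \<le> \<rho>" for h
    using hl0_taylor_remainder[OF d \<rho>(2) that \<rho>(1)] \<rho>
    by (intro norm_g0_le) (auto simp: g0_apply_linear g0_apply_delta D)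
  have "(delta has_derivative D) (at x)"
    unfolding has_derivative_at_alt
  proof (intro conjI allI impI)
    fix e :: real assume e: "0 < e"
    have "norm (delta y - delta x - D (y - x)) \<le> e * norm (y - x)"
      if y: "norm (y - x) < min (\<rho> / 4) (e * \<rho> / 16)" for y
    proof -
      have "norm (delta y - delta x - D (y - x)) \<le> 16 / \<rho> * (norm (y - x))\<^sup>2"
        using rem[of "y - x"] y by simp
      also have "\<dots> = (16 / \<rho> * norm (y - x)) * norm (y - x)" by (simp add: power2_eq_square)
      also have "\<dots> \<le> e * norm (y - x)"
        using y \<rho>(1) by (intro mult_right_mono) (auto simp: field_simps)
      finally show ?thesis .
    qed
    then show "\<exists>t>0. \<forall>y. norm (y - x) < t \<longrightarrow> norm (delta y - delta x - D (y - x)) \<le> e * norm (y - x)"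
      using e \<rho>(1) by (intro exI[of _ "min (\<rho> / 4) (e * \<rho> / 16)"]) auto
  qed (rule bounded_clinear_bounded_linear[OF bl])
  with bl show "\<exists>D. bounded_clinear D \<and> ((delta :: 'a \<Rightarrow> 'a g0) has_derivative D) (at x)" by blast
qed

lemma frechet_holomorphic_on_clinear_comp:
  assumes F: "bounded_clinear F" and u: "frechet_holomorphic_on u U"
  shows "frechet_holomorphic_on (\<lambda>x. F (u x)) U"
  unfolding frechet_holomorphic_on_def
proof
  fix x assume "x \<in> U"
  then obtain D where D: "bounded_clinear D" "(u has_derivative D) (at x)"
    using u unfolding frechet_holomorphic_on_def by blast
  have "((\<lambda>x. F (u x)) has_derivative (\<lambda>x. F (D x))) (at x)"
    by (rule bounded_linear.has_derivative[OF bounded_clinear_bounded_linear[OF F] D(2)])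
  with bounded_clinear_compose[OF F D(1)]
  show "\<exists>D. bounded_clinear D \<and> ((\<lambda>x. F (u x)) has_derivative D) (at x)" by blast
qed

lemma frechet_holomorphic_on_comp_clinear:
  assumes A: "bounded_clinear A" and u: "frechet_holomorphic_on u V" and "\<And>x. x \<in> U \<Longrightarrow> A x \<in> V"
  shows "frechet_holomorphic_on (\<lambda>x. u (A x)) U"
  unfolding frechet_holomorphic_on_def
proof
  fix x assume "x \<in> U"
  then obtain D where D: "bounded_clinear D" "(u has_derivative D) (at (A x))"
    using u assms(3) unfolding frechet_holomorphic_on_def by blast
  have "((\<lambda>x. u (A x)) has_derivative (\<lambda>x. D (A x))) (at x)"
    by (rule has_derivative_compose[OF bounded_linear_imp_has_derivative[OF bounded_clinear_bounded_linear[OF A]] D(2)])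
  with bounded_clinear_compose[OF D(1) A]
  show "\<exists>D. bounded_clinear D \<and> ((\<lambda>x. u (A x)) has_derivative D) (at x)" by blast
qed

text \<open>The dual of the predual is the space of holomorphic Lipschitz functions: a functional \<open>F\<close> is
  represented by \<open>F \<circ> delta\<close>.\<close>

lemma g0_dual:
  fixes F :: "'a::complex_normed_vector g0 \<Rightarrow> complex"
  assumes F: "bounded_clinear F"
  shows "\<exists>f. (\<forall>x. hl0_apply f x = F (delta x)) \<and> (\<forall>\<phi>. F \<phi> = g0_apply \<phi> f)"
proof -
  obtain K where K: "0 \<le> K" "\<And>\<phi>. cmod (F \<phi>) \<le> norm \<phi> * K"
    using bounded_linear.nonneg_bounded[OF bounded_clinear_bounded_linear[OF F]] by blast
  define f where "f = restrict_hl0 (\<lambda>x. F (delta x))"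
  have f: "hl0_apply f = (\<lambda>x. if norm x < 1 then F (delta x) else 0)"
    unfolding f_def
  proof (rule restrict_hl0_apply(1)[OF frechet_holomorphic_on_clinear_comp[OF F frechet_holomorphic_delta]])
    fix x y :: 'a assume "norm x < 1" "norm y < 1"
    then have "norm (delta x - delta y) * K \<le> norm (x - y) * K"
      using K(1) by (intro mult_right_mono norm_delta_diff)
    then show "cmod (F (delta x) - F (delta y)) \<le> K * norm (x - y)"
      using K(2)[of "delta x - delta y"] by (simp add: bounded_clinearD[OF F] mult.commute)
  qed (use K(1) in \<open>auto simp: bounded_clinearD[OF F]\<close>)
  then have "hl0_apply f x = F (delta x)" for x
    by (auto simp: delta_outside bounded_clinearD[OF F])
  moreover have "F \<phi> = g0_apply \<phi> f" for \<phi>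
    by (rule bounded_clinear_eq_on_delta[OF F bounded_clinear_g0_apply_left]) (simp add: g0_apply_delta f)
  ultimately show ?thesis by blast
qed

section \<open>Linearisation\<close>

lemma norm_le_by_functionals:
  fixes y :: "'a::complex_normed_vector"
  assumes "\<And>F :: 'a \<Rightarrow> complex. bounded_clinear F \<Longrightarrow> (\<And>x. cmod (F x) \<le> norm x) \<Longrightarrow> cmod (F y) \<le> c"
  shows "norm y \<le> c"
proof (rule ccontr)
  assume "\<not> norm y \<le> c"
  moreover have "0 \<le> c"
    using assms[of "\<lambda>x. 0"] by (simp add: bounded_clinear_def)
  ultimately obtain r where r: "c < r" "r < norm y" "0 < r" using dense[of c "norm y"] by auto
  have "1 < norm ((1 / r) *\<^sub>R y)" using r by simp
  then obtain F :: "'a \<Rightarrow> complex" where F: "bounded_clinear F" "\<And>x. cmod (F x) \<le> norm x"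
      "1 \<le> cmod (F ((1 / r) *\<^sub>R y))"
    using norming_functional by blast
  then have "r \<le> cmod (F y)"
    using r by (simp add: scaleR_scaleC bounded_clinearD[OF F(1)] norm_mult norm_divide field_simps)
  then show False using assms[OF F(1,2)] r by simp
qed

text \<open>The universal property of the predual. The value \<open>y = T \<phi>\<close> is determined by its images under the
  functionals \<open>F\<close> on the target, which must be \<open>\<phi>\<close> applied to \<open>F \<circ> u\<close>. The relation \<open>R \<phi> y\<close> expressing
  this is linear, contains \<open>(delta x, u x)\<close>, and bounds \<open>norm y\<close> by \<open>C * norm \<phi>\<close>; hence its domain is
  closed and, by density of the evaluations, everything.\<close>

theorem linearization:
  fixes u :: "'a::complex_normed_vector \<Rightarrow> 'b::complex_banach"
  assumes hol: "frechet_holomorphic_on u (ball 0 1)"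
    and lip: "\<And>x y. norm x < 1 \<Longrightarrow> norm y < 1 \<Longrightarrow> norm (u x - u y) \<le> C * norm (x - y)"
    and C: "0 \<le> C" and u0: "u 0 = 0"
  shows "\<exists>T. bounded_clinear T \<and> (\<forall>x. norm x < 1 \<longrightarrow> T (delta x) = u x) \<and> (\<forall>\<phi>. norm (T \<phi>) \<le> C * norm \<phi>)"
proof -
  define contr where "contr F \<longleftrightarrow> bounded_clinear F \<and> (\<forall>y. cmod (F y) \<le> norm y)" for F :: "'b \<Rightarrow> complex"
  define p where "p F = restrict_hl0 (\<lambda>x. F (u x))" for F
  have p: "hl0_apply (p F) = (\<lambda>x. if norm x < 1 then F (u x) else 0)" "norm (p F) \<le> C" if "contr F" for F
  proof -
    have F: "bounded_clinear F" "\<And>y. cmod (F y) \<le> norm y" using that by (auto simp: contr_def)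
    have l: "cmod (F (u x) - F (u y)) \<le> C * norm (x - y)" if "norm x < 1" "norm y < 1" for x y
      using F(2)[of "u x - u y"] lip[OF that] by (simp add: bounded_clinearD[OF F(1)])
    note * = restrict_hl0_apply[OF frechet_holomorphic_on_clinear_comp[OF F(1) hol] l C]
    show "hl0_apply (p F) = (\<lambda>x. if norm x < 1 then F (u x) else 0)" "norm (p F) \<le> C"
      unfolding p_def using * by (auto simp: u0 bounded_clinearD[OF F(1)])
  qed
  define R where "R \<phi> y \<longleftrightarrow> (\<forall>F. contr F \<longrightarrow> F y = g0_apply \<phi> (p F))" for \<phi> y
  have R_bound: "norm y \<le> C * norm \<phi>" if "R \<phi> y" for \<phi> y
  proof (rule norm_le_by_functionals)
    fix F :: "'b \<Rightarrow> complex" assume "bounded_clinear F" "\<And>x. cmod (F x) \<le> norm x"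
    then have F: "contr F" by (simp add: contr_def)
    then have "cmod (F y) \<le> norm \<phi> * norm (p F)"
      using that g0_apply_bound[of \<phi> "p F"] by (simp add: R_def)
    also have "\<dots> \<le> norm \<phi> * C" using p(2)[OF F] by (intro mult_left_mono) auto
    finally show "cmod (F y) \<le> C * norm \<phi>" by (simp add: mult.commute)
  qed
  have R_add: "R (\<phi> + \<psi>) (y + z)" and R_diff: "R (\<phi> - \<psi>) (y - z)"
    if "R \<phi> y" "R \<psi> z" for \<phi> \<psi> y z
    using that unfolding R_def by (auto simp: g0_apply_linear bounded_clinearD contr_def)
  have R_scaleC: "R (c *\<^sub>C \<phi>) (c *\<^sub>C y)" if "R \<phi> y" for c \<phi> y
    using that unfolding R_def by (auto simp: g0_apply_linear bounded_clinearD contr_def)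
  have R_delta: "R (delta x) (u x)" if "norm x < 1" for x
    using that unfolding R_def by (auto simp: g0_apply_delta p)
  have R_unique: "y = z" if "R \<phi> y" "R \<phi> z" for \<phi> y z
    using R_bound[OF R_diff[OF that]] by simp
  have "\<exists>y. R \<phi> y" for \<phi>
  proof (induction \<phi> rule: g0_induct)
    case closed
    show ?case
      unfolding closed_sequential_limits
    proof (intro allI impI, elim conjE)
      fix \<phi> \<psi> assume mem: "\<forall>n. \<phi> n \<in> {\<phi>. \<exists>y. R \<phi> y}" and lim: "\<phi> \<longlonglongrightarrow> \<psi>"
      then obtain y where y: "\<And>n. R (\<phi> n) (y n)" by (auto simp: choice_iff)
      have "Cauchy y"
      proof (rule CauchyI)
        fix e :: real assume e: "0 < e"
        then have "0 < e / (C + 1)" using C by simp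
        then obtain M where M: "\<And>m n. m \<ge> M \<Longrightarrow> n \<ge> M \<Longrightarrow> norm (\<phi> m - \<phi> n) < e / (C + 1)"
          using CauchyD[OF LIMSEQ_imp_Cauchy[OF lim]] by blast
        have "norm (y m - y n) < e" if "m \<ge> M" "n \<ge> M" for m n
        proof -
          have "norm (y m - y n) \<le> C * norm (\<phi> m - \<phi> n)"
            by (rule R_bound[OF R_diff[OF y y]])
          also have "\<dots> \<le> (C + 1) * norm (\<phi> m - \<phi> n)" by (intro mult_right_mono) auto
          also have "\<dots> < e" using M[OF that] C by (simp add: field_simps)
          finally show ?thesis .
        qed
        then show "\<exists>M. \<forall>m\<ge>M. \<forall>n\<ge>M. norm (y m - y n) < e" by blast
      qed
      then obtain z where z: "y \<longlonglongrightarrow> z" by (auto simp: Cauchy_convergent_iff convergent_def)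
      have "R \<psi> z"
        unfolding R_def
      proof (intro allI impI)
        fix F assume F: "contr F"
        then have "(\<lambda>n. F (y n)) \<longlonglongrightarrow> F z"
          using z by (auto simp: contr_def intro: bounded_linear.tendsto bounded_clinear_bounded_linear)
        moreover have "F (y n) = g0_apply (\<phi> n) (p F)" for n
          using y[of n] F unfolding R_def by blast
        then have "(\<lambda>n. F (y n)) \<longlonglongrightarrow> g0_apply \<psi> (p F)"
          using bounded_linear.tendsto[OF bounded_clinear_bounded_linear[OF bounded_clinear_g0_apply_left] lim]
          by simp
        ultimately show "F z = g0_apply \<psi> (p F)" by (rule LIMSEQ_unique)
      qed
      then show "\<psi> \<in> {\<phi>. \<exists>y. R \<phi> y}" by blast
    qed
  qed (use R_delta R_add R_scaleC in blast)+
  then obtain T where T: "\<And>\<phi>. R \<phi> (T \<phi>)" by metis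
  have "bounded_clinear T"
  proof (rule bounded_clinear_intro)
    show "T (\<phi> + \<psi>) = T \<phi> + T \<psi>" for \<phi> \<psi> by (rule R_unique[OF T R_add[OF T T]])
    show "T (c *\<^sub>C \<phi>) = c *\<^sub>C T \<phi>" for c \<phi> by (rule R_unique[OF T R_scaleC[OF T]])
  qed (rule R_bound[OF T])
  moreover have "T (delta x) = u x" if "norm x < 1" for x
    by (rule R_unique[OF T R_delta[OF that]])
  ultimately show ?thesis using R_bound[OF T] by blast
qed

section \<open>Operators induced by linear contractions\<close>

definition contraction :: "('a::complex_normed_vector \<Rightarrow> 'b::complex_normed_vector) \<Rightarrow> bool"
  where "contraction A \<longleftrightarrow> bounded_clinear A \<and> (\<forall>x. norm (A x) \<le> norm x)"

text \<open>The functor that sends a linear contraction \<open>A\<close> to the operator dual to \<open>f \<mapsto> f \<circ> A\<close>.\<close>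

definition g0_map :: "('a::complex_normed_vector \<Rightarrow> 'b::complex_normed_vector) \<Rightarrow> 'a g0 \<Rightarrow> 'b g0"
  where "g0_map A = (SOME T. bounded_clinear T \<and> (\<forall>x. norm x < 1 \<longrightarrow> T (delta x) = delta (A x)) \<and>
    (\<forall>\<phi>. norm (T \<phi>) \<le> 1 * norm \<phi>))"

lemma g0_map:
  assumes "contraction A"
  shows bounded_clinear_g0_map: "bounded_clinear (g0_map A)"
    and g0_map_delta: "norm x < 1 \<Longrightarrow> g0_map A (delta x) = delta (A x)"
    and norm_g0_map: "norm (g0_map A \<phi>) \<le> norm \<phi>"
proof -
  have A: "bounded_clinear A" "\<And>x. norm (A x) \<le> norm x" using assms by (auto simp: contraction_def)
  have inside: "norm (A x) < 1" if "norm x < 1" for x using A(2)[of x] that by simp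
  have "\<exists>T. bounded_clinear T \<and> (\<forall>x. norm x < 1 \<longrightarrow> T (delta x) = delta (A x)) \<and>
    (\<forall>\<phi>. norm (T \<phi>) \<le> 1 * norm \<phi>)"
  proof (rule linearization)
    show "frechet_holomorphic_on (\<lambda>x. delta (A x)) (ball 0 1)"
      using inside by (intro frechet_holomorphic_on_comp_clinear[OF A(1) frechet_holomorphic_delta]) auto
    fix x y :: 'a assume "norm x < 1" "norm y < 1"
    then have "norm (delta (A x) - delta (A y)) \<le> norm (A x - A y)"
      by (intro norm_delta_diff inside)
    also have "\<dots> \<le> norm (x - y)" using A(2)[of "x - y"] by (simp add: bounded_clinearD[OF A(1)])
    finally show "norm (delta (A x) - delta (A y)) \<le> 1 * norm (x - y)" by simp
  qed (auto simp: bounded_clinearD[OF A(1)])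
  from someI_ex[OF this, folded g0_map_def]
  show "bounded_clinear (g0_map A)" "norm x < 1 \<Longrightarrow> g0_map A (delta x) = delta (A x)"
    "norm (g0_map A \<phi>) \<le> norm \<phi>" by auto
qed

lemma g0_map_commute:
  fixes B :: "'a::complex_normed_vector \<Rightarrow> 'b::complex_normed_vector" and A :: "'b \<Rightarrow> 'c::complex_normed_vector"
    and B' :: "'a \<Rightarrow> 'd::complex_normed_vector" and A' :: "'d \<Rightarrow> 'c"
  assumes "contraction A" "contraction B" "contraction A'" "contraction B'"
    "\<And>x. A (B x) = A' (B' x)"
  shows "g0_map A (g0_map B \<phi>) = g0_map A' (g0_map B' \<phi>)"
proof (rule bounded_clinear_eq_on_delta[of "\<lambda>\<phi>. g0_map A (g0_map B \<phi>)" "\<lambda>\<phi>. g0_map A' (g0_map B' \<phi>)"])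
  show "bounded_clinear (\<lambda>\<phi>. g0_map A (g0_map B \<phi>))" "bounded_clinear (\<lambda>\<phi>. g0_map A' (g0_map B' \<phi>))"
    by (rule bounded_clinear_compose[OF bounded_clinear_g0_map[OF assms(1)] bounded_clinear_g0_map[OF assms(2)]])
      (rule bounded_clinear_compose[OF bounded_clinear_g0_map[OF assms(3)] bounded_clinear_g0_map[OF assms(4)]])
  fix x :: 'a assume x: "norm x < 1"
  then have "norm (B x) < 1" "norm (B' x) < 1"
    using assms(2,4) unfolding contraction_def by (meson le_less_trans)+
  then show "g0_map A (g0_map B (delta x)) = g0_map A' (g0_map B' (delta x))"
    using assms x by (simp add: g0_map_delta)
qed

lemma bounded_clinear_scaleC_const: "bounded_clinear (\<lambda>x. c *\<^sub>C x)"
  by (simp add: bounded_clinear_def bounded_linear_scaleC scaleC_scaleC mult.commute)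

lemma contraction_scaleC: "cmod z \<le> 1 \<Longrightarrow> contraction (\<lambda>x. z *\<^sub>C x)"
  by (auto simp: contraction_def bounded_clinear_scaleC_const norm_scaleC mult_left_le_one_le)

definition dilation :: "complex \<Rightarrow> 'a::complex_normed_vector g0 \<Rightarrow> 'a g0"
  where "dilation z = g0_map (\<lambda>x. z *\<^sub>C x)"

lemma dilation:
  assumes "cmod z \<le> 1"
  shows bounded_clinear_dilation: "bounded_clinear (dilation z)"
    and dilation_delta: "norm x < 1 \<Longrightarrow> dilation z (delta x) = delta (z *\<^sub>C x)"
    and norm_dilation: "norm (dilation z \<phi>) \<le> norm \<phi>"
  using g0_map[OF contraction_scaleC[OF assms]] unfolding dilation_def by auto

lemma continuous_on_dilation: "continuous_on (cball 0 1) (\<lambda>z. dilation z \<phi>)"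
proof (induction \<phi> rule: g0_induct)
  case (delta x)
  have "norm (dilation z (delta x) - dilation w (delta x)) \<le> 1 * norm (z - w)"
    if "z \<in> cball 0 1" "w \<in> cball 0 1" for z w
  proof -
    have zw: "cmod z \<le> 1" "cmod w \<le> 1" using that by auto
    have in1: "norm (z *\<^sub>C x) < 1" "norm (w *\<^sub>C x) < 1"
      using delta zw by (auto simp: norm_scaleC intro: le_less_trans[OF mult_left_le_one_le])
    have "norm (dilation z (delta x) - dilation w (delta x)) \<le> norm (z *\<^sub>C x - w *\<^sub>C x)"
      using norm_delta_diff[OF in1] zw delta by (simp add: dilation_delta)
    also have "\<dots> = norm (z - w) * norm x"
      by (simp add: norm_scaleC flip: complex_vector.scale_left_diff_distrib)
    also have "\<dots> \<le> norm (z - w)" using delta by (simp add: mult_left_le)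
    finally show ?thesis by simp
  qed
  then have "1-lipschitz_on (cball 0 1) (\<lambda>z. dilation z (delta x))"
    by (intro lipschitz_onI) (auto simp: dist_norm)
  then show ?case by (rule lipschitz_on_continuous_on)
next
  case (add \<phi> \<psi>)
  then have "continuous_on (cball 0 1) (\<lambda>z. dilation z \<phi> + dilation z \<psi>)"
    by (rule continuous_on_add)
  then show ?case
    by (rule continuous_on_eq) (simp add: bounded_clinear_add[OF bounded_clinear_dilation])
next
  case (scaleC c \<phi>)
  then have "continuous_on (cball 0 1) (\<lambda>z. c *\<^sub>C dilation z \<phi>)"
    by (rule bounded_linear.continuous_on[OF bounded_linear_scaleC])
  then show ?case
    by (rule continuous_on_eq) (simp add: bounded_clinear_scaleC[OF bounded_clinear_dilation])
next
  case closed
  show ?case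
    unfolding closed_sequential_limits
  proof (intro allI impI, elim conjE)
    fix \<phi> and \<psi> :: "'a g0"
    assume mem: "\<forall>n. \<phi> n \<in> {\<phi>. continuous_on (cball 0 1) (\<lambda>z. dilation z \<phi>)}" and lim: "\<phi> \<longlonglongrightarrow> \<psi>"
    have "uniform_limit (cball 0 1) (\<lambda>n z. dilation z (\<phi> n)) (\<lambda>z. dilation z \<psi>) sequentially"
    proof (rule uniform_limitI)
      fix e :: real assume "0 < e"
      with lim have "\<forall>\<^sub>F n in sequentially. dist (\<phi> n) \<psi> < e" by (rule tendstoD)
      then show "\<forall>\<^sub>F n in sequentially. \<forall>z\<in>cball 0 1. dist (dilation z (\<phi> n)) (dilation z \<psi>) < e"
      proof eventually_elim
        case (elim n)
        have "dist (dilation z (\<phi> n)) (dilation z \<psi>) \<le> dist (\<phi> n) \<psi>" if "cmod z \<le> 1" for z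
          using norm_dilation[OF that, of "\<phi> n - \<psi>"]
          by (simp add: dist_norm bounded_clinear_diff[OF bounded_clinear_dilation[OF that]])
        then show ?case using elim by (meson le_less_trans mem_cball_0)
      qed
    qed
    moreover have "\<forall>\<^sub>F n in sequentially. continuous_on (cball 0 1) (\<lambda>z. dilation z (\<phi> n))"
      using mem by simp
    ultimately show "\<psi> \<in> {\<phi>. continuous_on (cball 0 1) (\<lambda>z. dilation z \<phi>)}"
      using uniform_limit_theorem by (metis mem_Collect_eq sequentially_bot)
  qed
qed

lemma dilation_one: "dilation 1 \<phi> = \<phi>"
proof (rule bounded_clinear_eq_on_delta)
  show "bounded_clinear (\<lambda>\<phi>::'a g0. \<phi>)" by (simp add: bounded_clinear_def)
qed (auto simp: bounded_clinear_dilation dilation_delta scaleC_one)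

text \<open>Pointwise convergence is uniform on compact sets because dilations do not increase the norm.\<close>

lemma dilation_approximates_identity:
  fixes K :: "'a::complex_normed_vector g0 set"
  assumes "compact K" "0 < e"
  shows "\<exists>r::real. 0 \<le> r \<and> r < 1 \<and> (\<forall>\<phi>\<in>K. norm (dilation (complex_of_real r) \<phi> - \<phi>) < e)"
proof -
  obtain X where X: "X \<subseteq> K" "finite X" "K \<subseteq> (\<Union>\<phi>\<in>X. ball \<phi> (e / 3))"
    using compactE_image[OF assms(1), of K "\<lambda>\<phi>. ball \<phi> (e / 3)"] assms(2)
    by (metis UN_I centre_in_ball divide_pos_pos open_ball subsetI zero_less_numeral)
  define r where "r n = 1 - 1 / real (Suc n)" for n
  have r: "0 \<le> r n" "r n < 1" for n by (auto simp: r_def)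
  have "r \<longlonglongrightarrow> 1" unfolding r_def by real_asymp
  then have r1: "(\<lambda>n. complex_of_real (r n)) \<longlonglongrightarrow> 1"
    using tendsto_of_real[of r 1 sequentially] by simp
  have "(\<lambda>n. dilation (r n) \<phi>) \<longlonglongrightarrow> dilation 1 \<phi>" for \<phi> :: "'a g0"
    by (rule continuous_on_tendsto_compose[OF continuous_on_dilation r1]) (use r in \<open>auto simp: less_imp_le\<close>)
  then have "\<forall>\<^sub>F n in sequentially. \<forall>\<phi>\<in>X. dist (dilation (r n) \<phi>) \<phi> < e / 3"
  proof (intro eventually_ball_finite ballI X(2))
    fix \<phi> assume "\<phi> \<in> X"
    show "\<forall>\<^sub>F n in sequentially. dist (dilation (r n) \<phi>) \<phi> < e / 3"
      using tendstoD[OF \<open>(\<lambda>n. dilation (r n) \<phi>) \<longlonglongrightarrow> dilation 1 \<phi>\<close>, of "e / 3"] assms(2)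
      by (simp add: dilation_one)
  qed
  then obtain n where n: "\<And>\<phi>. \<phi> \<in> X \<Longrightarrow> dist (dilation (r n) \<phi>) \<phi> < e / 3"
    by (auto simp: eventually_sequentially)
  have "norm (dilation (r n) \<phi> - \<phi>) < e" if "\<phi> \<in> K" for \<phi>
  proof -
    have rn: "cmod (r n) \<le> 1" using r[of n] by simp
    have "\<phi> \<in> (\<Union>\<phi>\<in>X. ball \<phi> (e / 3))" by (rule subsetD[OF X(3) that])
    then obtain \<psi> where \<psi>: "\<psi> \<in> X" "dist \<psi> \<phi> < e / 3"
      unfolding UN_iff mem_ball by blast
    have "dist (dilation (r n) \<phi>) (dilation (r n) \<psi>) \<le> dist \<phi> \<psi>"
      using norm_dilation[OF rn, of "\<phi> - \<psi>"]
      by (simp add: dist_norm bounded_clinear_diff[OF bounded_clinear_dilation[OF rn]])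
    then have "dist (dilation (r n) \<phi>) \<phi> < e"
      using n[OF \<psi>(1)] \<psi>(2) dist_triangle[of "dilation (r n) \<phi>" \<phi> "dilation (r n) \<psi>"]
        dist_triangle[of "dilation (r n) \<psi>" \<phi> \<psi>] by (simp add: dist_commute)
    then show ?thesis by (simp add: dist_norm)
  qed
  then show ?thesis using r[of n] by blast
qed

section \<open>Homogeneous components\<close>

lemma bounded_bilinear_scaleC:
  "bounded_bilinear (scaleC :: complex \<Rightarrow> 'a::complex_normed_vector \<Rightarrow> 'a)"
proof
  show "\<exists>K. \<forall>a b. norm (a *\<^sub>C (b::'a)) \<le> norm a * norm b * K"
    by (rule exI[of _ 1]) (simp add: norm_scaleC)
qed (simp_all add: scaleC_add_left scaleC_add_right scaleR_scaleC scaleC_scaleC scaleR_conv_of_real mult.commute)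

definition circle_exp :: "real \<Rightarrow> complex"
  where "circle_exp t = exp (2 * of_real pi * \<i> * of_real t)"

lemma norm_circle_exp [simp]: "cmod (circle_exp t) = 1"
  by (simp add: circle_exp_def norm_exp_eq_Re)

lemma circle_exp_nonzero [simp]: "circle_exp t \<noteq> 0"
  by (simp add: circle_exp_def)

lemma continuous_on_circle_exp: "continuous_on S circle_exp"
  unfolding circle_exp_def by (intro continuous_intros)

text \<open>The Fourier coefficients of the rotations. This is the projection dual to taking the homogeneous
  part of degree \<open>k\<close> of a function. An integral with values in the predual, rather than an operator
  on functions, avoids proving that the homogeneous parts of a holomorphic function on an
  infinite-dimensional ball are holomorphic.\<close>

definition hproj :: "nat \<Rightarrow> 'a::complex_normed_vector g0 \<Rightarrow> 'a g0"
  where "hproj k \<phi> = integral {0..1} (\<lambda>t. inverse (circle_exp t) ^ k *\<^sub>C dilation (circle_exp t) \<phi>)"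

lemma continuous_on_hproj_integrand:
  "continuous_on S (\<lambda>t. inverse (circle_exp t) ^ k *\<^sub>C dilation (circle_exp t) \<phi>)"
proof (rule bounded_bilinear.continuous_on[OF bounded_bilinear_scaleC])
  show "continuous_on S (\<lambda>t. inverse (circle_exp t) ^ k)"
    by (intro continuous_intros continuous_on_circle_exp) simp
  show "continuous_on S (\<lambda>t. dilation (circle_exp t) \<phi>)"
    by (rule continuous_on_compose2[OF continuous_on_dilation continuous_on_circle_exp]) auto
qed

lemma hproj_integrable:
  "(\<lambda>t. inverse (circle_exp t) ^ k *\<^sub>C dilation (circle_exp t) \<phi>) integrable_on {0..1}"
  by (rule integrable_continuous_real[OF continuous_on_hproj_integrand])

lemma clinear_hproj:
  assumes L: "bounded_clinear L"
  shows "L (hproj k \<phi>) = integral {0..1} (\<lambda>t. inverse (circle_exp t) ^ k *\<^sub>C L (dilation (circle_exp t) \<phi>))"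
  using integral_linear[OF hproj_integrable bounded_clinear_bounded_linear[OF L], of k \<phi>]
  by (simp add: hproj_def o_def bounded_clinear_scaleC[OF L])

lemma norm_hproj: "norm (hproj k \<phi>) \<le> norm \<phi>"
proof -
  have "norm (integral {0..1} (\<lambda>t. inverse (circle_exp t) ^ k *\<^sub>C dilation (circle_exp t) \<phi>)) \<le> norm \<phi> * (1 - 0)"
    by (rule integral_bound[OF _ continuous_on_hproj_integrand])
      (auto simp: norm_scaleC norm_power norm_inverse norm_dilation)
  then show ?thesis by (simp add: hproj_def)
qed

lemma bounded_clinear_hproj: "bounded_clinear (hproj k)"
proof (rule bounded_clinear_intro[where K = 1])
  have lin: "bounded_clinear (dilation (circle_exp t))" for t
    by (rule bounded_clinear_dilation) simp
  show "hproj k (\<phi> + \<psi>) = hproj k \<phi> + hproj k \<psi>" for \<phi> \<psi> :: "'a g0"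
    unfolding hproj_def
    by (simp add: integral_add[symmetric] hproj_integrable bounded_clinear_add[OF lin] scaleC_add_right)
  show "hproj k (c *\<^sub>C \<phi>) = c *\<^sub>C hproj k \<phi>" for c and \<phi> :: "'a g0"
    unfolding clinear_hproj[OF bounded_clinear_scaleC_const]
    by (simp add: hproj_def bounded_clinear_scaleC[OF lin] scaleC_scaleC mult.commute)
qed (simp add: norm_hproj)

definition taylor_coeff :: "'a::complex_normed_vector hl0 \<Rightarrow> 'a \<Rightarrow> nat \<Rightarrow> complex"
  where "taylor_coeff f x k = (deriv ^^ k) (\<lambda>z. hl0_apply f (z *\<^sub>C x)) 0 / fact k"

lemma hl0_line_holomorphic:
  "(\<lambda>z. hl0_apply f (z *\<^sub>C x)) holomorphic_on {z. norm (z *\<^sub>C x) < 1}"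
  using frechet_holomorphic_along_line[OF hl0_holomorphic, of f 0 x] by simp

text \<open>Cauchy's integral formula on the unit circle.\<close>

lemma g0_apply_hproj_delta:
  fixes x :: "'a::complex_normed_vector"
  assumes x: "norm x < 1"
  shows "g0_apply (hproj k (delta x)) f = taylor_coeff f x k"
proof -
  define g where "g z = hl0_apply f (z *\<^sub>C x)" for z
  have hol: "g holomorphic_on cball 0 1"
    unfolding g_def using hl0_line_holomorphic
    by (rule holomorphic_on_subset)
      (use x in \<open>auto simp: norm_scaleC intro: le_less_trans[OF mult_left_le_one_le]\<close>)
  have "((\<lambda>u. g u / (u - 0) ^ Suc k) has_contour_integral (2 * pi * \<i> / fact k * (deriv ^^ k) g 0)) (circlepath 0 1)"
    by (rule Cauchy_has_contour_integral_higher_derivative_circlepath)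
      (use hol in \<open>auto intro: holomorphic_on_imp_continuous_on holomorphic_on_subset\<close>)
  then have "((\<lambda>t. g (circlepath 0 1 t) / circlepath 0 1 t ^ Suc k *
      vector_derivative (circlepath 0 1) (at t within {0..1})) has_integral
      (2 * pi * \<i> / fact k * (deriv ^^ k) g 0)) {0..1}"
    by (simp add: has_contour_integral_def)
  then have "((\<lambda>t. 2 * pi * \<i> * (inverse (circle_exp t) ^ k * g (circle_exp t))) has_integral
      (2 * pi * \<i> / fact k * (deriv ^^ k) g 0)) {0..1}"
  proof (rule has_integral_eq[rotated])
    fix t :: real assume t: "t \<in> {0..1}"
    have "circlepath 0 1 t = circle_exp t" by (simp add: circlepath circle_exp_def)
    moreover have "vector_derivative (circlepath 0 1) (at t within {0..1}) = 2 * pi * \<i> * circle_exp t"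
      using vector_derivative_circlepath01[of t 0 1] t by (simp add: circle_exp_def)
    ultimately show "g (circlepath 0 1 t) / circlepath 0 1 t ^ Suc k *
        vector_derivative (circlepath 0 1) (at t within {0..1})
        = 2 * pi * \<i> * (inverse (circle_exp t) ^ k * g (circle_exp t))"
      by (simp add: field_simps)
  qed
  then have "((\<lambda>t. 1 / (2 * pi * \<i>) * (2 * pi * \<i> * (inverse (circle_exp t) ^ k * g (circle_exp t)))) has_integral
      (1 / (2 * pi * \<i>) * (2 * pi * \<i> / fact k * (deriv ^^ k) g 0))) {0..1}"
    by (rule has_integral_mult_right)
  then have "((\<lambda>t. inverse (circle_exp t) ^ k * g (circle_exp t)) has_integral taylor_coeff f x k) {0..1}"
    by (simp add: taylor_coeff_def g_def[symmetric])
  moreover have "g0_apply (hproj k (delta x)) f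
      = integral {0..1} (\<lambda>t. inverse (circle_exp t) ^ k * g (circle_exp t))"
    using x by (simp add: clinear_hproj[OF bounded_clinear_g0_apply_left] dilation_delta g0_apply_delta g_def)
  ultimately show ?thesis by (simp add: integral_unique)
qed

lemma taylor_coeff_scaleC:
  assumes "norm x < 1" "cmod w \<le> 1"
  shows "taylor_coeff f (w *\<^sub>C x) k = w ^ k * taylor_coeff f x k"
proof -
  let ?T = "{z. norm (z *\<^sub>C x) < 1}"
  have "continuous_on UNIV (\<lambda>z::complex. norm (z *\<^sub>C x))"
    unfolding norm_scaleC by (intro continuous_intros)
  then have op: "open ?T" by (simp add: open_Collect_less)
  have "(deriv ^^ k) (\<lambda>z. hl0_apply f ((w * z) *\<^sub>C x)) 0 = w ^ k * (deriv ^^ k) (\<lambda>z. hl0_apply f (z *\<^sub>C x)) (w * 0)"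
  proof (rule higher_deriv_compose_linear[OF hl0_line_holomorphic, where S = "ball 0 1"])
    fix z :: complex assume "z \<in> ball 0 1"
    then have "cmod (w * z) * norm x \<le> norm x"
      using assms by (intro mult_left_le_one_le) (auto simp: norm_mult mult_le_one)
    then show "w * z \<in> ?T" using assms(1) by (simp add: norm_scaleC)
  qed (use op in auto)
  then show ?thesis
    by (simp add: taylor_coeff_def scaleC_scaleC mult.commute)
qed

lemma g0_map_hproj:
  assumes A: "contraction A"
  shows "g0_map A (hproj k \<phi>) = hproj k (g0_map A \<phi>)"
proof -
  have "g0_map A (dilation (circle_exp t) \<phi>) = dilation (circle_exp t) (g0_map A \<phi>)" for t
    unfolding dilation_def using A
    by (intro g0_map_commute contraction_scaleC) (auto simp: contraction_def bounded_clinear_scaleC)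
  then show ?thesis
    unfolding clinear_hproj[OF bounded_clinear_g0_map[OF A]] by (simp add: hproj_def)
qed

lemma hproj_delta_scaleC:
  assumes "norm x < 1" "cmod z \<le> 1"
  shows "hproj k (delta (z *\<^sub>C x)) = z ^ k *\<^sub>C hproj k (delta x)"
proof (rule g0_eqI)
  have "norm (z *\<^sub>C x) < 1"
    using assms by (auto simp: norm_scaleC intro: le_less_trans[OF mult_left_le_one_le])
  then show "g0_apply (hproj k (delta (z *\<^sub>C x))) f = g0_apply (z ^ k *\<^sub>C hproj k (delta x)) f" for f
    using assms by (simp add: g0_apply_hproj_delta g0_apply_linear taylor_coeff_scaleC)
qed

lemma dilation_hproj:
  assumes z: "cmod z \<le> 1"
  shows "dilation z (hproj k \<phi>) = z ^ k *\<^sub>C hproj k \<phi>"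
proof (rule bounded_clinear_eq_on_delta[of "\<lambda>\<phi>. dilation z (hproj k \<phi>)" "\<lambda>\<phi>. z ^ k *\<^sub>C hproj k \<phi>"])
  show "bounded_clinear (\<lambda>\<phi>::'a g0. dilation z (hproj k \<phi>))" "bounded_clinear (\<lambda>\<phi>::'a g0. z ^ k *\<^sub>C hproj k \<phi>)"
    by (rule bounded_clinear_compose[OF bounded_clinear_dilation[OF z] bounded_clinear_hproj],
      rule bounded_clinear_compose[OF bounded_clinear_scaleC_const bounded_clinear_hproj])
  fix x :: 'a assume x: "norm x < 1"
  have "dilation z (hproj k (delta x)) = hproj k (delta (z *\<^sub>C x))"
    using g0_map_hproj[OF contraction_scaleC[OF z], of k "delta x"] dilation_delta[OF z x]
    by (simp flip: dilation_def)
  then show "dilation z (hproj k (delta x)) = z ^ k *\<^sub>C hproj k (delta x)"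
    using hproj_delta_scaleC[OF x z] by simp
qed

lemma hproj_idem: "hproj k (hproj k \<phi>) = hproj k \<phi>"
proof -
  have "inverse (circle_exp t) ^ k *\<^sub>C dilation (circle_exp t) (hproj k \<phi>) = hproj k \<phi>" for t
    by (simp add: dilation_hproj scaleC_scaleC scaleC_one flip: power_mult_distrib)
  then show ?thesis unfolding hproj_def[of k "hproj k \<phi>"] by simp
qed

text \<open>On \<open>delta x\<close> this is the Taylor expansion of \<open>z \<mapsto> f (z *\<^sub>C x)\<close> at \<open>z = r\<close>. It extends to the whole
  predual because the series converges absolutely and so defines a bounded operator.\<close>

lemma dilation_sums_hproj:
  fixes \<phi> :: "'a::complex_normed_vector g0"
  assumes r: "0 \<le> r" "r < 1"
  shows "(\<lambda>k. r ^ k *\<^sub>R hproj k \<phi>) sums dilation (complex_of_real r) \<phi>"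
proof -
  have bound: "norm (r ^ k *\<^sub>R hproj k \<phi>) \<le> r ^ k * norm \<phi>" for k and \<phi> :: "'a g0"
    using r by (simp add: mult_left_mono norm_hproj)
  have geo: "summable (\<lambda>k. r ^ k * norm \<phi>)" for \<phi> :: "'a g0"
    using r by (intro summable_mult2 summable_geometric) auto
  have sn: "summable (\<lambda>k. norm (r ^ k *\<^sub>R hproj k \<phi>))" for \<phi> :: "'a g0"
    by (rule summable_comparison_test'[OF geo]) (use bound in auto)
  have s: "summable (\<lambda>k. r ^ k *\<^sub>R hproj k \<phi>)" for \<phi> :: "'a g0"
    by (rule summable_norm_cancel[OF sn])
  define S where "S \<phi> = (\<Sum>k. r ^ k *\<^sub>R hproj k \<phi>)" for \<phi> :: "'a g0"
  have "S \<phi> = dilation (complex_of_real r) \<phi>"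
  proof (rule bounded_clinear_eq_on_delta[of S "dilation (complex_of_real r)"])
    show "bounded_clinear S"
    proof (rule bounded_clinear_intro)
      show "S (\<phi> + \<psi>) = S \<phi> + S \<psi>" for \<phi> \<psi>
        unfolding S_def
        by (simp add: suminf_add[OF s s] bounded_clinear_add[OF bounded_clinear_hproj] scaleR_add_right)
      show "S (c *\<^sub>C \<phi>) = c *\<^sub>C S \<phi>" for c \<phi>
        unfolding S_def bounded_linear.suminf[OF bounded_linear_scaleC s]
        by (simp add: bounded_clinear_scaleC[OF bounded_clinear_hproj] scaleR_scaleC scaleC_scaleC mult.commute)
      show "norm (S \<phi>) \<le> (1 / (1 - r)) * norm \<phi>" for \<phi>
      proof -
        have "norm (S \<phi>) \<le> (\<Sum>k. norm (r ^ k *\<^sub>R hproj k \<phi>))"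
          unfolding S_def by (rule summable_norm[OF sn])
        also have "\<dots> \<le> (\<Sum>k. r ^ k * norm \<phi>)" by (rule suminf_le[OF bound sn geo])
        also have "\<dots> = (1 / (1 - r)) * norm \<phi>"
          using r by (simp add: suminf_mult2[symmetric] summable_geometric suminf_geometric)
        finally show ?thesis .
      qed
    qed
    show "bounded_clinear (dilation (complex_of_real r))"
      using r by (intro bounded_clinear_dilation) simp
    fix x :: 'a assume x: "norm x < 1"
    show "S (delta x) = dilation (complex_of_real r) (delta x)"
    proof (rule g0_eqI)
      fix f :: "'a hl0"
      have "(\<lambda>k. g0_apply (r ^ k *\<^sub>R hproj k (delta x)) f) sums g0_apply (S (delta x)) f"
        unfolding S_def
        by (rule bounded_linear.sums[OF bounded_clinear_bounded_linear[OF bounded_clinear_g0_apply_left] summable_sums[OF s]])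
      then have "(\<lambda>k. r ^ k * taylor_coeff f x k) sums g0_apply (S (delta x)) f"
        using x by (simp add: g0_apply_linear g0_apply_hproj_delta scaleR_conv_of_real)
      moreover have "(\<lambda>k. r ^ k * taylor_coeff f x k) sums hl0_apply f (complex_of_real r *\<^sub>C x)"
      proof -
        have "(\<lambda>z. hl0_apply f (z *\<^sub>C x)) holomorphic_on ball 0 1"
          using hl0_line_holomorphic
          by (rule holomorphic_on_subset)
            (use x in \<open>auto simp: norm_scaleC less_imp_le intro: le_less_trans[OF mult_left_le_one_le]\<close>)
        from holomorphic_power_series[OF this, of "complex_of_real r"] show ?thesis
          using r by (simp add: taylor_coeff_def mult.commute)
      qed
      ultimately show "g0_apply (S (delta x)) f = g0_apply (dilation (complex_of_real r) (delta x)) f"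
        using x r by (simp add: sums_unique2 dilation_delta g0_apply_delta)
    qed
  qed
  then show ?thesis using summable_sums[OF s, of \<phi>] by (simp add: S_def)
qed

lemma dilation_partial_sum:
  assumes r: "0 \<le> r" "r < 1"
  shows "norm (dilation (complex_of_real r) \<phi> - (\<Sum>k<N. r ^ k *\<^sub>R hproj k \<phi>)) \<le> r ^ N / (1 - r) * norm \<phi>"
proof -
  have *: "(\<lambda>k. r ^ (k + N) *\<^sub>R hproj (k + N) \<phi>) sums
      (dilation (complex_of_real r) \<phi> - (\<Sum>k<N. r ^ k *\<^sub>R hproj k \<phi>))"
    by (rule sums_split_initial_segment[OF dilation_sums_hproj[OF r]])
  have bound: "norm (r ^ (k + N) *\<^sub>R hproj (k + N) \<phi>) \<le> r ^ k * (r ^ N * norm \<phi>)" for k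
    using r norm_hproj[of "k + N" \<phi>] by (simp add: power_add mult_left_mono mult.assoc)
  have "(\<lambda>k. r ^ k * (r ^ N * norm \<phi>)) sums (1 / (1 - r) * (r ^ N * norm \<phi>))"
    using r by (intro sums_mult2 geometric_sums) auto
  from norm_sums_le[OF * this bound] show ?thesis by (simp add: mult.commute)
qed

section \<open>Homogeneous polynomials with values in the predual\<close>

text \<open>The extension of \<open>x \<mapsto> hproj k (delta x)\<close> by homogeneity from the ball to the whole space; the factor
  \<open>1 / (1 + norm y)\<close> is only a convenient way to get into the ball.\<close>

definition hpoly :: "nat \<Rightarrow> 'a::complex_normed_vector \<Rightarrow> 'a g0"
  where "hpoly k y = (1 + norm y) ^ k *\<^sub>R hproj k (delta ((1 / (1 + norm y)) *\<^sub>R y))"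

lemma hproj_delta_scaleR:
  assumes "0 < s" "s \<le> t" "t * norm y < 1"
  shows "(1 / s) ^ k *\<^sub>R hproj k (delta (s *\<^sub>R y)) = (1 / t) ^ k *\<^sub>R hproj k (delta (t *\<^sub>R y))"
proof -
  have t: "0 < t" using assms by simp
  have "s *\<^sub>R y = complex_of_real (s / t) *\<^sub>C (t *\<^sub>R y)"
    using t by (simp add: scaleC_scaleC scaleR_scaleC)
  moreover have "cmod (complex_of_real (s / t)) \<le> 1"
    unfolding norm_of_real using assms t by simp
  ultimately have "hproj k (delta (s *\<^sub>R y)) = complex_of_real (s / t) ^ k *\<^sub>C hproj k (delta (t *\<^sub>R y))"
    using hproj_delta_scaleC[of "t *\<^sub>R y" "complex_of_real (s / t)" k] assms t by simp
  also have "\<dots> = (s / t) ^ k *\<^sub>R hproj k (delta (t *\<^sub>R y))"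
    by (simp add: scaleR_scaleC)
  finally show ?thesis using assms(1) t by (simp add: power_divide)
qed

lemma hpoly_eq:
  assumes "0 < s" "s * norm y < 1"
  shows "hpoly k y = (1 / s) ^ k *\<^sub>R hproj k (delta (s *\<^sub>R y))"
proof -
  define a where "a = 1 / (1 + norm y)"
  have n: "0 < 1 + norm y" by (simp add: add_pos_nonneg)
  have a: "0 < a" "a * norm y < 1" using n by (auto simp: a_def)
  have eq: "hpoly k y = (1 / a) ^ k *\<^sub>R hproj k (delta (a *\<^sub>R y))" by (simp add: hpoly_def a_def)
  show ?thesis
  proof (cases "s \<le> a")
    case True
    then show ?thesis unfolding eq by (rule hproj_delta_scaleR[OF assms(1) _ a(2), symmetric])
  next
    case False
    then show ?thesis unfolding eq by (intro hproj_delta_scaleR[OF a(1) _ assms(2)]) simp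
  qed
qed

lemma hpoly_inside: "norm x < 1 \<Longrightarrow> hpoly k x = hproj k (delta x)"
  using hpoly_eq[of 1 x k] by simp

lemma norm_hpoly: "norm (hpoly k y) \<le> (1 + norm y) ^ k"
proof -
  have n: "0 < 1 + norm y" by (simp add: add_pos_nonneg)
  have "norm (hproj k (delta ((1 / (1 + norm y)) *\<^sub>R y))) \<le> norm ((1 / (1 + norm y)) *\<^sub>R y)"
    by (rule order_trans[OF norm_hproj norm_delta])
  also have "\<dots> \<le> 1" using n by simp
  finally show ?thesis
    using n by (simp add: hpoly_def mult_left_le)
qed

lemma hpoly_holomorphic_along_line:
  fixes F :: "'a::complex_normed_vector g0 \<Rightarrow> complex"
  assumes F: "bounded_clinear F"
  shows "(\<lambda>z. F (hpoly k (x + z *\<^sub>C h))) holomorphic_on UNIV"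
  unfolding holomorphic_on_def
proof
  fix z\<^sub>0 :: complex
  define s where "s = 1 / (1 + norm (x + z\<^sub>0 *\<^sub>C h))"
  have n: "0 < 1 + norm (x + z\<^sub>0 *\<^sub>C h)" by (simp add: add_pos_nonneg)
  have s: "0 < s" "norm (x + z\<^sub>0 *\<^sub>C h) < 1 / s" using n by (auto simp: s_def)
  define U where "U = {z. norm (s *\<^sub>R x + z *\<^sub>C (s *\<^sub>R h)) < 1}"
  have "frechet_holomorphic_on (\<lambda>x. F (hproj k (delta x))) (ball 0 1)"
    by (rule frechet_holomorphic_on_clinear_comp[OF bounded_clinear_compose[OF F bounded_clinear_hproj]
      frechet_holomorphic_delta])
  from frechet_holomorphic_along_line[OF this]
  have hol: "(\<lambda>z. (1 / s) ^ k * F (hproj k (delta (s *\<^sub>R x + z *\<^sub>C (s *\<^sub>R h))))) holomorphic_on U"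
    unfolding U_def by (intro holomorphic_intros)
  have dist: "s *\<^sub>R x + z *\<^sub>C (s *\<^sub>R h) = s *\<^sub>R (x + z *\<^sub>C h)" for z
    by (simp add: scaleR_scaleC scaleC_scaleC scaleC_add_right mult.commute)
  have U: "z \<in> U \<longleftrightarrow> s * norm (x + z *\<^sub>C h) < 1" for z
    using s by (simp add: U_def dist)
  have "(1 / s) ^ k * F (hproj k (delta (s *\<^sub>R x + z *\<^sub>C (s *\<^sub>R h)))) = F (hpoly k (x + z *\<^sub>C h))" if "z \<in> U" for z
    using that s unfolding U dist hpoly_eq[OF s(1) that[unfolded U]]
    by (simp add: scaleR_scaleC[of "(1 / s) ^ k"] bounded_clinear_scaleC[OF F])
  then have "(\<lambda>z. F (hpoly k (x + z *\<^sub>C h))) holomorphic_on U"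
    using hol by (rule holomorphic_transform[rotated])
  moreover have "open U"
  proof -
    have "continuous_on UNIV (\<lambda>z. x + z *\<^sub>C h)"
      by (intro continuous_intros bounded_bilinear.continuous_on[OF bounded_bilinear_scaleC])
    from continuous_on_mult_left[OF continuous_on_norm[OF this], of "\<bar>s\<bar>"] show ?thesis
      unfolding U_def dist norm_scaleR by (intro open_Collect_less continuous_on_const)
  qed
  moreover have "z\<^sub>0 \<in> U" unfolding U using s by (simp add: field_simps)
  ultimately show "(\<lambda>z. F (hpoly k (x + z *\<^sub>C h))) field_differentiable (at z\<^sub>0 within UNIV)"
    using holomorphic_on_imp_differentiable_at by blast
qed

text \<open>An entire function that grows at most like \<open>cmod z ^ k\<close> is a polynomial of degree at most \<open>k\<close>.\<close>

lemma hpoly_polynomial_along_line: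
  fixes F :: "'a::complex_normed_vector g0 \<Rightarrow> complex"
  assumes F: "bounded_clinear F"
  shows "\<exists>c. \<forall>z. F (hpoly k (x + z *\<^sub>C h)) = (\<Sum>i\<le>k. c i * z ^ i)"
proof -
  obtain B where B: "0 \<le> B" "\<And>\<phi>. cmod (F \<phi>) \<le> norm \<phi> * B"
    using bounded_linear.nonneg_bounded[OF bounded_clinear_bounded_linear[OF F]] by blast
  have growth: "cmod (F (hpoly k (x + z *\<^sub>C h))) \<le> ((1 + norm x + norm h) ^ k * B) * cmod z ^ k"
    if z: "1 \<le> cmod z" for z
  proof -
    have "1 + norm (x + z *\<^sub>C h) \<le> 1 + norm x + cmod z * norm h"
      using norm_triangle_ineq[of x "z *\<^sub>C h"] by (simp add: norm_scaleC)
    also have "\<dots> \<le> (1 + norm x + norm h) * cmod z"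
    proof -
      have "1 + norm x \<le> (1 + norm x) * cmod z" using mult_left_mono[OF z, of "1 + norm x"] by simp
      then show ?thesis by (simp add: algebra_simps)
    qed
    finally have "(1 + norm (x + z *\<^sub>C h)) ^ k \<le> ((1 + norm x + norm h) * cmod z) ^ k"
      by (intro power_mono) auto
    then have "norm (hpoly k (x + z *\<^sub>C h)) * B \<le> ((1 + norm x + norm h) * cmod z) ^ k * B"
      using B(1) norm_hpoly order_trans by (intro mult_right_mono) blast+
    then show ?thesis using B(2) order_trans by (fastforce simp: power_mult_distrib mult_ac)
  qed
  have "F (hpoly k (x + z *\<^sub>C h)) = (\<Sum>i\<le>k. (deriv ^^ i) (\<lambda>z. F (hpoly k (x + z *\<^sub>C h))) 0 / fact i * z ^ i)" for z
    by (rule Liouville_polynomial[OF hpoly_holomorphic_along_line[OF F] growth])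
  then show ?thesis
    by (intro exI[of _ "\<lambda>i. (deriv ^^ i) (\<lambda>z. F (hpoly k (x + z *\<^sub>C h))) 0 / fact i"] allI)
qed

lemma lagrange_interpolation:
  "\<exists>w. \<forall>c::nat \<Rightarrow> complex. (\<Sum>i\<le>k. c i * z ^ i) = (\<Sum>a\<le>k. w a * (\<Sum>i\<le>k. c i * of_nat a ^ i))"
proof -
  define lag :: "nat \<Rightarrow> complex poly" where
    "lag a = (\<Prod>b\<in>{..k} - {a}. smult (1 / (of_nat a - of_nat b)) [:- of_nat b, 1:])" for a
  have deg_lag: "degree (lag a) \<le> k" if "a \<le> k" for a
  proof -
    have "degree (lag a) \<le> (\<Sum>b\<in>{..k} - {a}. degree (smult (1 / (of_nat a - of_nat b)) [:- of_nat b, 1 :: complex:]))"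
      unfolding lag_def by (rule degree_prod_sum_le[unfolded o_def]) auto
    also have "\<dots> \<le> (\<Sum>b\<in>{..k} - {a}. 1)"
      by (intro sum_mono) (auto intro: order_trans[OF degree_smult_le])
    also have "\<dots> = k" using that by simp
    finally show ?thesis .
  qed
  have lag_node: "poly (lag a) (of_nat b) = (if a = b then 1 else 0)" if "a \<le> k" "b \<le> k" for a b
  proof (cases "a = b")
    case True
    have "1 / (of_nat a - of_nat c) * (of_nat a - of_nat c) = (1::complex)" if "c \<in> {..k} - {a}" for c
      using that by simp
    then show ?thesis using True by (simp add: lag_def poly_prod right_diff_distrib)
  next
    case False
    then have "b \<in> {..k} - {a}" using that by auto
    then have "poly (lag a) (of_nat b) = 0" by (auto simp: lag_def poly_prod intro!: prod_zero)
    then show ?thesis using False by simp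
  qed
  have "(\<Sum>i\<le>k. c i * z ^ i) = (\<Sum>a\<le>k. poly (lag a) z * (\<Sum>i\<le>k. c i * of_nat a ^ i))" for c :: "nat \<Rightarrow> complex"
  proof -
    define p where "p = (\<Sum>i\<le>k. monom (c i) i)"
    define q where "q = (\<Sum>a\<le>k. smult (poly p (of_nat a)) (lag a))"
    have p: "poly p y = (\<Sum>i\<le>k. c i * y ^ i)" for y
      by (simp add: p_def poly_sum poly_monom)
    have "p = q"
    proof (rule poly_eqI_degree[of "of_nat ` {..k}"])
      fix y :: complex assume "y \<in> of_nat ` {..k}"
      then obtain b where b: "b \<le> k" "y = of_nat b" by auto
      have "poly q y = (\<Sum>a\<le>k. poly p (of_nat a) * (if a = b then 1 else 0))"
        using b by (simp add: q_def poly_sum lag_node)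
      also have "\<dots> = poly p y" using b by (simp add: mult_delta_right)
      finally show "poly p y = poly q y" by simp
    next
      have card: "card ((of_nat :: nat \<Rightarrow> complex) ` {..k}) = Suc k"
        by (simp add: card_image inj_on_def)
      have "degree p \<le> k"
        unfolding p_def by (intro degree_sum_le) (auto intro: order_trans[OF degree_monom_le])
      then show "card ((of_nat :: nat \<Rightarrow> complex) ` {..k}) > degree p" by (simp add: card)
      have "degree q \<le> k"
        unfolding q_def by (intro degree_sum_le) (use deg_lag in auto)
      then show "card ((of_nat :: nat \<Rightarrow> complex) ` {..k}) > degree q" by (simp add: card)
    qed
    then have "poly p z = poly q z" by simp
    then show ?thesis by (simp add: p q_def poly_sum mult.commute)
  qed
  then show ?thesis by (intro exI[of _ "\<lambda>a. poly (lag a) z"] allI)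
qed

text \<open>Lagrange interpolation on each line, with coefficients that do not depend on the functional used to
  test the vector, expresses a value by those at \<open>k + 1\<close> points.\<close>

lemma hpoly_interpolation:
  fixes x h :: "'a::complex_normed_vector"
  shows "hpoly k (x + z *\<^sub>C h) \<in> cspan ((\<lambda>a. hpoly k (x + of_nat a *\<^sub>C h)) ` {..k})"
proof -
  obtain w where w: "\<And>c::nat \<Rightarrow> complex. (\<Sum>i\<le>k. c i * z ^ i) = (\<Sum>a\<le>k. w a * (\<Sum>i\<le>k. c i * of_nat a ^ i))"
    using lagrange_interpolation[where k = k and z = z] by blast
  have "hpoly k (x + z *\<^sub>C h) = (\<Sum>a\<le>k. w a *\<^sub>C hpoly k (x + of_nat a *\<^sub>C h))"
  proof (rule g0_eqI)
    fix f :: "'a hl0"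
    obtain c where "\<And>z. g0_apply (hpoly k (x + z *\<^sub>C h)) f = (\<Sum>i\<le>k. c i * z ^ i)"
      using hpoly_polynomial_along_line[OF bounded_clinear_g0_apply_left] by blast
    then show "g0_apply (hpoly k (x + z *\<^sub>C h)) f = g0_apply (\<Sum>a\<le>k. w a *\<^sub>C hpoly k (x + of_nat a *\<^sub>C h)) f"
      using w by (simp add: g0_apply_sum g0_apply_linear)
  qed
  also have "\<dots> \<in> cspan ((\<lambda>a. hpoly k (x + of_nat a *\<^sub>C h)) ` {..k})"
    by (intro complex_vector.span_sum complex_vector.span_scale complex_vector.span_base imageI)
  finally show ?thesis .
qed

text \<open>Interpolating in one coordinate after the other expresses all values by those on a finite grid.
  The translates \<open>P\<close> make the induction work: removing \<open>e\<close> from the spanning set replaces each \<open>p\<close> by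
  the points \<open>p + a e\<close> for \<open>a \<le> k\<close>.\<close>

lemma hpoly_finite_dimensional:
  assumes "finite B" "finite P"
  shows "\<exists>Z. finite Z \<and> (\<forall>p\<in>P. \<forall>x\<in>cspan B. hpoly k (p + x) \<in> cspan Z)"
  using assms
proof (induction B arbitrary: P rule: finite_induct)
  case empty
  then show ?case
    by (intro exI[of _ "hpoly k ` P"]) (auto intro: complex_vector.span_base)
next
  case (insert e B)
  define Q where "Q = (\<lambda>(p, a). p + of_nat a *\<^sub>C e) ` (P \<times> {..k})"
  have "finite Q" using insert.prems by (simp add: Q_def)
  from insert.IH[OF this] obtain Z where Z: "finite Z"
    "\<forall>q\<in>Q. \<forall>x\<in>cspan B. hpoly k (q + x) \<in> cspan Z" by (elim exE conjE)
  have "hpoly k (p + x) \<in> cspan Z" if p: "p \<in> P" and x: "x \<in> cspan (insert e B)" for p x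
  proof -
    obtain z where z: "x - z *\<^sub>C e \<in> cspan B"
      using x by (auto simp: complex_vector.span_breakdown_eq)
    have "hpoly k ((p + (x - z *\<^sub>C e)) + z *\<^sub>C e)
        \<in> cspan ((\<lambda>a. hpoly k (p + (x - z *\<^sub>C e) + of_nat a *\<^sub>C e)) ` {..k})"
      by (rule hpoly_interpolation)
    also have "\<dots> \<subseteq> cspan Z"
    proof (rule complex_vector.span_minimal)
      show "(\<lambda>a. hpoly k (p + (x - z *\<^sub>C e) + of_nat a *\<^sub>C e)) ` {..k} \<subseteq> cspan Z"
      proof (intro image_subsetI)
        fix a assume "a \<in> {..k}"
        then have "p + of_nat a *\<^sub>C e \<in> Q" using p by (auto simp: Q_def)
        from Z(2)[rule_format, OF this z] show "hpoly k (p + (x - z *\<^sub>C e) + of_nat a *\<^sub>C e) \<in> cspan Z"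
          by (simp add: add.assoc add.commute add.left_commute diff_conv_add_uminus del: add_uminus_conv_diff)
      qed
    qed (rule complex_vector.subspace_span)
    finally show ?thesis by simp
  qed
  then show ?case using Z(1) by blast
qed

section \<open>Finite rank of the homogeneous components\<close>

lemma convex_cspan: "convex (cspan S)"
  by (intro convexI)
    (auto simp: scaleR_scaleC intro!: complex_vector.span_add complex_vector.span_scale)

text \<open>A functional that vanishes on the closed subspace \<open>cspan S\<close> but not at \<open>e\<close> yields a continuous
  projection along \<open>e\<close> that maps \<open>cspan (insert e S)\<close> to \<open>cspan S\<close>.\<close>

lemma closed_cspan_finite:
  fixes S :: "'a::complex_normed_vector set"
  assumes "finite S"
  shows "closed (cspan S)"
  using assms
proof (induction S rule: finite_induct)
  case empty
  then show ?case by simp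
next
  case (insert e S)
  show ?case
  proof (cases "e \<in> cspan S")
    case True
    then show ?thesis using insert.IH by (simp add: complex_vector.span_redundant)
  next
    case False
    then have "e \<notin> closure (cspan S)" using insert.IH by simp
    then have "\<exists>F :: 'a \<Rightarrow> complex. bounded_clinear F \<and> (\<forall>x\<in>cspan S. cmod (F x) \<le> 1) \<and> 1 \<le> cmod (F e)"
      by (intro absconvex_separation convex_cspan complex_vector.span_zero complex_vector.span_scale)
    then obtain F :: "'a \<Rightarrow> complex" where F: "bounded_clinear F" "\<forall>x\<in>cspan S. cmod (F x) \<le> 1"
      "1 \<le> cmod (F e)" by (elim exE conjE)
    \<comment> \<open>a functional bounded on a subspace vanishes there\<close>
    have zero: "F x = 0" if "x \<in> cspan S" for x
    proof (rule ccontr)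
      assume "F x \<noteq> 0"
      moreover have "cmod (F ((2 / F x) *\<^sub>C x)) \<le> 1"
        by (intro F(2)[rule_format] complex_vector.span_scale that)
      ultimately show False by (simp add: bounded_clinear_scaleC[OF F(1)])
    qed
    define T where "T x = x - (F x / F e) *\<^sub>C e" for x
    have "T x \<in> cspan S \<longleftrightarrow> x \<in> cspan (insert e S)" for x
    proof
      assume "x \<in> cspan (insert e S)"
      then obtain z where z: "x - z *\<^sub>C e \<in> cspan S" by (auto simp: complex_vector.span_breakdown_eq)
      have "F x = z * F e" using zero[OF z] by (simp add: bounded_clinearD[OF F(1)])
      then show "T x \<in> cspan S" using z F(3) by (auto simp: T_def)
    qed (auto simp: T_def complex_vector.span_breakdown_eq)
    then have "cspan (insert e S) = T -` cspan S" by auto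
    moreover have "continuous_on UNIV T"
      unfolding T_def using F(3)
      by (intro continuous_intros bounded_bilinear.continuous_on[OF bounded_bilinear_scaleC]
        linear_continuous_on bounded_clinear_bounded_linear[OF F(1)]) auto
    ultimately show ?thesis using insert.IH by (simp add: closed_vimage)
  qed
qed

text \<open>The evaluations are mapped into the span of the values of \<open>hpoly k\<close> on the range of \<open>A\<close>, which is
  finite-dimensional and hence closed, so everything is mapped into it.\<close>

lemma finite_rank_hproj_g0_map:
  fixes A :: "'a::complex_normed_vector \<Rightarrow> 'b::complex_normed_vector"
  assumes A: "contraction A" "finite_rank A"
  shows "finite_rank (\<lambda>\<phi>. hproj k (g0_map A \<phi>))"
proof -
  obtain B where B: "finite B" "range A \<subseteq> cspan B" using A(2) unfolding finite_rank_def by blast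
  have "\<exists>Z. finite Z \<and> (\<forall>p\<in>{0}. \<forall>x\<in>cspan B. hpoly k (p + x) \<in> cspan Z)"
    by (rule hpoly_finite_dimensional[OF B(1)]) simp
  then obtain Z where Z: "finite Z" "\<forall>x\<in>cspan B. hpoly k x \<in> cspan Z"
    by auto
  have lin: "bounded_clinear (\<lambda>\<phi>. hproj k (g0_map A \<phi>))"
    by (rule bounded_clinear_compose[OF bounded_clinear_hproj bounded_clinear_g0_map[OF A(1)]])
  have "hproj k (g0_map A \<phi>) \<in> cspan Z" for \<phi>
  proof (induction \<phi> rule: g0_induct)
    case (delta x)
    have "norm (A x) < 1" using A(1) delta unfolding contraction_def by (meson le_less_trans)
    then have "hproj k (g0_map A (delta x)) = hpoly k (A x)"
      using delta by (simp add: g0_map_delta[OF A(1)] hpoly_inside)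
    then show ?case using Z(2) B(2) by auto
  next
    case closed
    have "closed ((\<lambda>\<phi>. hproj k (g0_map A \<phi>)) -` cspan Z)"
      using closed_cspan_finite[OF Z(1)] linear_continuous_on[OF bounded_clinear_bounded_linear[OF lin], of UNIV]
      by (rule closed_vimage)
    then show ?case by (simp add: vimage_def)
  qed (simp_all add: bounded_clinearD[OF lin] complex_vector.span_add complex_vector.span_scale)
  then show ?thesis unfolding finite_rank_def using Z(1) by blast
qed

section \<open>The unit ball of a homogeneous component\<close>

text \<open>A \<open>k\<close>-homogeneous function bounded by 1 on the ball is bounded by \<open>2 ^ k\<close> on the ball of radius 2.
  Cauchy's inequality on discs of radius 1 in the direction \<open>x - y\<close> then bounds its derivatives on the
  unit ball.\<close>

lemma hproj_lipschitz:
  fixes F :: "'a::complex_normed_vector g0 \<Rightarrow> complex"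
  assumes F: "bounded_clinear F" and le1: "\<And>x. norm x < 1 \<Longrightarrow> cmod (F (hproj k (delta x))) \<le> 1"
    and x: "norm x < 1" and y: "norm y < 1"
  shows "cmod (F (hproj k (delta x)) - F (hproj k (delta y))) \<le> 2 ^ k * norm (x - y)"
proof (cases "x = y")
  case True
  then show ?thesis by simp
next
  case False
  define d where "d = norm (x - y)"
  have d: "0 < d" using False by (simp add: d_def)
  define u where "u z = F (hpoly k (y + z *\<^sub>C (x - y)))" for z
  have hol: "u holomorphic_on S" for S
    unfolding u_def using hpoly_holomorphic_along_line[OF F] holomorphic_on_subset by blast
  have on_double_ball: "cmod (F (hpoly k v)) \<le> 2 ^ k" if "norm v < 2" for v
  proof -
    have "hpoly k v = 2 ^ k *\<^sub>R hproj k (delta ((1 / 2) *\<^sub>R v))"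
      using hpoly_eq[of "1 / 2" v k] that by simp
    then have "cmod (F (hpoly k v)) = 2 ^ k * cmod (F (hproj k (delta ((1 / 2) *\<^sub>R v))))"
      by (simp add: scaleR_scaleC bounded_clinear_scaleC[OF F] norm_mult norm_power)
    also have "\<dots> \<le> 2 ^ k * 1" using that by (intro mult_left_mono le1) auto
    finally show ?thesis by simp
  qed
  have deriv: "cmod (deriv u z) \<le> 2 ^ k * d" if z: "z \<in> closed_segment 0 1" for z
  proof -
    obtain t where t: "0 \<le> t" "t \<le> 1" "z = complex_of_real t"
      using z by (auto simp: in_segment scaleR_conv_of_real)
    have "(1 - t) *\<^sub>R y + t *\<^sub>R x \<in> ball 0 1"
      using t x y by (intro convexD_alt convex_ball) auto
    moreover have "(1 - t) *\<^sub>R y + t *\<^sub>R x = y + z *\<^sub>C (x - y)"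
      by (simp add: t(3) scaleR_scaleC[symmetric] algebra_simps)
    ultimately have seg: "norm (y + z *\<^sub>C (x - y)) < 1" by simp
    have "cmod ((deriv ^^ 1) u z) \<le> fact 1 * 2 ^ k / (1 / d) ^ 1"
    proof (rule Cauchy_inequality)
      fix w assume w: "cmod (z - w) = 1 / d"
      have "y + w *\<^sub>C (x - y) = (y + z *\<^sub>C (x - y)) - (z - w) *\<^sub>C (x - y)"
        by (simp add: complex_vector.scale_left_diff_distrib)
      then have "norm (y + w *\<^sub>C (x - y)) \<le> norm (y + z *\<^sub>C (x - y)) + cmod (z - w) * d"
        by (metis d_def norm_scaleC norm_triangle_ineq4)
      also have "\<dots> < 2" using seg w d by simp
      finally show "cmod (u w) \<le> 2 ^ k" unfolding u_def by (rule on_double_ball)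
    qed (use d hol in \<open>auto intro: holomorphic_on_imp_continuous_on\<close>)
    then show ?thesis by simp
  qed
  have "norm (u 1 - u 0) \<le> 2 ^ k * d * norm (1 - 0 :: complex)"
  proof (rule field_differentiable_bound[of "closed_segment 0 1"])
    fix z :: complex assume z: "z \<in> closed_segment 0 1"
    show "(u has_field_derivative deriv u z) (at z within closed_segment 0 1)"
      using holomorphic_derivI[OF hol open_UNIV, of z] by (simp add: has_field_derivative_at_within)
  qed (use deriv in auto)
  then show ?thesis
    using x y by (simp add: u_def d_def hpoly_inside scaleC_one complex_vector.scale_zero_left)
qed

text \<open>If \<open>\<psi>\<close> were outside of the closed hull, a functional \<open>F\<close> would separate it. On the range of \<open>hproj k\<close>
  this functional is given by a \<open>k\<close>-homogeneous function that is bounded by 1 on the ball, so it has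
  Lipschitz constant at most \<open>2 ^ k\<close> and cannot be large at \<open>\<psi>\<close>.\<close>

lemma homogeneous_ball_subset_hull:
  fixes \<psi> :: "'a::complex_normed_vector g0"
  assumes fix_\<psi>: "hproj k \<psi> = \<psi>" and small: "norm \<psi> < 1 / 2 ^ k"
  shows "\<psi> \<in> closure (convex hull {c *\<^sub>C hproj k (delta x) | c x. cmod c \<le> 1 \<and> norm x < 1})"
proof (rule ccontr)
  define D :: "'a g0 set" where "D = {c *\<^sub>C hproj k (delta x) | c x. cmod c \<le> 1 \<and> norm x < 1}"
  assume "\<psi> \<notin> closure (convex hull {c *\<^sub>C hproj k (delta x) | c x. cmod c \<le> 1 \<and> norm x < 1})"
  then have notin: "\<psi> \<notin> closure (convex hull D)" by (simp add: D_def)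
  have D: "c *\<^sub>C hproj k (delta x) \<in> D" if "cmod c \<le> 1" "norm x < 1" for c x
    using that unfolding D_def by blast
  have bal: "c *\<^sub>C v \<in> convex hull D" if c: "cmod c = 1" and v: "v \<in> convex hull D" for c v
  proof -
    have "(\<lambda>v. c *\<^sub>C v) ` (convex hull D) = convex hull ((\<lambda>v. c *\<^sub>C v) ` D)"
      by (rule convex_hull_linear_image[OF linear_scaleC])
    also have "\<dots> \<subseteq> convex hull D"
    proof (rule hull_mono, rule image_subsetI)
      fix v assume "v \<in> D"
      then obtain b x where "v = b *\<^sub>C hproj k (delta x)" "cmod b \<le> 1" "norm x < 1"
        unfolding D_def by blast
      then show "c *\<^sub>C v \<in> D" using D[of "c * b" x] c by (simp add: scaleC_scaleC norm_mult)
    qed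
    finally show ?thesis using v by blast
  qed
  have "0 \<in> D" using D[of 0 0] by simp
  then have "0 \<in> convex hull D" by (rule hull_inc)
  then have "\<exists>F :: 'a g0 \<Rightarrow> complex. bounded_clinear F \<and> (\<forall>v\<in>convex hull D. cmod (F v) \<le> 1) \<and> 1 \<le> cmod (F \<psi>)"
    using notin bal by (intro absconvex_separation convex_convex_hull)
  then obtain F :: "'a g0 \<Rightarrow> complex" where F: "bounded_clinear F"
    "\<forall>v\<in>convex hull D. cmod (F v) \<le> 1" "1 \<le> cmod (F \<psi>)" by (elim exE conjE)
  have le1: "cmod (F (hproj k (delta x))) \<le> 1" if "norm x < 1" for x
    using F(2) hull_inc[OF D[of 1 x]] that by (simp add: scaleC_one)
  have "bounded_clinear (\<lambda>\<phi>. F (hproj k \<phi>))"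
    by (rule bounded_clinear_compose[OF F(1) bounded_clinear_hproj])
  from g0_dual[OF this] obtain f where f: "\<And>x. hl0_apply f x = F (hproj k (delta x))"
    "\<And>\<phi>. F (hproj k \<phi>) = g0_apply \<phi> f" by blast
  have "norm f \<le> 2 ^ k"
    by (rule norm_hl0_le) (simp_all add: f(1) hproj_lipschitz[OF F(1) le1])
  have "cmod (F \<psi>) = cmod (g0_apply \<psi> f)" using f(2)[of \<psi>] fix_\<psi> by simp
  also have "\<dots> \<le> norm \<psi> * norm f" by (rule g0_apply_bound)
  also have "\<dots> \<le> norm \<psi> * 2 ^ k" using \<open>norm f \<le> 2 ^ k\<close> by (intro mult_left_mono) auto
  also have "\<dots> < 1" using small by (simp add: field_simps)
  finally show False using F(3) by simp
qed

section \<open>Compact subsets of a closed convex hull\<close>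

lemma finite_subset_convex_hull:
  assumes "finite V" "V \<subseteq> convex hull D"
  shows "\<exists>D'. finite D' \<and> D' \<subseteq> D \<and> V \<subseteq> convex hull D'"
  using assms
proof (induction V rule: finite_induct)
  case empty
  then show ?case by auto
next
  case (insert v V)
  then obtain D1 where D1: "finite D1" "D1 \<subseteq> D" "V \<subseteq> convex hull D1" by auto
  obtain S u where S: "finite S" "S \<subseteq> D" "\<forall>x\<in>S. 0 \<le> u x" "sum u S = 1" "(\<Sum>w\<in>S. u w *\<^sub>R w) = v"
    using insert.prems unfolding convex_hull_explicit by auto
  have "v \<in> convex hull S" using S unfolding convex_hull_finite[OF S(1)] by auto
  then have "insert v V \<subseteq> convex hull (D1 \<union> S)"
    using D1(3) hull_mono[of S "D1 \<union> S" convex] hull_mono[of D1 "D1 \<union> S" convex] by auto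
  then show ?case using D1 S by (intro exI[of _ "D1 \<union> S"]) auto
qed

text \<open>Cover \<open>K\<close> by finitely many small balls with centres in the hull, and rescale the differences to the
  centres.\<close>

lemma compact_hull_step:
  fixes D V :: "'b::real_normed_vector set"
  assumes V: "subspace V" "D \<subseteq> V" and \<rho>: "0 < \<rho>" and q: "0 < q"
    and hull: "\<And>\<psi>. \<psi> \<in> V \<Longrightarrow> norm \<psi> < \<rho> \<Longrightarrow> \<psi> \<in> closure (convex hull D)"
    and K: "compact K" "K \<subseteq> V \<inter> ball 0 \<rho>"
  shows "\<exists>D' K'. finite D' \<and> D' \<subseteq> D \<and> compact K' \<and> K' \<subseteq> V \<inter> ball 0 \<rho> \<and>
    (\<forall>\<psi>\<in>K. \<exists>v\<in>convex hull D'. \<exists>\<psi>'\<in>K'. \<psi> = v + q *\<^sub>R \<psi>')"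
proof -
  define \<epsilon> where "\<epsilon> = q * \<rho> / 2"
  have \<epsilon>: "0 < \<epsilon>" "\<epsilon> < q * \<rho>" using \<rho> q by (auto simp: \<epsilon>_def)
  have "K \<subseteq> (\<Union>v\<in>convex hull D. ball v \<epsilon>)"
  proof
    fix \<psi> assume "\<psi> \<in> K"
    then have "\<psi> \<in> closure (convex hull D)" using K(2) by (intro hull) auto
    then show "\<psi> \<in> (\<Union>v\<in>convex hull D. ball v \<epsilon>)"
      using \<epsilon>(1) by (auto simp: closure_approachable)
  qed
  then obtain X where X: "X \<subseteq> convex hull D" "finite X" "K \<subseteq> (\<Union>v\<in>X. ball v \<epsilon>)"
    using compactE_image[OF K(1), of "convex hull D" "\<lambda>v. ball v \<epsilon>"] by auto
  obtain D' where D': "finite D'" "D' \<subseteq> D" "X \<subseteq> convex hull D'"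
    using finite_subset_convex_hull[OF X(2,1)] by blast
  define K' where "K' = (\<Union>v\<in>X. (\<lambda>\<psi>. (1 / q) *\<^sub>R (\<psi> - v)) ` (K \<inter> cball v \<epsilon>))"
  have "compact K'"
    unfolding K'_def
    by (intro compact_UN X(2) compact_continuous_image compact_Int_closed K(1) continuous_intros) auto
  moreover have "K' \<subseteq> V \<inter> ball 0 \<rho>"
  proof
    fix \<theta> assume "\<theta> \<in> K'"
    then obtain v \<psi> where v: "v \<in> X" "\<psi> \<in> K" "\<psi> \<in> cball v \<epsilon>" "\<theta> = (1 / q) *\<^sub>R (\<psi> - v)"
      unfolding K'_def by blast
    have "convex hull D \<subseteq> V"
      by (intro hull_minimal V(2) subspace_imp_convex V(1))
    then have "\<theta> \<in> V" using v X(1) K(2) V(1) by (auto intro!: subspace_scale subspace_diff)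
    moreover have "norm \<theta> \<le> \<epsilon> / q"
      using v(3) q by (simp add: v(4) dist_norm norm_minus_commute divide_right_mono)
    then have "norm \<theta> < \<rho>" using \<epsilon> q by (smt (verit) divide_less_eq mult.commute)
    ultimately show "\<theta> \<in> V \<inter> ball 0 \<rho>" by simp
  qed
  moreover have "\<exists>v\<in>convex hull D'. \<exists>\<psi>'\<in>K'. \<psi> = v + q *\<^sub>R \<psi>'" if \<psi>: "\<psi> \<in> K" for \<psi>
  proof -
    have "\<psi> \<in> (\<Union>v\<in>X. ball v \<epsilon>)" by (rule subsetD[OF X(3) \<psi>])
    then obtain v where v: "v \<in> X" "\<psi> \<in> ball v \<epsilon>" by (elim UN_E)
    have "(1 / q) *\<^sub>R (\<psi> - v) \<in> K'"
      unfolding K'_def using v \<psi> ball_subset_cball by blast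
    moreover have "\<psi> = v + q *\<^sub>R ((1 / q) *\<^sub>R (\<psi> - v))" using q by simp
    ultimately show ?thesis using v(1) D'(3) by blast
  qed
  ultimately show ?thesis using D'(1,2) by (intro exI[of _ D'] exI[of _ K'] conjI ballI)
qed

text \<open>Iterating the previous step with the factor \<open>q = 1 / (2 * b)\<close> writes each element of \<open>K\<close> as a series
  \<open>\<Sum>j. q ^ j *\<^sub>R v j\<close>, where \<open>v j\<close> lies in the convex hull of a finite set \<open>\<D> j\<close> that does not depend on
  the element. Bounds \<open>\<eta> * b ^ j\<close> on these finite sets add up to \<open>2 * \<eta>\<close>. The norm of the operator
  \<open>S\<close> does not enter the bound.\<close>

lemma compact_absorbed_by_hull:
  fixes D V :: "'b::real_normed_vector set"
  assumes V: "subspace V" "D \<subseteq> V" and \<rho>: "0 < \<rho>" and b: "1 \<le> b"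
    and hull: "\<And>\<psi>. \<psi> \<in> V \<Longrightarrow> norm \<psi> < \<rho> \<Longrightarrow> \<psi> \<in> closure (convex hull D)"
    and K: "compact K" "K \<subseteq> V \<inter> ball 0 \<rho>"
  shows "\<exists>\<D>. (\<forall>j::nat. finite (\<D> j) \<and> \<D> j \<subseteq> D) \<and>
    (\<forall>(S :: 'b \<Rightarrow> 'c::real_normed_vector) \<eta>. bounded_linear S \<longrightarrow> 0 \<le> \<eta> \<longrightarrow>
      (\<forall>j. \<forall>d\<in>\<D> j. norm (S d) \<le> \<eta> * b ^ j) \<longrightarrow> (\<forall>\<psi>\<in>K. norm (S \<psi>) \<le> 2 * \<eta>))"
proof -
  define q where "q = 1 / (2 * b)"
  have q: "0 < q" "q < 1" "q * b = 1 / 2" using b by (auto simp: q_def field_simps)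
  define good where "good K \<longleftrightarrow> compact K \<and> K \<subseteq> V \<inter> ball 0 \<rho>" for K
  define splits where "splits K K' D' \<longleftrightarrow> finite D' \<and> D' \<subseteq> D \<and>
    (\<forall>\<psi>\<in>K. \<exists>v\<in>convex hull D'. \<exists>\<psi>'\<in>K'. \<psi> = v + q *\<^sub>R \<psi>')" for K K' D'
  have "\<exists>\<K>. \<forall>n::nat. (good (\<K> n) \<and> (n = 0 \<longrightarrow> \<K> n = K)) \<and> (\<exists>D'. splits (\<K> n) (\<K> (Suc n)) D')"
  proof (rule dependent_nat_choice)
    show "\<exists>L. good L \<and> (0 = (0::nat) \<longrightarrow> L = K)" using K by (auto simp: good_def)
    fix L and n :: nat assume "good L \<and> (n = 0 \<longrightarrow> L = K)"
    then have "compact L" "L \<subseteq> V \<inter> ball 0 \<rho>" by (auto simp: good_def)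
    from compact_hull_step[OF V \<rho> q(1) hull this]
    show "\<exists>L'. (good L' \<and> (Suc n = 0 \<longrightarrow> L' = K)) \<and> (\<exists>D'. splits L L' D')"
      unfolding good_def splits_def by blast
  qed
  then obtain \<K> where \<K>: "\<And>n. good (\<K> n)" "\<K> 0 = K" "\<And>n. \<exists>D'. splits (\<K> n) (\<K> (Suc n)) D'"
    by blast
  from \<K>(3) obtain \<D> where \<D>: "\<And>n. splits (\<K> n) (\<K> (Suc n)) (\<D> n)" by metis
  have "norm (S \<psi>) \<le> 2 * \<eta>"
    if S: "bounded_linear S" and \<eta>: "0 \<le> \<eta>" and small: "\<forall>j. \<forall>d\<in>\<D> j. norm (S d) \<le> \<eta> * b ^ j" and \<psi>: "\<psi> \<in> K"
    for S :: "'b \<Rightarrow> 'c" and \<eta> \<psi>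
  proof -
    interpret S: bounded_linear S by fact
    obtain B where B: "0 \<le> B" "\<And>x. norm (S x) \<le> norm x * B" using S.nonneg_bounded by blast
    have on_hull: "norm (S v) \<le> \<eta> * b ^ j" if "v \<in> convex hull \<D> j" for v j
    proof -
      have "convex hull \<D> j \<subseteq> S -` cball 0 (\<eta> * b ^ j)"
        using small by (intro hull_minimal convex_linear_vimage S.linear convex_cball) auto
      then show ?thesis using that by auto
    qed
    \<comment> \<open>the norm of \<open>S\<close>, through \<open>B\<close>, enters only the remainder, which tends to 0\<close>
    have claim: "norm (S \<psi>) \<le> 2 * \<eta> * b ^ j + B * \<rho> * q ^ n" if "\<psi> \<in> \<K> j" for n j \<psi>
      using that
    proof (induction n arbitrary: j \<psi>)
      case 0
      then have "norm \<psi> \<le> \<rho>" using \<K>(1)[of j] by (auto simp: good_def)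
      then have "norm \<psi> * B \<le> B * \<rho>" using B(1) by (subst mult.commute) (rule mult_left_mono)
      moreover have "0 \<le> 2 * \<eta> * b ^ j" using \<eta> b by simp
      ultimately show ?case using B(2)[of \<psi>] unfolding power_0 mult_1_right by linarith
    next
      case (Suc n)
      then obtain v \<psi>' where v: "v \<in> convex hull \<D> j" "\<psi>' \<in> \<K> (Suc j)" "\<psi> = v + q *\<^sub>R \<psi>'"
        using \<D>[of j] unfolding splits_def by blast
      have "norm (S \<psi>) \<le> norm (S v) + q * norm (S \<psi>')"
        using q(1) norm_triangle_ineq[of "S v" "q *\<^sub>R S \<psi>'"] by (simp add: v(3) S.add S.scaleR)
      also have "\<dots> \<le> \<eta> * b ^ j + q * (2 * \<eta> * b ^ Suc j + B * \<rho> * q ^ n)"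
        using on_hull[OF v(1)] Suc.IH[OF v(2)] q(1) by (intro add_mono mult_left_mono) auto
      also have "q * (2 * \<eta> * b ^ Suc j + B * \<rho> * q ^ n) = 2 * \<eta> * b ^ j * (q * b) + B * \<rho> * q ^ Suc n"
        by (simp add: algebra_simps)
      finally show ?case by (simp add: q(3))
    qed
    have "(\<lambda>n. 2 * \<eta> * b ^ 0 + B * \<rho> * q ^ n) \<longlonglongrightarrow> 2 * \<eta> * b ^ 0 + B * \<rho> * 0"
      using q by (intro tendsto_intros LIMSEQ_power_zero) auto
    then have "norm (S \<psi>) \<le> 2 * \<eta> * b ^ 0 + B * \<rho> * 0"
      by (rule LIMSEQ_le_const) (use claim[of \<psi> 0] \<psi> \<K>(2) in auto)
    then show ?thesis by simp
  qed
  then show ?thesis using \<D> unfolding splits_def by (intro exI[of _ \<D>]) blast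
qed

lemma compact_shrinking_finite_sets:
  fixes X :: "nat \<Rightarrow> 'a::real_normed_vector set"
  assumes "\<And>j. finite (X j)" "\<And>j x. x \<in> X j \<Longrightarrow> norm x \<le> 1"
  shows "compact (insert 0 (\<Union>j. (\<lambda>x. (1 / 2) ^ j *\<^sub>R x) ` X j))"
proof (rule compactI)
  fix \<C> assume op: "\<forall>U\<in>\<C>. open U" and cover: "insert 0 (\<Union>j. (\<lambda>x. (1 / 2) ^ j *\<^sub>R x) ` X j) \<subseteq> \<Union>\<C>"
  then obtain U where U: "U \<in> \<C>" "0 \<in> U" by auto
  then obtain e where e: "0 < e" "ball 0 e \<subseteq> U" using op by (metis open_contains_ball)
  obtain N where N: "(1 / 2) ^ N < e" using real_arch_pow_inv[OF e(1), of "1 / 2"] by auto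
  have far: "(1 / 2) ^ j *\<^sub>R x \<in> U" if "N \<le> j" "x \<in> X j" for j x
  proof -
    have "norm ((1 / 2) ^ j *\<^sub>R x) \<le> (1 / 2) ^ j * 1"
      using assms(2)[OF that(2)] by (simp add: divide_right_mono)
    also have "\<dots> \<le> (1 / 2) ^ N" using that(1) by (simp add: power_decreasing)
    finally show ?thesis using N e(2) by (auto simp: subset_iff)
  qed
  define Y where "Y = (\<Union>j<N. (\<lambda>x. (1 / 2) ^ j *\<^sub>R x) ` X j)"
  have "finite Y" using assms(1) by (simp add: Y_def)
  moreover have "\<forall>y\<in>Y. \<exists>V\<in>\<C>. y \<in> V" using cover by (auto simp: Y_def)
  then obtain V where V: "\<And>y. y \<in> Y \<Longrightarrow> V y \<in> \<C> \<and> y \<in> V y" by metis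
  have "y \<in> \<Union>(insert U (V ` Y))" if "y \<in> insert 0 (\<Union>j. (\<lambda>x. (1 / 2) ^ j *\<^sub>R x) ` X j)" for y
  proof (cases "y = 0")
    case False
    then have "y \<in> (\<Union>j. (\<lambda>x. (1 / 2) ^ j *\<^sub>R x) ` X j)" using that by blast
    then obtain j x where jx: "x \<in> X j" "y = (1 / 2) ^ j *\<^sub>R x" by blast
    show ?thesis
    proof (cases "j < N")
      case True
      then have "y \<in> Y" using jx by (auto simp: Y_def)
      then show ?thesis using V by auto
    next
      case False
      then show ?thesis using far[of j x] jx by simp
    qed
  qed (use U in simp)
  then have "insert 0 (\<Union>j. (\<lambda>x. (1 / 2) ^ j *\<^sub>R x) ` X j) \<subseteq> \<Union>(insert U (V ` Y))" by blast
  moreover have "finite (insert U (V ` Y))" "insert U (V ` Y) \<subseteq> \<C>"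
    using \<open>finite Y\<close> V U(1) by auto
  ultimately show "\<exists>\<C>'\<subseteq>\<C>. finite \<C>' \<and> insert 0 (\<Union>j. (\<lambda>x. (1 / 2) ^ j *\<^sub>R x) ` X j) \<subseteq> \<Union>\<C>'"
    by blast
qed

section \<open>The approximation property\<close>

lemma finite_rank_zero: "finite_rank (\<lambda>x. 0)"
  unfolding finite_rank_def by (intro exI[of _ "{}"]) auto

lemma finite_rank_add:
  assumes "finite_rank S" "finite_rank T"
  shows "finite_rank (\<lambda>x. S x + T x)"
proof -
  obtain B C where BC: "finite B" "range S \<subseteq> cspan B" "finite C" "range T \<subseteq> cspan C"
    using assms unfolding finite_rank_def by blast
  have "S x + T x \<in> cspan (B \<union> C)" for x
    using BC(2,4) complex_vector.span_mono[of B "B \<union> C"] complex_vector.span_mono[of C "B \<union> C"]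
    by (intro complex_vector.span_add) (auto simp: subset_iff)
  then show ?thesis unfolding finite_rank_def using BC(1,3) by (intro exI[of _ "B \<union> C"]) auto
qed

lemma finite_rank_compose_left:
  assumes L: "bounded_clinear L" and T: "finite_rank T"
  shows "finite_rank (\<lambda>x. L (T x))"
proof -
  obtain B where B: "finite B" "range T \<subseteq> cspan B" using T unfolding finite_rank_def by blast
  have "L v \<in> cspan (L ` B)" if "v \<in> cspan B" for v
    using that
  proof (induction rule: complex_vector.span_induct_alt)
    case base
    then show ?case by (simp add: bounded_clinearD[OF L] complex_vector.span_zero)
  next
    case (step c x y)
    then show ?case
      by (auto simp: bounded_clinearD[OF L] intro!: complex_vector.span_add complex_vector.span_scale
          intro: complex_vector.span_base)
  qed
  then show ?thesis unfolding finite_rank_def using B by (intro exI[of _ "L ` B"]) auto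
qed

lemma finite_rank_compose_right: "finite_rank S \<Longrightarrow> finite_rank (\<lambda>x. S (T x))"
proof -
  assume "finite_rank S"
  then obtain B where "finite B" "range S \<subseteq> cspan B" unfolding finite_rank_def by blast
  moreover have "range (\<lambda>x. S (T x)) \<subseteq> range S" by auto
  ultimately show ?thesis unfolding finite_rank_def by (intro exI[of _ B]) simp
qed

lemma bounded_clinear_add_fun:
  "bounded_clinear S \<Longrightarrow> bounded_clinear T \<Longrightarrow> bounded_clinear (\<lambda>x. S x + T x)"
  by (simp add: bounded_clinear_def bounded_linear_add scaleC_add_right)

lemma bounded_clinear_id: "bounded_clinear (\<lambda>x. x)"
  by (simp add: bounded_clinear_def)

lemma bounded_clinear_scaleR_const: "bounded_clinear (\<lambda>x. r *\<^sub>R x)"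
  unfolding scaleR_scaleC by (rule bounded_clinear_scaleC_const)

lemma hpoly_scaleR:
  assumes "0 < t"
  shows "hpoly k (t *\<^sub>R y) = t ^ k *\<^sub>R hpoly k y"
proof -
  define s where "s = 1 / (1 + norm (t *\<^sub>R y))"
  have n: "0 < 1 + norm (t *\<^sub>R y)" by (simp add: add_pos_nonneg)
  have s: "0 < s" "s * norm (t *\<^sub>R y) < 1" unfolding s_def using n by (simp_all only: zero_less_divide_1_iff) simp
  have "hpoly k (t *\<^sub>R y) = (1 / s) ^ k *\<^sub>R hproj k (delta (s *\<^sub>R t *\<^sub>R y))"
    by (rule hpoly_eq[OF s])
  moreover have "hpoly k y = (1 / (s * t)) ^ k *\<^sub>R hproj k (delta ((s * t) *\<^sub>R y))"
    using s assms by (intro hpoly_eq) auto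
  ultimately show ?thesis
    using assms by (simp add: power_mult_distrib[symmetric])
qed

lemma hpoly_lipschitz:
  assumes "norm x < 4" "norm y < 4"
  shows "norm (hpoly k x - hpoly k y) \<le> 4 ^ k * norm (x - y)"
proof -
  have "hpoly k v = 4 ^ k *\<^sub>R hproj k (delta ((1 / 4) *\<^sub>R v))" if "norm v < 4" for v :: 'a
    using hpoly_eq[of "1 / 4" v k] that by simp
  then have "hpoly k x - hpoly k y = 4 ^ k *\<^sub>R hproj k (delta ((1 / 4) *\<^sub>R x) - delta ((1 / 4) *\<^sub>R y))"
    using assms by (simp add: bounded_clinear_diff[OF bounded_clinear_hproj] scaleR_right_diff_distrib)
  then have "norm (hpoly k x - hpoly k y) = 4 ^ k * norm (hproj k (delta ((1 / 4) *\<^sub>R x) - delta ((1 / 4) *\<^sub>R y)))"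
    by simp
  also have "\<dots> \<le> 4 ^ k * norm ((1 / 4) *\<^sub>R x - (1 / 4) *\<^sub>R y)"
    using assms by (intro mult_left_mono order_trans[OF norm_hproj norm_delta_diff]) auto
  also have "\<dots> \<le> 4 ^ k * norm (x - y)"
    by (intro mult_left_mono) (simp_all flip: scaleR_right_diff_distrib)
  finally show ?thesis .
qed

text \<open>Let \<open>T\<close> be a finite-rank operator that is close to the identity on a compact set \<open>C\<close>, and let \<open>s\<close> be so
  small that \<open>A = s T\<close> is a contraction. Then \<open>U = s\<^sup>-\<^sup>k (hproj k \<circ> g0_map A)\<close> has finite rank and, by
  homogeneity, does not depend on \<open>s\<close>: it maps \<open>delta x\<close> to \<open>hpoly k (T x)\<close>. The set \<open>C\<close> is chosen
  such that \<open>U\<close> is close to the identity, with the weights of \<open>compact_absorbed_by_hull\<close>, on the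
  vectors that control the image of \<open>K\<close> under \<open>hproj k\<close>.\<close>

lemma approximate_hproj:
  fixes K :: "'a::complex_banach g0 set"
  assumes ap: "approximation_property TYPE('a)" and K: "compact K" and e: "0 < e"
  shows "\<exists>U. bounded_clinear U \<and> finite_rank U \<and> (\<forall>\<phi>\<in>K. norm (U \<phi> - hproj k \<phi>) < e)"
proof -
  define V where "V = {\<psi> :: 'a g0. hproj k \<psi> = \<psi>}"
  define D where "D = {c *\<^sub>C hproj k (delta x) | c (x::'a). cmod c \<le> 1 \<and> norm x < 1}"
  note lin_h = bounded_clinear_hproj[of k]
  have V: "subspace V"
    unfolding V_def subspace_def
    by (auto simp: bounded_clinearD[OF lin_h] scaleR_scaleC)
  have DV: "D \<subseteq> V"
    unfolding D_def V_def by (auto simp: bounded_clinear_scaleC[OF lin_h] hproj_idem)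
  define \<rho> where "\<rho> = 1 / (2::real) ^ k"
  have \<rho>: "0 < \<rho>" by (simp add: \<rho>_def)
  have hull: "\<psi> \<in> closure (convex hull D)" if "\<psi> \<in> V" "norm \<psi> < \<rho>" for \<psi>
    using homogeneous_ball_subset_hull[of k \<psi>] that by (simp add: V_def D_def \<rho>_def)
  obtain M where M: "0 < M" "\<And>\<phi>. \<phi> \<in> K \<Longrightarrow> norm \<phi> \<le> M"
    using compact_imp_bounded[OF K] unfolding bounded_pos by blast
  define a where "a = \<rho> / (2 * M)"
  have a: "0 < a" "a * M < \<rho>" using M(1) \<rho> by (auto simp: a_def)
  define K1 where "K1 = (\<lambda>\<phi>. a *\<^sub>R hproj k \<phi>) ` K"
  have "compact K1"
    unfolding K1_def
    by (intro compact_continuous_image K continuous_intros linear_continuous_on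
        bounded_clinear_bounded_linear[OF lin_h])
  moreover have "K1 \<subseteq> V \<inter> ball 0 \<rho>"
  proof (unfold K1_def, rule image_subsetI)
    fix \<phi> assume \<phi>: "\<phi> \<in> K"
    have "norm (a *\<^sub>R hproj k \<phi>) \<le> a * M"
      using a(1) order_trans[OF norm_hproj M(2)[OF \<phi>]] by (simp add: mult_left_mono)
    then show "a *\<^sub>R hproj k \<phi> \<in> V \<inter> ball 0 \<rho>"
      using a by (simp add: V_def scaleR_scaleC bounded_clinear_scaleC[OF lin_h] hproj_idem)
  qed
  ultimately have "\<exists>\<D>. (\<forall>j::nat. finite (\<D> j) \<and> \<D> j \<subseteq> D) \<and>
    (\<forall>(S :: 'a g0 \<Rightarrow> 'a g0) \<eta>. bounded_linear S \<longrightarrow> 0 \<le> \<eta> \<longrightarrow>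
      (\<forall>j. \<forall>d\<in>\<D> j. norm (S d) \<le> \<eta> * (2 ^ k) ^ j) \<longrightarrow> (\<forall>\<psi>\<in>K1. norm (S \<psi>) \<le> 2 * \<eta>))"
    by (intro compact_absorbed_by_hull[OF V DV \<rho> _ hull]) (auto simp: one_le_power)
  then obtain \<D> where \<D>: "\<forall>j::nat. finite (\<D> j) \<and> \<D> j \<subseteq> D"
    and absorb: "\<forall>(S :: 'a g0 \<Rightarrow> 'a g0) \<eta>. bounded_linear S \<longrightarrow> 0 \<le> \<eta> \<longrightarrow>
      (\<forall>j. \<forall>d\<in>\<D> j. norm (S d) \<le> \<eta> * (2 ^ k) ^ j) \<longrightarrow> (\<forall>\<psi>\<in>K1. norm (S \<psi>) \<le> 2 * \<eta>)"
    by (elim exE conjE)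
  have "\<forall>d\<in>D. \<exists>c x. d = c *\<^sub>C hproj k (delta x) \<and> cmod c \<le> 1 \<and> norm x < 1"
    unfolding D_def by blast
  then obtain cf pt where cfpt: "\<And>d. d \<in> D \<Longrightarrow> d = cf d *\<^sub>C hproj k (delta (pt d :: 'a)) \<and>
      cmod (cf d) \<le> 1 \<and> norm (pt d) < 1" by metis
  \<comment> \<open>an error at \<open>(1 / 2) ^ j *\<^sub>R x\<close> becomes \<open>(2 ^ k) ^ j\<close> times as large at \<open>x\<close>, which is just what is permitted on \<open>\<D> j\<close>\<close>
  define C where "C = insert 0 (\<Union>j. (\<lambda>x. (1 / 2) ^ j *\<^sub>R x) ` (pt ` \<D> j))"
  have "compact C"
    unfolding C_def
  proof (rule compact_shrinking_finite_sets)
    show "finite (pt ` \<D> j)" for j using \<D> by blast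
    show "norm x \<le> 1" if "x \<in> pt ` \<D> j" for j x
      using that \<D> cfpt by (force intro: less_imp_le)
  qed
  define \<eta> where "\<eta> = e * a / 4"
  \<comment> \<open>\<open>\<tau> \<le> 1\<close> keeps \<open>T y\<close> in the ball of radius 4, on which \<open>hpoly k\<close> has Lipschitz constant \<open>4 ^ k\<close>\<close>
  define \<tau> where "\<tau> = min 1 (\<eta> / 4 ^ k)"
  have \<eta>: "0 < \<eta>" using e a(1) by (simp add: \<eta>_def)
  have \<tau>: "0 < \<tau>" "\<tau> \<le> 1" "4 ^ k * \<tau> \<le> \<eta>" using \<eta> by (auto simp: \<tau>_def min_def field_simps)
  from ap[unfolded approximation_property_def, rule_format, OF \<open>compact C\<close> \<tau>(1)]
  obtain T :: "'a \<Rightarrow> 'a" where T: "bounded_clinear T" "finite_rank T" "\<forall>y\<in>C. norm (T y - y) < \<tau>"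
    by (elim exE conjE)
  obtain B where B: "0 \<le> B" "\<And>x. norm (T x) \<le> norm x * B"
    using bounded_linear.nonneg_bounded[OF bounded_clinear_bounded_linear[OF T(1)]] by blast
  define s where "s = 1 / (B + 1)"
  have s: "0 < s" "s * B < 1" using B(1) by (auto simp: s_def field_simps)
  define A where "A x = s *\<^sub>R T x" for x
  have norm_A: "norm (A x) \<le> (s * B) * norm x" for x
    using s(1) mult_left_mono[OF B(2)[of x], of s] by (simp add: A_def mult_ac)
  have A_le: "norm (A x) \<le> norm x" for x
    using norm_A[of x] s(2) by (smt (verit) mult_left_le_one_le mult_nonneg_nonneg B(1) s(1) norm_ge_zero)
  have A: "contraction A" "finite_rank A"
    unfolding contraction_def using A_le
    by (auto simp: A_def[abs_def] intro: bounded_clinear_compose[OF bounded_clinear_scaleR_const T(1)]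
      finite_rank_compose_left[OF bounded_clinear_scaleR_const T(2)])
  define U where "U \<phi> = (1 / s) ^ k *\<^sub>R hproj k (g0_map A \<phi>)" for \<phi>
  have lin_U: "bounded_clinear U"
    unfolding U_def[abs_def]
    by (rule bounded_clinear_compose[OF bounded_clinear_scaleR_const
      bounded_clinear_compose[OF lin_h bounded_clinear_g0_map[OF A(1)]]])
  have rank_U: "finite_rank U"
    unfolding U_def[abs_def]
    by (rule finite_rank_compose_left[OF bounded_clinear_scaleR_const finite_rank_hproj_g0_map[OF A]])
  have U_hproj: "U (hproj k \<phi>) = U \<phi>" for \<phi>
    by (simp add: U_def g0_map_hproj[OF A(1)] hproj_idem)
  have U_delta: "U (delta x) = hpoly k (T x)" if x: "norm x < 1" for x
  proof -
    have "norm (T x) \<le> B" using B x by (smt (verit) mult_left_le_one_le norm_ge_zero)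
    then have "s * norm (T x) < 1" using s by (smt (verit) mult_left_mono)
    then have "hpoly k (T x) = (1 / s) ^ k *\<^sub>R hproj k (delta (s *\<^sub>R T x))"
      by (rule hpoly_eq[OF s(1)])
    then show ?thesis using x by (simp add: U_def g0_map_delta[OF A(1)] A_def)
  qed
  have lin_S: "bounded_linear (\<lambda>\<psi>. \<psi> - U \<psi>)"
    by (intro bounded_linear_sub bounded_linear_ident bounded_clinear_bounded_linear lin_U)
  have "\<forall>j. \<forall>d\<in>\<D> j. norm (d - U d) \<le> \<eta> * (2 ^ k) ^ j"
  proof (intro allI ballI)
    fix j d assume d: "d \<in> \<D> j"
    define x where "x = pt d"
    have d': "d = cf d *\<^sub>C hproj k (delta x)" "cmod (cf d) \<le> 1" "norm x < 1"
      using cfpt[of d] \<D> d by (auto simp: x_def)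
    define y where "y = (1 / 2) ^ j *\<^sub>R x"
    have y: "y \<in> C" "norm y < 4"
    proof -
      show "y \<in> C" using d by (auto simp: C_def y_def x_def)
      have "norm y \<le> 1 * norm x"
        unfolding y_def norm_scaleR by (intro mult_right_mono) (auto simp: power_le_one)
      then show "norm y < 4" using d'(3) by simp
    qed
    have Ty: "norm (T y - y) \<le> \<tau>" using T(3) y(1) by force
    have "norm y \<le> 1"
      using d'(3) mult_right_mono[of "(1/2)^j" 1 "norm x"] by (simp add: y_def power_le_one)
    then have "norm (T y) < 4"
      using Ty \<tau>(2) norm_triangle_sub[of "T y" y] by simp
    have x_eq: "x = 2 ^ j *\<^sub>R y" by (simp add: y_def power_divide)
    have Tx_eq: "T x = 2 ^ j *\<^sub>R T y"
      by (simp add: x_eq scaleR_scaleC bounded_clinear_scaleC[OF T(1)])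
    have "U (hproj k (delta x)) = hpoly k (T x)" by (simp add: U_hproj U_delta[OF d'(3)])
    then have "hproj k (delta x) - U (hproj k (delta x)) = (2 ^ j) ^ k *\<^sub>R (hpoly k y - hpoly k (T y))"
      using hpoly_inside[OF d'(3), of k] hpoly_scaleR[of "2 ^ j" k y] hpoly_scaleR[of "2 ^ j" k "T y"]
      by (simp add: x_eq[symmetric] Tx_eq[symmetric] scaleR_right_diff_distrib)
    then have "norm (hproj k (delta x) - U (hproj k (delta x))) = (2 ^ j) ^ k * norm (hpoly k y - hpoly k (T y))"
      by simp
    also have "\<dots> \<le> (2 ^ j) ^ k * (4 ^ k * norm (y - T y))"
      by (intro mult_left_mono hpoly_lipschitz y \<open>norm (T y) < 4\<close>) auto
    also have "\<dots> \<le> (2 ^ j) ^ k * \<eta>"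
    proof (rule mult_left_mono)
      have "4 ^ k * norm (y - T y) \<le> 4 ^ k * \<tau>" using Ty by (simp add: norm_minus_commute)
      then show "4 ^ k * norm (y - T y) \<le> \<eta>" using \<tau>(3) by linarith
    qed simp
    finally have *: "norm (hproj k (delta x) - U (hproj k (delta x))) \<le> \<eta> * (2 ^ k) ^ j"
      by (simp add: mult.commute flip: power_mult)
    have "d - U d = cf d *\<^sub>C (hproj k (delta x) - U (hproj k (delta x)))"
      by (subst (1 2) d'(1)) (simp add: bounded_clinear_scaleC[OF lin_U] complex_vector.scale_right_diff_distrib)
    then have "norm (d - U d) \<le> 1 * norm (hproj k (delta x) - U (hproj k (delta x)))"
      unfolding norm_scaleC using d'(2) by (metis mult_right_mono norm_ge_zero norm_scaleC)
    with * show "norm (d - U d) \<le> \<eta> * (2 ^ k) ^ j" by simp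
  qed
  from absorb[rule_format, OF lin_S _ this[rule_format]] \<eta> have small: "norm (\<psi> - U \<psi>) \<le> 2 * \<eta>" if "\<psi> \<in> K1" for \<psi>
    using that by simp
  have "norm (U \<phi> - hproj k \<phi>) < e" if \<phi>: "\<phi> \<in> K" for \<phi>
  proof -
    have "a *\<^sub>R hproj k \<phi> \<in> K1" unfolding K1_def using \<phi> by (rule imageI)
    from small[OF this] have "norm (a *\<^sub>R (hproj k \<phi> - U \<phi>)) \<le> 2 * \<eta>"
      by (simp add: scaleR_scaleC bounded_clinear_scaleC[OF lin_U] U_hproj complex_vector.scale_right_diff_distrib)
    then have "a * norm (U \<phi> - hproj k \<phi>) \<le> e * a / 2"
      using a(1) by (simp add: \<eta>_def norm_minus_commute)
    then have "norm (U \<phi> - hproj k \<phi>) \<le> e / 2" using a(1) by (simp add: field_simps)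
    then show ?thesis using e by simp
  qed
  with lin_U rank_U show ?thesis by blast
qed

text \<open>Approximate the identity by a dilation, the dilation by a partial sum of its expansion into
  homogeneous components, and each component by an operator of finite rank.\<close>

lemma approximation_property_g0:
  assumes ap: "approximation_property TYPE('a::complex_banach)"
  shows "approximation_property TYPE('a g0)"
  unfolding approximation_property_def
proof (intro allI impI)
  fix K :: "'a g0 set" and e :: real assume K: "compact K" and e: "0 < e"
  obtain r where r: "0 \<le> r" "r < 1" "\<And>\<phi>. \<phi> \<in> K \<Longrightarrow> norm (dilation (complex_of_real r) \<phi> - \<phi>) < e / 3"
    using dilation_approximates_identity[OF K, of "e / 3"] e by auto
  obtain M where M: "0 < M" "\<And>\<phi>. \<phi> \<in> K \<Longrightarrow> norm \<phi> \<le> M"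
    using compact_imp_bounded[OF K] unfolding bounded_pos by blast
  have "(\<lambda>N. r ^ N / (1 - r) * M) \<longlonglongrightarrow> 0 / (1 - r) * M"
    using r by (intro tendsto_intros LIMSEQ_power_zero) auto
  then have "(\<lambda>N. r ^ N / (1 - r) * M) \<longlonglongrightarrow> 0" by simp
  from order_tendstoD(2)[OF this, of "e / 3"] obtain N where N: "r ^ N / (1 - r) * M < e / 3"
    using e by (auto simp: eventually_sequentially)
  define \<epsilon> where "\<epsilon> = e / (3 * (real N + 1))"
  have \<epsilon>: "0 < \<epsilon>" "real N * \<epsilon> < e / 3" using e by (auto simp: \<epsilon>_def field_simps)
  have "\<forall>k. \<exists>U. bounded_clinear U \<and> finite_rank U \<and> (\<forall>\<phi>\<in>K. norm (U \<phi> - hproj k \<phi>) < \<epsilon>)"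
    using approximate_hproj[OF ap K \<epsilon>(1)] by blast
  then obtain U where U: "\<And>k. bounded_clinear (U k)" "\<And>k. finite_rank (U k)"
    "\<And>k \<phi>. \<phi> \<in> K \<Longrightarrow> norm (U k \<phi> - hproj k \<phi>) < \<epsilon>" by metis
  define T where "T \<phi> = (\<Sum>k<N. r ^ k *\<^sub>R U k \<phi>)" for \<phi>
  have "bounded_clinear (\<lambda>\<phi>. \<Sum>k<n. r ^ k *\<^sub>R U k \<phi>)" "finite_rank (\<lambda>\<phi>. \<Sum>k<n. r ^ k *\<^sub>R U k \<phi>)" for n
  proof (induction n)
    case 0
    { case 1 show ?case by (simp add: bounded_clinear_def) }
    { case 2 show ?case by (simp add: finite_rank_zero) }
  next
    case (Suc n)
    { case 1 show ?case
        using Suc(1) bounded_clinear_compose[OF bounded_clinear_scaleR_const U(1)]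
        by (simp add: bounded_clinear_add_fun) }
    { case 2 show ?case
        using Suc(2) finite_rank_compose_left[OF bounded_clinear_scaleR_const U(2)]
        by (simp add: finite_rank_add) }
  qed
  then have "bounded_clinear T" "finite_rank T" by (simp_all add: T_def[abs_def])
  moreover have "norm (T \<phi> - \<phi>) < e" if \<phi>: "\<phi> \<in> K" for \<phi>
  proof -
    define P where "P = (\<Sum>k<N. r ^ k *\<^sub>R hproj k \<phi>)"
    have "norm (T \<phi> - P) = norm (\<Sum>k<N. r ^ k *\<^sub>R (U k \<phi> - hproj k \<phi>))"
      by (simp add: T_def P_def scaleR_right_diff_distrib sum_subtractf)
    also have "\<dots> \<le> (\<Sum>k<N. \<epsilon>)"
    proof (rule sum_norm_le)
      fix k
      have "r ^ k * norm (U k \<phi> - hproj k \<phi>) \<le> 1 * \<epsilon>"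
        using r U(3)[OF \<phi>, of k] by (intro mult_mono) (auto simp: power_le_one)
      then show "norm (r ^ k *\<^sub>R (U k \<phi> - hproj k \<phi>)) \<le> \<epsilon>" using r by simp
    qed
    also have "\<dots> < e / 3" using \<epsilon>(2) by simp
    finally have 1: "norm (T \<phi> - P) < e / 3" .
    have "norm (dilation (complex_of_real r) \<phi> - P) \<le> r ^ N / (1 - r) * norm \<phi>"
      unfolding P_def by (rule dilation_partial_sum[OF r(1,2)])
    also have "\<dots> \<le> r ^ N / (1 - r) * M" using r M(2)[OF \<phi>] by (intro mult_left_mono) auto
    finally have 2: "norm (dilation (complex_of_real r) \<phi> - P) < e / 3" using N by linarith
    let ?d = "dilation (complex_of_real r) \<phi>"
    have "norm (T \<phi> - \<phi>) = norm (((T \<phi> - P) - (?d - P)) + (?d - \<phi>))" by simp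
    also have "\<dots> \<le> norm ((T \<phi> - P) - (?d - P)) + norm (?d - \<phi>)" by (rule norm_triangle_ineq)
    also have "\<dots> \<le> norm (T \<phi> - P) + norm (?d - P) + norm (?d - \<phi>)"
      by (intro add_right_mono norm_triangle_ineq4)
    finally show ?thesis using 1 2 r(3)[OF \<phi>] by linarith
  qed
  ultimately show "\<exists>T. bounded_clinear T \<and> finite_rank T \<and> (\<forall>\<phi>\<in>K. norm (T \<phi> - \<phi>) < e)" by blast
qed

text \<open>\<open>P\<close> is the linearization of the inclusion of the ball and \<open>J\<close> is the derivative of \<open>delta\<close> at 0;
  differentiating \<open>P (delta x) = x\<close> at 0 gives \<open>P (J x) = x\<close>.\<close>

lemma g0_retraction:
  "\<exists>(J :: 'a::complex_banach \<Rightarrow> 'a g0) P. bounded_clinear J \<and> bounded_clinear P \<and>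
    (\<forall>\<phi>. norm (P \<phi>) \<le> norm \<phi>) \<and> (\<forall>x. P (J x) = x)"
proof -
  have "frechet_holomorphic_on (\<lambda>x::'a. x) (ball 0 1)"
    unfolding frechet_holomorphic_on_def using bounded_clinear_id has_derivative_ident by blast
  then have "\<exists>P :: 'a g0 \<Rightarrow> 'a. bounded_clinear P \<and> (\<forall>x. norm x < 1 \<longrightarrow> P (delta x) = x) \<and>
      (\<forall>\<phi>. norm (P \<phi>) \<le> 1 * norm \<phi>)"
    by (rule linearization) auto
  then obtain P :: "'a g0 \<Rightarrow> 'a" where P: "bounded_clinear P" "\<And>x. norm x < 1 \<Longrightarrow> P (delta x) = x"
    "\<And>\<phi>. norm (P \<phi>) \<le> norm \<phi>" by auto
  have "(0::'a) \<in> ball 0 1" by simp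
  then obtain J :: "'a \<Rightarrow> 'a g0" where J: "bounded_clinear J" "(delta has_derivative J) (at 0)"
    using frechet_holomorphic_delta unfolding frechet_holomorphic_on_def by blast
  have "((\<lambda>x. P (delta x)) has_derivative (\<lambda>x. P (J x))) (at 0)"
    by (rule bounded_linear.has_derivative[OF bounded_clinear_bounded_linear[OF P(1)] J(2)])
  then have "((\<lambda>x. x) has_derivative (\<lambda>x. P (J x))) (at 0)"
    by (rule has_derivative_transform_within_open[of _ _ _ _ "ball 0 1"]) (auto simp: P(2))
  then have "(\<lambda>x. P (J x)) = (\<lambda>x. x)"
    using has_derivative_unique has_derivative_ident by blast
  then have "\<forall>x. P (J x) = x" by metis
  with P J show ?thesis by blast
qed

lemma approximation_property_of_g0:
  assumes ap: "approximation_property TYPE('a::complex_banach g0)"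
  shows "approximation_property TYPE('a)"
  unfolding approximation_property_def
proof (intro allI impI)
  fix K :: "'a set" and e :: real assume K: "compact K" and e: "0 < e"
  obtain J :: "'a \<Rightarrow> 'a g0" and P where JP: "bounded_clinear J" "bounded_clinear P"
    "\<forall>\<phi>. norm (P \<phi>) \<le> norm \<phi>" "\<forall>x. P (J x) = x"
    using g0_retraction[where 'a = 'a] by (elim exE conjE)
  have "compact (J ` K)"
    by (intro compact_continuous_image K linear_continuous_on bounded_clinear_bounded_linear JP(1))
  from ap[unfolded approximation_property_def, rule_format, OF this e]
  obtain T :: "'a g0 \<Rightarrow> 'a g0" where T: "bounded_clinear T" "finite_rank T"
    "\<forall>\<phi>\<in>J ` K. norm (T \<phi> - \<phi>) < e"
    by (elim exE conjE)
  have "bounded_clinear (\<lambda>x. P (T (J x)))"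
    by (rule bounded_clinear_compose[OF JP(2) bounded_clinear_compose[OF T(1) JP(1)]])
  moreover have "finite_rank (\<lambda>x. P (T (J x)))"
    by (rule finite_rank_compose_left[OF JP(2) finite_rank_compose_right[OF T(2)]])
  moreover have "norm (P (T (J x)) - x) < e" if "x \<in> K" for x
  proof -
    have "norm (P (T (J x)) - x) = norm (P (T (J x) - J x))"
      by (simp add: bounded_clinear_diff[OF JP(2)] JP(4))
    also have "\<dots> \<le> norm (T (J x) - J x)" by (rule JP(3)[rule_format])
    also have "\<dots> < e" using T(3) that by simp
    finally show ?thesis .
  qed
  ultimately show "\<exists>T. bounded_clinear T \<and> finite_rank T \<and> (\<forall>x\<in>K. norm (T x - x) < e)" by blast
qed

theorem theorem3p10:
  shows "approximation_property TYPE('a::complex_banach) \<longleftrightarrow>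
    approximation_property TYPE('a g0)"
  using approximation_property_g0 approximation_property_of_g0 by blast

end
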